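(* Let $K$ be a convex polytope in $\mathbb{R}^d$ with nonempty interior, and let $\varepsilon>0$; consider $d$, $K$ and $\varepsilon$ as fixed. There is a randomized algorithm which, given a nonempty polytope $P\subset\mathbb{R}^d$ presented as an intersection of $n$ half-spaces, runs in $O(n)$ expected time (with the implied constant depending only on $d$, $K$ and $\varepsilon$) and outputs an approximation of $\alpha(K,P)$ with relative error at most $\varepsilon$, i.e. a number $\beta$ with $|\beta-\alpha(K,P)|\le\varepsilon\,\alpha(K,P)$.
   Context: $O(d)$ in "$A\in O(d)$" denotes the group of orthogonal $d\times d$ matrices (not to be confused with the asymptotic notation $O(n)$), and $AK=\{Ax:x\in K\}$. For compact convex sets $K,P\subset\mathbb{R}^d$, $$\alpha(K,P)=\max\{\alpha : a+\alpha AK\subset P \text{ for some } a\in\mathbb{R}^d,\ A\in O(d)\}$$ is the scaling factor of the largest scaled isometric copy of $K$ contained in $P$. Polytopes are bounded. Running time counts elementary operations in the unit-cost real-number (real RAM) model; the expectation is over the random choices of the algorithm, for every input $P$. *)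

theory Defs
  imports "HOL-Analysis.Analysis" "HOL-Probability.Probability"
begin

text \<open>The maximum is attained if \<open>P\<close> is nonempty and compact and \<open>K\<close> has at least two points;
  otherwise \<open>GREATEST\<close> need not be meaningful.\<close>

definition alpha :: "(real ^ 'd::finite) set \<Rightarrow> (real ^ 'd) set \<Rightarrow> real" where
  "alpha K P = (GREATEST r. \<exists>a A. orthogonal_matrix A \<and>
     (\<lambda>x. a + r *\<^sub>R (A *v x)) ` K \<subseteq> P)"

text \<open>The pair \<open>(a, b)\<close> stands for the half-space \<open>{x. a \<bullet> x \<le> b}\<close>; it is proper if \<open>a \<noteq> 0\<close>.\<close>

definition halfspaces_Int :: "((real ^ 'd::finite) \<times> real) list \<Rightarrow> (real ^ 'd) set" where
  "halfspaces_Int hs = (\<Inter>(a, b)\<in>set hs. {x. a \<bullet> x \<le> b})"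

text \<open>
  Programs run on a randomized unit-cost real RAM. The machine has a memory of natural numbers,
  used for counting and addressing, and a memory of exact reals. There is no conversion from reals
  to naturals (in particular no rounding). Programs are finite and may contain arbitrary real
  constants. They are presented in structured form; jumps instead of loops would change running
  times by constant factors only.
\<close>

type_synonym state = "(nat \<Rightarrow> nat) \<times> (nat \<Rightarrow> real)"

text \<open>In either memory, an indirect address is looked up in the memory of natural numbers.\<close>

datatype loc = Dir nat | Ind nat

fun addr :: "state \<Rightarrow> loc \<Rightarrow> nat" where
  "addr s (Dir i) = i"
| "addr s (Ind i) = fst s i"

definition nat_at :: "state \<Rightarrow> loc \<Rightarrow> nat" where
  "nat_at s l = fst s (addr s l)"

definition real_at :: "state \<Rightarrow> loc \<Rightarrow> real" where
  "real_at s l = snd s (addr s l)"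

definition put_nat :: "loc \<Rightarrow> nat \<Rightarrow> state \<Rightarrow> state" where
  "put_nat l v s = ((fst s)(addr s l := v), snd s)"

definition put_real :: "loc \<Rightarrow> real \<Rightarrow> state \<Rightarrow> state" where
  "put_real l v s = (fst s, (snd s)(addr s l := v))"

datatype test = NLess loc loc | NLeq loc loc | RLess loc loc | RLeq loc loc

fun holds :: "test \<Rightarrow> state \<Rightarrow> bool" where
  "holds (NLess x y) s \<longleftrightarrow> nat_at s x < nat_at s y"
| "holds (NLeq x y) s \<longleftrightarrow> nat_at s x \<le> nat_at s y"
| "holds (RLess x y) s \<longleftrightarrow> real_at s x < real_at s y"
| "holds (RLeq x y) s \<longleftrightarrow> real_at s x \<le> real_at s y"

datatype prog =
    Skip
  | NConst loc nat
  | NCopy loc loc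
  | NAdd loc loc loc
  | NSub loc loc loc
  | NRand loc loc
  | RConst loc real
  | RCopy loc loc
  | RAdd loc loc loc
  | RSub loc loc loc
  | RMul loc loc loc
  | RDiv loc loc loc
  | Seq prog prog
  | Cond test prog prog
  | While test prog

text \<open>
  One step performs at most one operation, comparison or random choice. The first argument of an
  assignment is its target. \<open>NSub\<close> is truncated subtraction; \<open>NRand x y\<close> draws a uniformly random
  element of \<open>{0, \<dots>, y}\<close>, independently of all earlier draws. Discarding a completed first half
  of a \<open>Seq\<close> also counts as a step, so running times are, if anything, overestimated.
\<close>

fun step :: "prog \<Rightarrow> state \<Rightarrow> (prog \<times> state) pmf" where
  "step Skip s = return_pmf (Skip, s)"
| "step (NConst x k) s = return_pmf (Skip, put_nat x k s)"
| "step (NCopy x y) s = return_pmf (Skip, put_nat x (nat_at s y) s)"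
| "step (NAdd x y z) s = return_pmf (Skip, put_nat x (nat_at s y + nat_at s z) s)"
| "step (NSub x y z) s = return_pmf (Skip, put_nat x (nat_at s y - nat_at s z) s)"
| "step (NRand x y) s =
     map_pmf (\<lambda>k. (Skip, put_nat x k s)) (pmf_of_set {0..nat_at s y})"
| "step (RConst x r) s = return_pmf (Skip, put_real x r s)"
| "step (RCopy x y) s = return_pmf (Skip, put_real x (real_at s y) s)"
| "step (RAdd x y z) s = return_pmf (Skip, put_real x (real_at s y + real_at s z) s)"
| "step (RSub x y z) s = return_pmf (Skip, put_real x (real_at s y - real_at s z) s)"
| "step (RMul x y z) s = return_pmf (Skip, put_real x (real_at s y * real_at s z) s)"
| "step (RDiv x y z) s = return_pmf (Skip, put_real x (real_at s y / real_at s z) s)"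
| "step (Seq p q) s =
     (if p = Skip then return_pmf (q, s)
      else map_pmf (\<lambda>(p', s'). (Seq p' q, s')) (step p s))"
| "step (Cond b p q) s = return_pmf (if holds b s then p else q, s)"
| "step (While b p) s = return_pmf (if holds b s then Seq p (While b p) else Skip, s)"

text \<open>The distribution of the configuration after \<open>t\<close> steps; a program has halted once only
  \<open>Skip\<close> is left to be executed.\<close>

primrec run :: "nat \<Rightarrow> prog \<Rightarrow> state \<Rightarrow> (prog \<times> state) pmf" where
  "run 0 p s = return_pmf (p, s)"
| "run (Suc t) p s = bind_pmf (step p s) (\<lambda>(p', s'). run t p' s')"

text \<open>
  If \<open>T\<close> is the (possibly infinite) number of steps until the program halts, then \<open>T\<close> is the sum
  over all \<open>t\<close> of the indicator of \<open>T > t\<close>, that is, of the event that the program has not halted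
  after \<open>t\<close> steps. Hence the following sum is the expectation of \<open>T\<close>; it is infinite unless the
  program halts with probability 1.
\<close>

definition expected_time :: "prog \<Rightarrow> state \<Rightarrow> ennreal" where
  "expected_time p s =
     (\<Sum>t. ennreal (measure_pmf.prob (run t p s) {(p', s'). p' \<noteq> Skip}))"

text \<open>All outputs that occur with positive probability; the output is what a halted program
  leaves in real cell 0.\<close>

definition outputs :: "prog \<Rightarrow> state \<Rightarrow> real set" where
  "outputs p s = {snd s' 0 | t s'. (Skip, s') \<in> set_pmf (run t p s)}"

text \<open>
  The input consisting of \<open>n\<close> half-spaces in dimension \<open>d\<close>: natural number cell 0 contains \<open>n\<close>,
  and real cells \<open>i * (d + 1), \<dots>, i * (d + 1) + d\<close> contain the \<open>d\<close> coordinates of the normal vector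
  of the \<open>i\<close>-th half-space followed by its right-hand side. All other cells are 0. The coordinates
  are ordered by the bijection \<open>from_nat_into UNIV\<close> from \<open>{..<d}\<close> to the index type.
\<close>

definition input :: "((real ^ 'd::finite) \<times> real) list \<Rightarrow> state" where
  "input hs =
     (\<lambda>k. if k = 0 then length hs else 0,
      \<lambda>k. let i = k div (CARD('d) + 1); j = k mod (CARD('d) + 1)
          in if i < length hs
             then if j < CARD('d) then fst (hs ! i) $ from_nat_into UNIV j else snd (hs ! i)
             else 0)"

end

theory Submission
  imports Defs
begin

text \<open>
  Orthogonal matrices that are close to each other give copies of \<open>K\<close> that are close to each other.
  Since the orthogonal group is compact, it has a finite subset, depending only on \<open>K\<close> and \<open>\<epsilon>\<close>, such
  that for every \<open>P\<close> some matrix \<open>A\<close> of this subset admits a copy of \<open>A K\<close> in \<open>P\<close> with scaling factor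
  at least \<open>alpha K P / (1 + \<epsilon>)\<close> (\<open>finite_rotations\<close>). For a fixed \<open>A\<close>, the largest translated and
  scaled copy of \<open>A K\<close> is found by a linear program in \<open>D = d + 1\<close> variables, with one inequality for
  each half-space and each vertex of \<open>K\<close>. The output is the largest of the optimal values for the
  finitely many matrices (\<open>best_value_approximates\<close>). It remains to solve linear programs with \<open>m\<close>
  inequalities in a fixed number of variables in expected time \<open>O(m)\<close> on the given machine.

  The starting point is Fourier-Motzkin elimination. Each elimination of a variable squares the number
  of inequalities, so the running time is \<open>O(m ^ 2 ^ D)\<close> (\<open>solver_elimination_solver\<close>). Random sampling
  then halves the exponent (\<open>solver_sampling_solver\<close>), and \<open>D\<close> nested levels of sampling make it 1
  (\<open>ex_linear_solver\<close>).

  A level of sampling is Clarkson's algorithm. Every system of inequalities that has a solution has a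
  canonical one, which is determined by a subsystem of bounded size, a basis. Hence the canonical
  solution of a random sample of size \<open>r\<close> violates only \<open>O(m / r)\<close> of the \<open>m\<close> inequalities on average
  (\<open>sum_card_violated\<close>). If it violates any, then it violates an element of the basis
  (\<open>solves_basis_imp_solves\<close>). So the algorithm repeatedly solves a fresh sample together with the
  inequalities collected so far, and collects the violated inequalities if there are not too many. Each
  success collects a new element of the basis, which can happen only a bounded number of times; and
  each round succeeds with probability at least one half. For \<open>r\<close> close to the square root of \<open>m\<close>, all
  systems that are passed to the given solver have size \<open>O(r)\<close>.

  Expected running times of programs are bounded by means of a transformer \<open>ert\<close> that maps the
  expected cost of what follows, as a function of the final state, to the expected total cost as a
  function of the initial state. A postcondition is the special case of a cost that is infinite at
  all states that violate it, so the same calculus yields correctness. The judgement \<open>runs\<close> combines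
  a time bound with a postcondition. It suffices for most of the programs; only the sampling loop needs
  an average over random choices, and only the loop over the rounds needs a potential function.
\<close>


section \<open>Expected running times\<close>

text \<open>The expectation of the number of steps plus the value of \<open>f\<close> at the final state, where
  only computations that halt within \<open>n\<close> steps contribute a value of \<open>f\<close>.\<close>

primrec truncated_ert :: "nat \<Rightarrow> (state \<Rightarrow> ennreal) \<Rightarrow> prog \<Rightarrow> state \<Rightarrow> ennreal" where
  "truncated_ert 0 f p s = (if p = Skip then f s else 0)"
| "truncated_ert (Suc n) f p s = (if p = Skip then f s
     else 1 + (\<integral>\<^sup>+x. truncated_ert n f (fst x) (snd x) \<partial>measure_pmf (step p s)))"

text \<open>The expected running time of \<open>p\<close> followed by a computation with expected running time \<open>f\<close>.
  A postcondition is a special case: if \<open>f\<close> is infinite at the bad states, then finiteness of the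
  expectation excludes that they are ever reached.\<close>

definition ert :: "(state \<Rightarrow> ennreal) \<Rightarrow> prog \<Rightarrow> state \<Rightarrow> ennreal" where
  "ert f p s = (SUP n. truncated_ert n f p s)"

lemma truncated_ert_Skip [simp]: "truncated_ert n f Skip s = f s"
  by (cases n) auto

lemma ert_Skip [simp]: "ert f Skip s = f s"
  by (simp add: ert_def)

lemma truncated_ert_Suc: "truncated_ert n f p s \<le> truncated_ert (Suc n) f p s"
proof (induction n arbitrary: p s)
  case (Suc n)
  have "(\<integral>\<^sup>+x. truncated_ert n f (fst x) (snd x) \<partial>measure_pmf (step p s))
      \<le> (\<integral>\<^sup>+x. truncated_ert (Suc n) f (fst x) (snd x) \<partial>measure_pmf (step p s))"
    using Suc by (intro nn_integral_mono) auto
  then show ?case by (subst (1 2) truncated_ert.simps(2)) (auto intro: add_mono)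
qed simp

lemma truncated_ert_mono:
  assumes "\<And>s. f s \<le> g s"
  shows "truncated_ert n f p s \<le> truncated_ert n g p s"
  by (induction n arbitrary: p s) (auto simp: assms intro!: add_mono nn_integral_mono)

lemma truncated_ert_le_ert: "truncated_ert n f p s \<le> ert f p s"
  unfolding ert_def by (rule SUP_upper) simp

lemma ert_leI: "(\<And>n. truncated_ert n f p s \<le> B) \<Longrightarrow> ert f p s \<le> B"
  unfolding ert_def by (rule SUP_least) simp

lemma ert_step:
  assumes "p \<noteq> Skip" "step p s = return_pmf (q, s')"
  shows "ert f p s \<le> 1 + ert f q s'"
proof (rule ert_leI)
  fix n show "truncated_ert n f p s \<le> 1 + ert f q s'"
    by (cases n) (auto simp: assms intro: add_mono truncated_ert_le_ert)
qed

text \<open>Bounds on \<open>ert\<close> for compound programs are proved for all truncations by induction, and then for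
  the supremum.\<close>

lemma truncated_ert_Seq:
  "truncated_ert n f (Seq p q) s \<le> truncated_ert n (\<lambda>s'. 1 + truncated_ert n f q s') p s"
proof (induction n arbitrary: p s)
  case (Suc n)
  show ?case
  proof (cases "p = Skip")
    case True
    have "1 + truncated_ert n f q s \<le> 1 + truncated_ert (Suc n) f q s"
      by (intro add_mono order_refl truncated_ert_Suc)
    then show ?thesis using True by simp
  next
    case False
    have "(\<integral>\<^sup>+x. truncated_ert n f (Seq (fst x) q) (snd x) \<partial>measure_pmf (step p s))
       \<le> (\<integral>\<^sup>+x. truncated_ert n (\<lambda>s'. 1 + truncated_ert (Suc n) f q s') (fst x) (snd x)
             \<partial>measure_pmf (step p s))"
      by (intro nn_integral_mono order_trans[OF Suc] truncated_ert_mono add_mono order_refl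
          truncated_ert_Suc)
    moreover define g where "g = (\<lambda>s'. 1 + truncated_ert (Suc n) f q s')"
    ultimately have "1 + (\<integral>\<^sup>+x. truncated_ert n f (Seq (fst x) q) (snd x) \<partial>measure_pmf (step p s))
       \<le> truncated_ert (Suc n) g p s"
      using False by (simp del: truncated_ert.simps(2)) (simp add: add_mono)
    then show ?thesis
      using False unfolding g_def by (simp add: case_prod_beta)
  qed
qed simp

lemma ert_Seq: "ert f (Seq p q) s \<le> ert (\<lambda>s'. 1 + ert f q s') p s"
proof (rule ert_leI)
  fix n
  have "truncated_ert n f (Seq p q) s \<le> truncated_ert n (\<lambda>s'. 1 + truncated_ert n f q s') p s"
    by (rule truncated_ert_Seq)
  also have "\<dots> \<le> truncated_ert n (\<lambda>s'. 1 + ert f q s') p s"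
    by (intro truncated_ert_mono add_mono order_refl truncated_ert_le_ert)
  also have "\<dots> \<le> ert (\<lambda>s'. 1 + ert f q s') p s"
    by (rule truncated_ert_le_ert)
  finally show "truncated_ert n f (Seq p q) s \<le> ert (\<lambda>s'. 1 + ert f q s') p s" .
qed

lemma ert_Cond: "ert f (Cond b p q) s \<le> 1 + ert f (if holds b s then p else q) s"
  by (rule ert_step) auto

lemma ert_While_unfold:
  "ert f (While b p) s \<le> 1 + (if holds b s then ert (\<lambda>s'. 1 + ert f (While b p) s') p s else f s)"
proof -
  have "ert f (While b p) s \<le> 1 + ert f (if holds b s then Seq p (While b p) else Skip) s"
    by (rule ert_step) auto
  also have "\<dots> \<le> 1 + (if holds b s then ert (\<lambda>s'. 1 + ert f (While b p) s') p s else f s)"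
    by (auto intro!: add_mono ert_Seq)
  finally show ?thesis .
qed

text \<open>A loop is handled by a potential function \<open>I\<close> that pays for the next iteration and, in
  expectation, for the potential after it.\<close>

lemma ert_While:
  assumes "\<And>s. \<not> holds b s \<Longrightarrow> 1 + f s \<le> I s"
    and "\<And>s. holds b s \<Longrightarrow> 1 + ert (\<lambda>s'. 1 + I s') p s \<le> I s"
  shows "ert f (While b p) s \<le> I s"
proof (rule ert_leI)
  fix n show "truncated_ert n f (While b p) s \<le> I s"
  proof (induction n arbitrary: s)
    case (Suc n)
    show ?case
    proof (cases "holds b s")
      case True
      have "truncated_ert (Suc n) f (While b p) s = 1 + truncated_ert n f (Seq p (While b p)) s"
        using True by simp
      also have "\<dots> \<le> 1 + truncated_ert n (\<lambda>s'. 1 + truncated_ert n f (While b p) s') p s"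
        by (intro add_mono order_refl truncated_ert_Seq)
      also have "\<dots> \<le> 1 + truncated_ert n (\<lambda>s'. 1 + I s') p s"
        by (intro add_mono order_refl truncated_ert_mono Suc)
      also have "\<dots> \<le> 1 + ert (\<lambda>s'. 1 + I s') p s"
        by (intro add_mono order_refl truncated_ert_le_ert)
      also have "\<dots> \<le> I s" by (rule assms(2)[OF True])
      finally show ?thesis .
    qed (use assms(1) in simp)
  qed simp
qed

lemma ert_NRand:
  "ert f (NRand x y) s \<le> 1 + (\<Sum>k\<le>nat_at s y. f (put_nat x k s)) / of_nat (Suc (nat_at s y))"
proof (rule ert_leI)
  fix n
  have "(\<integral>\<^sup>+k. f (put_nat x k s) \<partial>measure_pmf (pmf_of_set {0..nat_at s y}))
      = (\<Sum>k\<le>nat_at s y. f (put_nat x k s)) / of_nat (Suc (nat_at s y))"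
    by (subst nn_integral_pmf_of_set) (auto simp: atLeast0AtMost ennreal_of_nat_eq_real_of_nat)
  then show "truncated_ert n f (NRand x y) s
      \<le> 1 + (\<Sum>k\<le>nat_at s y. f (put_nat x k s)) / of_nat (Suc (nat_at s y))"
    by (cases n) auto
qed

lemma run_Skip: "run t Skip s = return_pmf (Skip, s)"
  by (induction t) (auto simp: bind_return_pmf)

text \<open>For the cost 0 at the end, \<open>ert\<close> counts the steps that are executed.\<close>

lemma sum_running_le_truncated_ert:
  "(\<Sum>t<n. ennreal (measure_pmf.prob (run t p s) {(p', s'). p' \<noteq> Skip})) \<le> truncated_ert n f p s"
proof (induction n arbitrary: p s)
  case (Suc n)
  let ?g = "\<lambda>t p s. ennreal (measure_pmf.prob (run t p s) {(p', s'). p' \<noteq> Skip})"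
  show ?case
  proof (cases "p = Skip")
    case True
    then show ?thesis
      by (simp add: run_Skip indicator_def del: run.simps truncated_ert.simps)
  next
    case False
    have "?g (Suc t) p s = (\<integral>\<^sup>+x. ?g t (fst x) (snd x) \<partial>measure_pmf (step p s))" for t
      by (simp add: emeasure_bind_pmf case_prod_beta measure_pmf.emeasure_eq_measure[symmetric])
    then have "(\<Sum>t<n. ?g (Suc t) p s) =
        (\<integral>\<^sup>+x. (\<Sum>t<n. ?g t (fst x) (snd x)) \<partial>measure_pmf (step p s))"
      by (simp add: nn_integral_sum del: run.simps sum_ennreal)
    also have "\<dots> \<le> (\<integral>\<^sup>+x. truncated_ert n f (fst x) (snd x) \<partial>measure_pmf (step p s))"
      by (intro nn_integral_mono Suc)
    finally show ?thesis using False
      by (subst sum.lessThan_Suc_shift) (simp add: add_mono del: run.simps(2))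
  qed
qed simp

lemma expected_time_le_ert: "expected_time p s \<le> ert f p s"
  unfolding expected_time_def suminf_eq_SUP
  by (rule SUP_least) (rule order_trans[OF sum_running_le_truncated_ert truncated_ert_le_ert])

text \<open>A reachable final state with infinite cost is taken into account, however small its
  probability is: the distribution of the configurations is discrete.\<close>

lemma ert_infinite:
  assumes "(Skip, s') \<in> set_pmf (run t p s)" "f s' = \<top>"
  shows "ert f p s = \<top>"
proof -
  have "truncated_ert t f p s = \<top>" using assms(1)
  proof (induction t arbitrary: p s)
    case 0
    then show ?case using assms by auto
  next
    case (Suc t)
    show ?case
    proof (cases "p = Skip")
      case True
      then show ?thesis using Suc.prems assms by (auto simp: run_Skip simp del: run.simps)
    next
      case False
      obtain x where x: "x \<in> set_pmf (step p s)" "(Skip, s') \<in> set_pmf (run t (fst x) (snd x))"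
        using Suc.prems by auto
      have "\<top> = (\<integral>\<^sup>+y. \<top> * indicator {x} y \<partial>measure_pmf (step p s))"
        using x by (subst nn_integral_cmult_indicator)
          (auto simp: emeasure_pmf_single_eq_zero_iff ennreal_top_mult)
      also have "\<dots> \<le> (\<integral>\<^sup>+y. truncated_ert t f (fst y) (snd y) \<partial>measure_pmf (step p s))"
        using Suc.IH[OF x(2)] by (intro nn_integral_mono) (auto simp: indicator_def)
      finally show ?thesis using False by (simp add: top_unique)
    qed
  qed
  then show ?thesis using truncated_ert_le_ert[of t f p s] by (simp add: top_unique)
qed

text \<open>Started in \<open>s\<close>, the program \<open>p\<close> takes at most \<open>t\<close> steps in expectation, and all states in
  which it can halt satisfy \<open>Q\<close>. The quantification over \<open>f\<close> makes this composable: the values of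
  \<open>f\<close> and the running time need not be independent.\<close>

definition runs :: "prog \<Rightarrow> state \<Rightarrow> nat \<Rightarrow> (state \<Rightarrow> bool) \<Rightarrow> bool" where
  "runs p s t Q \<longleftrightarrow> (\<forall>f B. (\<forall>s'. Q s' \<longrightarrow> f s' \<le> B) \<longrightarrow> ert f p s \<le> of_nat t + B)"

lemma runsD: "runs p s t Q \<Longrightarrow> (\<And>s'. Q s' \<Longrightarrow> f s' \<le> B) \<Longrightarrow> ert f p s \<le> of_nat t + B"
  unfolding runs_def by blast

lemma runs_expected_time:
  assumes "runs p s t Q"
  shows "expected_time p s \<le> of_nat t"
  using order_trans[OF expected_time_le_ert runsD[OF assms, of "\<lambda>_. 0" 0]] by simp

lemma runs_outputs:
  assumes "runs p s t Q" "\<beta> \<in> outputs p s"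
  shows "\<exists>s'. Q s' \<and> \<beta> = snd s' 0"
proof -
  obtain t' s' where s': "\<beta> = snd s' 0" "(Skip, s') \<in> set_pmf (run t' p s)"
    using assms(2) by (auto simp: outputs_def)
  let ?f = "\<lambda>s. if Q s then 0 else \<top> :: ennreal"
  have "ert ?f p s \<le> of_nat t + 0" by (rule runsD[OF assms(1)]) auto
  then have "ert ?f p s \<noteq> \<top>" using ennreal_of_nat_neq_top[of t] by (metis add_0_right top_unique)
  then have "?f s' \<noteq> \<top>" using ert_infinite[OF s'(2), of ?f] by metis
  then have "Q s'" by presburger
  then show ?thesis using s' by blast
qed

lemma runs_weaken:
  assumes "runs p s t Q" "t \<le> t'" "\<And>s'. Q s' \<Longrightarrow> Q' s'"
  shows "runs p s t' Q'"
  unfolding runs_def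
proof (intro allI impI)
  fix f :: "state \<Rightarrow> ennreal" and B assume "\<forall>s'. Q' s' \<longrightarrow> f s' \<le> B"
  then have "ert f p s \<le> of_nat t + B" using assms by (intro runsD[OF assms(1)]) auto
  also have "\<dots> \<le> of_nat t' + B" using assms(2) by (intro add_mono) auto
  finally show "ert f p s \<le> of_nat t' + B" .
qed

lemma runs_Skip: "Q s \<Longrightarrow> runs Skip s t Q"
  unfolding runs_def by (metis add_increasing ert_Skip zero_le)

lemma runs_Seq:
  assumes "runs p s t P" "\<And>s'. P s' \<Longrightarrow> runs q s' u Q"
  shows "runs (Seq p q) s (t + 1 + u) Q"
  unfolding runs_def
proof (intro allI impI)
  fix f :: "state \<Rightarrow> ennreal" and B assume B: "\<forall>s'. Q s' \<longrightarrow> f s' \<le> B"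
  have "ert f (Seq p q) s \<le> ert (\<lambda>s'. 1 + ert f q s') p s" by (rule ert_Seq)
  also have "\<dots> \<le> of_nat t + (1 + (of_nat u + B))"
    using assms B by (intro runsD[OF assms(1)] add_mono order_refl runsD[OF assms(2)]) auto
  finally show "ert f (Seq p q) s \<le> of_nat (t + 1 + u) + B" by (simp add: ac_simps)
qed

lemma runs_Cond:
  assumes "holds b s \<Longrightarrow> runs p s t Q" "\<not> holds b s \<Longrightarrow> runs q s t Q"
  shows "runs (Cond b p q) s (Suc t) Q"
  unfolding runs_def
proof (intro allI impI)
  fix f :: "state \<Rightarrow> ennreal" and B assume B: "\<forall>s'. Q s' \<longrightarrow> f s' \<le> B"
  have "ert f (Cond b p q) s \<le> 1 + ert f (if holds b s then p else q) s" by (rule ert_Cond)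
  also have "\<dots> \<le> 1 + (of_nat t + B)"
    using assms B by (intro add_mono order_refl) (auto intro: runsD)
  finally show "ert f (Cond b p q) s \<le> of_nat (Suc t) + B" by (simp add: add.assoc)
qed

text \<open>Loops whose number of iterations is determined by the initial state need an invariant, but no
  potential function.\<close>

lemma runs_While:
  assumes body: "\<And>i s. i < n \<Longrightarrow> Inv i s \<Longrightarrow> holds b s \<and> runs p s t (Inv (Suc i))"
    and exit: "\<And>s. Inv n s \<Longrightarrow> \<not> holds b s"
    and "Inv 0 s"
  shows "runs (While b p) s (n * (t + 2) + 1) (Inv n)"
proof -
  have "Inv (n - k) s \<Longrightarrow> k \<le> n \<Longrightarrow> runs (While b p) s (k * (t + 2) + 1) (Inv n)" for k s
  proof (induction k arbitrary: s)
    case 0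
    show ?case unfolding runs_def
    proof (intro allI impI)
      fix f :: "state \<Rightarrow> ennreal" and B assume "\<forall>s'. Inv n s' \<longrightarrow> f s' \<le> B"
      then have "1 + f s \<le> 1 + B" using 0 by (cases s) (simp add: add_mono)
      moreover have "ert f (While b p) s \<le> 1 + f s"
        using 0 exit[of s] ert_While_unfold[of f b p s] by simp
      ultimately show "ert f (While b p) s \<le> of_nat (0 * (t + 2) + 1) + B"
        by (simp add: order_trans[of _ "1 + f s"])
    qed
  next
    case (Suc k)
    then have b: "holds b s" "runs p s t (Inv (n - k))"
      using body[of "n - Suc k" s] by (auto simp: Suc_diff_Suc)
    show ?case unfolding runs_def
    proof (intro allI impI)
      fix f :: "state \<Rightarrow> ennreal" and B assume B: "\<forall>s'. Inv n s' \<longrightarrow> f s' \<le> B"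
      have rest: "1 + ert f (While b p) s' \<le> 1 + (of_nat (k * (t + 2) + 1) + B)"
        if "Inv (n - k) s'" for s'
        using Suc.prems B that by (intro add_mono order_refl runsD[OF Suc.IH]) auto
      have "ert f (While b p) s \<le> 1 + ert (\<lambda>s'. 1 + ert f (While b p) s') p s"
        using ert_While_unfold[of f b p s] b by simp
      also have "\<dots> \<le> 1 + (of_nat t + (1 + (of_nat (k * (t + 2) + 1) + B)))"
        by (intro add_mono order_refl runsD[OF b(2)] rest)
      also have "\<dots> = of_nat (Suc k * (t + 2) + 1) + B"
        by (simp add: algebra_simps)
      finally show "ert f (While b p) s \<le> of_nat (Suc k * (t + 2) + 1) + B" .
    qed
  qed
  from this[of n s] assms(3) show ?thesis by simp
qed

subsection \<open>Straight-line programs\<close>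

text \<open>The final state of a deterministic program without loops is computed by rewriting with the
  equations of \<open>exec\<close>.\<close>

primrec straight :: "prog \<Rightarrow> bool" where
  "straight Skip = True" | "straight (NConst x k) = True" | "straight (NCopy x y) = True"
| "straight (NAdd x y z) = True" | "straight (NSub x y z) = True" | "straight (NRand x y) = False"
| "straight (RConst x r) = True" | "straight (RCopy x y) = True" | "straight (RAdd x y z) = True"
| "straight (RSub x y z) = True" | "straight (RMul x y z) = True" | "straight (RDiv x y z) = True"
| "straight (Seq p q) = (straight p \<and> straight q)"
| "straight (Cond b p q) = (straight p \<and> straight q)"
| "straight (While b p) = False"

primrec steps :: "prog \<Rightarrow> nat" where
  "steps Skip = 0" | "steps (NConst x k) = 1" | "steps (NCopy x y) = 1"
| "steps (NAdd x y z) = 1" | "steps (NSub x y z) = 1" | "steps (NRand x y) = 1"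
| "steps (RConst x r) = 1" | "steps (RCopy x y) = 1" | "steps (RAdd x y z) = 1"
| "steps (RSub x y z) = 1" | "steps (RMul x y z) = 1" | "steps (RDiv x y z) = 1"
| "steps (Seq p q) = steps p + 1 + steps q"
| "steps (Cond b p q) = Suc (max (steps p) (steps q))"
| "steps (While b p) = 0"

primrec exec :: "prog \<Rightarrow> state \<Rightarrow> state" where
  "exec Skip s = s" | "exec (NConst x k) s = put_nat x k s"
| "exec (NCopy x y) s = put_nat x (nat_at s y) s"
| "exec (NAdd x y z) s = put_nat x (nat_at s y + nat_at s z) s"
| "exec (NSub x y z) s = put_nat x (nat_at s y - nat_at s z) s"
| "exec (NRand x y) s = s"
| "exec (RConst x r) s = put_real x r s"
| "exec (RCopy x y) s = put_real x (real_at s y) s"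
| "exec (RAdd x y z) s = put_real x (real_at s y + real_at s z) s"
| "exec (RSub x y z) s = put_real x (real_at s y - real_at s z) s"
| "exec (RMul x y z) s = put_real x (real_at s y * real_at s z) s"
| "exec (RDiv x y z) s = put_real x (real_at s y / real_at s z) s"
| "exec (Seq p q) s = exec q (exec p s)"
| "exec (Cond b p q) s = (if holds b s then exec p s else exec q s)"
| "exec (While b p) s = s"

lemma runs_atom:
  assumes "p \<noteq> Skip" "step p s = return_pmf (Skip, s')"
  shows "runs p s 1 (\<lambda>r. r = s')"
  unfolding runs_def
proof (intro allI impI)
  fix f :: "state \<Rightarrow> ennreal" and B assume "\<forall>r. r = s' \<longrightarrow> f r \<le> B"
  then show "ert f p s \<le> of_nat 1 + B"
    using order_trans[OF ert_step[OF assms, of f] add_mono[OF order_refl]] by simp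
qed

lemma runs_exec: "straight p \<Longrightarrow> runs p s (steps p) (\<lambda>s'. s' = exec p s)"
proof (induction p arbitrary: s)
  case (Seq p q)
  then show ?case unfolding steps.simps exec.simps
    by (intro runs_Seq[where P = "\<lambda>s'. s' = exec p s"]) auto
next
  case (Cond b p q)
  then show ?case unfolding steps.simps exec.simps
    by (intro runs_Cond) (auto intro: runs_weaken[OF Cond.IH(1)] runs_weaken[OF Cond.IH(2)])
qed (simp_all add: runs_Skip, (rule runs_atom[unfolded One_nat_def]; simp)+)

lemma runs_straight:
  assumes "straight p" "steps p \<le> t" "Q (exec p s)"
  shows "runs p s t Q"
  using assms by (intro runs_weaken[OF runs_exec]) auto

definition block :: "prog list \<Rightarrow> prog" where
  "block ps = foldr Seq ps Skip"

lemma block_Nil [simp]: "block [] = Skip"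
  and block_Cons [simp]: "block (p # ps) = Seq p (block ps)"
  by (simp_all add: block_def)

lemma straight_block [simp]: "straight (block ps) \<longleftrightarrow> (\<forall>p\<in>set ps. straight p)"
  by (induction ps) auto

lemma steps_block [simp]: "steps (block ps) = (\<Sum>p\<leftarrow>ps. steps p + 1)"
  by (induction ps) auto

lemma runs_Seq_straight:
  assumes "straight p" "runs q (exec p s) u Q"
  shows "runs (Seq p q) s (steps p + 1 + u) Q"
  using assms by (intro runs_Seq[OF runs_exec]) auto

lemma exec_block_append [simp]: "exec (block (ps @ qs)) s = exec (block qs) (exec (block ps) s)"
  by (induction ps arbitrary: s) auto

section \<open>Fourier-Motzkin elimination and canonical solutions\<close>

text \<open>The list \<open>[b, a\<^sub>0, a\<^sub>1, \<dots>]\<close> stands for the inequality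
  \<open>a\<^sub>0 * x 0 + a\<^sub>1 * x 1 + \<dots> \<le> b\<close>. Only the variables \<open>x j\<close> with \<open>j < k\<close> are considered;
  coefficients of further variables are ignored. The slack is the right-hand side minus the
  left-hand side.\<close>

definition slack :: "nat \<Rightarrow> real list \<Rightarrow> (nat \<Rightarrow> real) \<Rightarrow> real" where
  "slack k g x = g ! 0 - (\<Sum>j<k. g ! Suc j * x j)"

definition solves :: "nat \<Rightarrow> (nat \<Rightarrow> real) \<Rightarrow> real list set \<Rightarrow> bool" where
  "solves k x G \<longleftrightarrow> (\<forall>g\<in>G. 0 \<le> slack k g x)"

definition feasible :: "nat \<Rightarrow> real list set \<Rightarrow> bool" where
  "feasible k G \<longleftrightarrow> (\<exists>x. solves k x G)"

text \<open>Nonnegative multipliers such that the combination of \<open>g\<close> and \<open>h\<close> does not contain \<open>x k\<close>.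
  The trivial combination is used for the pairs that are of no use, so that every pair gives
  exactly one inequality.\<close>

definition multipliers :: "nat \<Rightarrow> real list \<Rightarrow> real list \<Rightarrow> real \<times> real" where
  "multipliers k g h =
     (if g ! Suc k > 0 \<and> h ! Suc k < 0 then (- (h ! Suc k), g ! Suc k)
      else if g ! Suc k = 0 then (1, 0) else (0, 0))"

definition combine :: "nat \<Rightarrow> real list \<Rightarrow> real list \<Rightarrow> real list" where
  "combine k g h =
     map (\<lambda>j. fst (multipliers k g h) * g ! j + snd (multipliers k g h) * h ! j) [0..<length g]"

definition eliminate :: "nat \<Rightarrow> real list set \<Rightarrow> real list set" where
  "eliminate k G = (\<lambda>(g, h). combine k g h) ` (G \<times> G)"

text \<open>The point closest to 0 in the set of all numbers that are at least all elements of \<open>A\<close> and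
  at most all elements of \<open>B\<close>: if this set is nonempty, then one of the two summands is 0.\<close>

definition closest_to_0 :: "real set \<Rightarrow> real set \<Rightarrow> real" where
  "closest_to_0 A B = Max (insert 0 A) + Min (insert 0 B)"

definition lower_bounds :: "nat \<Rightarrow> real list set \<Rightarrow> (nat \<Rightarrow> real) \<Rightarrow> real set" where
  "lower_bounds k G x = (\<lambda>g. slack k g x / g ! Suc k) ` {g \<in> G. g ! Suc k < 0}"

definition upper_bounds :: "nat \<Rightarrow> real list set \<Rightarrow> (nat \<Rightarrow> real) \<Rightarrow> real set" where
  "upper_bounds k G x = (\<lambda>g. slack k g x / g ! Suc k) ` {g \<in> G. g ! Suc k > 0}"

text \<open>If \<open>G\<close> is feasible, this is the solution for which the sequence
  \<open>\<bar>x 0\<bar>, \<bar>x 1\<bar>, \<dots>, \<bar>x (k - 1)\<bar>\<close> is lexicographically minimal. Since absolute values are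
  minimized, it exists even if the solution set is unbounded; since the possible values of each
  variable, given those before it, form an interval, it is unique.\<close>

primrec canonical :: "nat \<Rightarrow> real list set \<Rightarrow> nat \<Rightarrow> real" where
  "canonical 0 G = (\<lambda>_. 0)"
| "canonical (Suc k) G = (let x = canonical k (eliminate k G)
     in x(k := closest_to_0 (lower_bounds k G x) (upper_bounds k G x)))"

lemma slack_cong: "(\<And>j. j < k \<Longrightarrow> x j = y j) \<Longrightarrow> slack k g x = slack k g y"
  unfolding slack_def by (auto intro!: sum.cong)

lemma slack_upd [simp]: "slack k g (x(k := v)) = slack k g x"
  by (rule slack_cong) auto

lemma slack_Suc: "slack (Suc k) g x = slack k g x - g ! Suc k * x k"
  by (simp add: slack_def)

lemma slack_Suc_upd: "slack (Suc k) g (x(k := v)) = slack k g x - g ! Suc k * v"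
  by (simp add: slack_Suc)

lemma finite_bounds [simp]:
  "finite G \<Longrightarrow> finite (lower_bounds k G x)" "finite G \<Longrightarrow> finite (upper_bounds k G x)"
  by (auto simp: lower_bounds_def upper_bounds_def)

lemma finite_eliminate [simp]: "finite G \<Longrightarrow> finite (eliminate k G)"
  by (auto simp: eliminate_def)

lemma eliminate_mono: "F \<subseteq> G \<Longrightarrow> eliminate k F \<subseteq> eliminate k G"
  by (auto simp: eliminate_def)

lemma length_eliminate:
  "G \<subseteq> {g. length g = n} \<Longrightarrow> eliminate k G \<subseteq> {g. length g = n}"
  by (auto simp: eliminate_def combine_def)

lemma solves_mono: "solves k x G \<Longrightarrow> F \<subseteq> G \<Longrightarrow> solves k x F"
  by (auto simp: solves_def)

lemma feasible_mono: "feasible k G \<Longrightarrow> F \<subseteq> G \<Longrightarrow> feasible k F"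
  unfolding feasible_def using solves_mono by blast

lemma slack_combine:
  assumes "k < length g"
  shows "slack k (combine k g h) x =
    fst (multipliers k g h) * slack k g x + snd (multipliers k g h) * slack k h x"
proof -
  have "combine k g h ! j = fst (multipliers k g h) * g ! j + snd (multipliers k g h) * h ! j"
    if "j \<le> k" for j
    using that assms by (simp add: combine_def)
  then show ?thesis
    unfolding slack_def by (simp add: algebra_simps sum.distrib sum_distrib_left Suc_leI)
qed

lemma solves_eliminate:
  assumes G: "\<And>g. g \<in> G \<Longrightarrow> k < length g" and x: "solves (Suc k) x G"
  shows "solves k x (eliminate k G)"
  unfolding solves_def
proof
  fix e assume "e \<in> eliminate k G"
  then obtain g h where gh: "g \<in> G" "h \<in> G" "e = combine k g h" by (auto simp: eliminate_def)
  obtain a b where ab: "multipliers k g h = (a, b)" by fastforce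
  have "a * g ! Suc k + b * h ! Suc k = 0" "a \<ge> 0" "b \<ge> 0"
    using ab by (auto simp: multipliers_def split: if_splits)
  moreover have "a * slack (Suc k) g x + b * slack (Suc k) h x
      = a * slack k g x + b * slack k h x - (a * g ! Suc k + b * h ! Suc k) * x k"
    by (simp add: slack_Suc algebra_simps)
  ultimately have "a * slack k g x + b * slack k h x = a * slack (Suc k) g x + b * slack (Suc k) h x"
    by simp
  moreover have "\<dots> \<ge> 0"
    using x gh \<open>a \<ge> 0\<close> \<open>b \<ge> 0\<close> by (auto simp: solves_def)
  ultimately show "0 \<le> slack k e x"
    using slack_combine[OF G[OF gh(1)], of h x] ab gh by simp
qed

lemma solves_Suc_iff:
  "solves (Suc k) (x(k := v)) G \<longleftrightarrow>
     (\<forall>a\<in>lower_bounds k G x. a \<le> v) \<and> (\<forall>b\<in>upper_bounds k G x. v \<le> b) \<and>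
     (\<forall>g\<in>G. g ! Suc k = 0 \<longrightarrow> 0 \<le> slack k g x)"
proof -
  have "0 \<le> slack k g x - g ! Suc k * v \<longleftrightarrow>
    (g ! Suc k < 0 \<longrightarrow> slack k g x / g ! Suc k \<le> v) \<and>
    (g ! Suc k > 0 \<longrightarrow> v \<le> slack k g x / g ! Suc k) \<and>
    (g ! Suc k = 0 \<longrightarrow> 0 \<le> slack k g x)" for g
    by (cases "g ! Suc k" "0 :: real" rule: linorder_cases)
      (auto simp: field_simps)
  then show ?thesis
    unfolding solves_def slack_Suc_upd lower_bounds_def upper_bounds_def by blast
qed

lemma Max_insert_0:
  fixes A :: "real set"
  assumes "finite A"
  shows "Max (insert 0 A) \<in> insert 0 A" "0 \<le> Max (insert 0 A)"
    "\<And>a. a \<in> A \<Longrightarrow> a \<le> Max (insert 0 A)"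
  using Max_in[of "insert 0 A"] Max_ge[of "insert 0 A"] assms by (simp_all del: Max_insert)

lemma Min_insert_0:
  fixes A :: "real set"
  assumes "finite A"
  shows "Min (insert 0 A) \<in> insert 0 A" "Min (insert 0 A) \<le> 0"
    "\<And>a. a \<in> A \<Longrightarrow> Min (insert 0 A) \<le> a"
  using Min_in[of "insert 0 A"] Min_le[of "insert 0 A"] assms by (simp_all del: Min_insert)

lemma closest_to_0_between:
  assumes "finite A" "finite B" and le: "\<And>a b. a \<in> A \<Longrightarrow> b \<in> B \<Longrightarrow> a \<le> b"
  shows "a \<in> A \<Longrightarrow> a \<le> closest_to_0 A B" "b \<in> B \<Longrightarrow> closest_to_0 A B \<le> b"
proof -
  define L U where "L = Max (insert 0 A)" and "U = Min (insert 0 B)"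
  note L = Max_insert_0[OF assms(1), folded L_def]
  note U = Min_insert_0[OF assms(2), folded U_def]
  have LU: "L = 0 \<or> U = 0" using L U le[of L U] by auto
  show "a \<le> closest_to_0 A B" if "a \<in> A"
    unfolding closest_to_0_def L_def[symmetric] U_def[symmetric]
    using LU L(2) L(3)[OF that] U(1) le[OF that, of U] by auto
  show "closest_to_0 A B \<le> b" if "b \<in> B"
    unfolding closest_to_0_def L_def[symmetric] U_def[symmetric]
    using LU U(2) U(3)[OF that] L(1) le[OF _ that, of L] by auto
qed

lemma closest_to_0_minimal:
  assumes "finite A" "finite B" and "\<And>a. a \<in> A \<Longrightarrow> a \<le> v" "\<And>b. b \<in> B \<Longrightarrow> v \<le> b"
  shows "\<bar>closest_to_0 A B\<bar> \<le> \<bar>v\<bar>"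
proof -
  define L U where "L = Max (insert 0 A)" and "U = Min (insert 0 B)"
  note L = Max_insert_0[OF assms(1), folded L_def]
  note U = Min_insert_0[OF assms(2), folded U_def]
  show ?thesis
    unfolding closest_to_0_def L_def[symmetric] U_def[symmetric]
    using L(1,2) U(1,2) assms(3)[of L] assms(4)[of U] by auto
qed

text \<open>If an interval is made smaller but keeps its point closest to 0, then this is still the closest
  one.\<close>

lemma closest_to_0_eqI:
  assumes fin: "finite A'" "finite B'" and sub: "A \<subseteq> A'" "B \<subseteq> B'"
    and A': "\<And>a. a \<in> A' \<Longrightarrow> a \<le> closest_to_0 A B"
    and B': "\<And>b. b \<in> B' \<Longrightarrow> closest_to_0 A B \<le> b"
  shows "closest_to_0 A' B' = closest_to_0 A B"
proof -
  define L U where "L = Max (insert 0 A)" and "U = Min (insert 0 B)"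
  define L' U' where "L' = Max (insert 0 A')" and "U' = Min (insert 0 B')"
  have v: "closest_to_0 A B = L + U" "closest_to_0 A' B' = L' + U'"
    by (simp_all add: closest_to_0_def L_def U_def L'_def U'_def del: Max_insert Min_insert)
  note L = Max_insert_0[OF finite_subset[OF sub(1) fin(1)], folded L_def]
  note U = Min_insert_0[OF finite_subset[OF sub(2) fin(2)], folded U_def]
  note L' = Max_insert_0[OF fin(1), folded L'_def]
  note U' = Min_insert_0[OF fin(2), folded U'_def]
  have "L \<le> L'" "U' \<le> U" using L(1) U(1) L'(2,3) U'(2,3) sub by auto
  moreover have "L = 0 \<or> U = 0"
    using L(1,2) U(1,2) A'[of L] B'[of U] sub unfolding v by auto
  ultimately have "L' = L \<and> U' = U"
    using L(1,2) U(1,2) L'(1,2) U'(1,2) A'[of L'] B'[of U'] unfolding v by auto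
  then show ?thesis by (simp add: v)
qed

text \<open>Fourier-Motzkin: a solution of the system after elimination extends to one of the original
  system, since every lower bound for the eliminated variable is at most every upper bound.\<close>

lemma solves_extend:
  assumes G: "finite G" "\<And>g. g \<in> G \<Longrightarrow> k < length g" and x: "solves k x (eliminate k G)"
  shows "solves (Suc k) (x(k := closest_to_0 (lower_bounds k G x) (upper_bounds k G x))) G"
proof -
  have comb: "0 \<le> fst (multipliers k g h) * slack k g x + snd (multipliers k g h) * slack k h x"
    if "g \<in> G" "h \<in> G" for g h
    using x that unfolding slack_combine[OF G(2)[OF that(1)], symmetric]
    by (auto simp: solves_def eliminate_def)
  have "a \<le> b" if ab: "a \<in> lower_bounds k G x" "b \<in> upper_bounds k G x" for a b
  proof -
    obtain g h where gh: "g \<in> G" "h \<in> G" "g ! Suc k > 0" "h ! Suc k < 0"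
        "a = slack k h x / h ! Suc k" "b = slack k g x / g ! Suc k"
      using ab by (auto simp: lower_bounds_def upper_bounds_def)
    have "h ! Suc k * slack k g x \<le> g ! Suc k * slack k h x"
      using comb[OF gh(1,2)] gh(3,4) by (simp add: multipliers_def)
    moreover have "slack k g x = g ! Suc k * b" "slack k h x = h ! Suc k * a"
      using gh by auto
    ultimately have "(g ! Suc k * h ! Suc k) * b \<le> (g ! Suc k * h ! Suc k) * a"
      by (simp add: mult_ac)
    then show ?thesis using mult_pos_neg[OF gh(3,4)] mult_le_cancel_left_neg by blast
  qed
  moreover have "0 \<le> slack k g x" if "g \<in> G" "g ! Suc k = 0" for g
    using comb[OF that(1,1)] that(2) by (simp add: multipliers_def)
  ultimately show ?thesis
    unfolding solves_Suc_iff using G by (auto intro: closest_to_0_between)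
qed

lemma feasible_eliminate:
  assumes "finite G" "\<And>g. g \<in> G \<Longrightarrow> k < length g"
  shows "feasible k (eliminate k G) \<longleftrightarrow> feasible (Suc k) G"
  using assms solves_extend[of G k] solves_eliminate[of G k] unfolding feasible_def by blast

lemma canonical_solves:
  assumes "finite G" "G \<subseteq> {g. length g = n}" "k \<le> n" "feasible k G"
  shows "solves k (canonical k G) G"
  using assms
proof (induction k arbitrary: G)
  case 0
  then show ?case by (simp add: feasible_def solves_def slack_def)
next
  case (Suc k)
  then have "feasible k (eliminate k G)" by (subst feasible_eliminate) auto
  then have "solves k (canonical k (eliminate k G)) (eliminate k G)"
    using Suc.prems by (intro Suc.IH length_eliminate) auto
  then show ?case
    using Suc.prems unfolding canonical.simps Let_def by (intro solves_extend) auto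
qed

text \<open>The variable \<open>x 0\<close> is the objective function of the linear programs to be solved.\<close>

lemma canonical_minimal:
  assumes "finite G" "G \<subseteq> {g. length g = n}" "Suc k \<le> n" "solves (Suc k) y G"
  shows "\<bar>canonical (Suc k) G 0\<bar> \<le> \<bar>y 0\<bar>"
  using assms
proof (induction k arbitrary: G)
  case 0
  have "solves (Suc 0) ((\<lambda>_. 0)(0 := y 0)) G"
    using 0(4) by (simp add: solves_def slack_def)
  then show ?case
    using 0(1) unfolding solves_Suc_iff by (simp add: closest_to_0_minimal Let_def)
next
  case (Suc k)
  have "solves (Suc k) y (eliminate (Suc k) G)"
    using Suc.prems by (intro solves_eliminate) auto
  then have "\<bar>canonical (Suc k) (eliminate (Suc k) G) 0\<bar> \<le> \<bar>y 0\<bar>"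
    using Suc.prems by (intro Suc.IH length_eliminate) auto
  then show ?case
    by (subst canonical.simps(2)) (simp add: Let_def del: canonical.simps(2))
qed

text \<open>Adding inequalities that the canonical solution satisfies does not change it, since it was
  minimal even among more solutions. The proof follows the recursion instead of comparing
  sequences lexicographically: in each coordinate the interval of possible values gets smaller.\<close>

lemma canonical_eqI:
  assumes "finite G" "G \<subseteq> {g. length g = n}" "k \<le> n" "F \<subseteq> G" "solves k (canonical k F) G"
  shows "canonical k G = canonical k F"
  using assms
proof (induction k arbitrary: F G)
  case (Suc k)
  let ?x = "canonical k (eliminate k F)"
  have "solves k (canonical (Suc k) F) (eliminate k G)"
    using Suc.prems by (intro solves_eliminate) auto
  then have "solves k ?x (eliminate k G)"
    by (simp add: solves_def Let_def)
  then have eq: "canonical k (eliminate k G) = ?x"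
    using Suc.prems by (intro Suc.IH eliminate_mono length_eliminate) auto
  have "lower_bounds k F ?x \<subseteq> lower_bounds k G ?x" "upper_bounds k F ?x \<subseteq> upper_bounds k G ?x"
    using Suc.prems(4) by (auto simp: lower_bounds_def upper_bounds_def)
  moreover have "solves (Suc k) (?x(k := closest_to_0 (lower_bounds k F ?x) (upper_bounds k F ?x))) G"
    using Suc.prems(5) by (simp only: canonical.simps Let_def)
  ultimately have "closest_to_0 (lower_bounds k G ?x) (upper_bounds k G ?x)
      = closest_to_0 (lower_bounds k F ?x) (upper_bounds k F ?x)"
    unfolding solves_Suc_iff using Suc.prems(1) by (intro closest_to_0_eqI) auto
  then show ?case by (simp add: Let_def eq)
qed simp

text \<open>The canonical solution is determined by a bounded number of inequalities: each inequality
  that arises by elimination has two parents, and one lower bound and one upper bound determine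
  the last variable.\<close>

primrec basis_size :: "nat \<Rightarrow> nat" where
  "basis_size 0 = 1"
| "basis_size (Suc k) = 2 * basis_size k + 2"

lemma witness_lower_bound:
  assumes "finite G"
  shows "\<exists>S\<subseteq>G. card S \<le> 1 \<and>
    Max (insert 0 (lower_bounds k S x)) = Max (insert 0 (lower_bounds k G x))"
proof (cases "Max (insert 0 (lower_bounds k G x)) = 0")
  case True
  then show ?thesis by (intro exI[of _ "{}"]) (auto simp: lower_bounds_def)
next
  case False
  let ?M = "Max (insert 0 (lower_bounds k G x))"
  note M = Max_insert_0(1,2)[OF finite_bounds(1)[OF assms], of k x]
  then obtain g where "g \<in> G" "g ! Suc k < 0" "?M = slack k g x / g ! Suc k"
    using False by (auto simp: lower_bounds_def)
  then have "lower_bounds k {g} x = {?M}" by (auto simp: lower_bounds_def)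
  then show ?thesis using \<open>g \<in> G\<close> M(2) by (intro exI[of _ "{g}"]) auto
qed

lemma witness_upper_bound:
  assumes "finite G"
  shows "\<exists>S\<subseteq>G. card S \<le> 1 \<and>
    Min (insert 0 (upper_bounds k S x)) = Min (insert 0 (upper_bounds k G x))"
proof (cases "Min (insert 0 (upper_bounds k G x)) = 0")
  case True
  then show ?thesis by (intro exI[of _ "{}"]) (auto simp: upper_bounds_def)
next
  case False
  let ?M = "Min (insert 0 (upper_bounds k G x))"
  note M = Min_insert_0(1,2)[OF finite_bounds(2)[OF assms], of k x]
  then obtain g where "g \<in> G" "g ! Suc k > 0" "?M = slack k g x / g ! Suc k"
    using False by (auto simp: upper_bounds_def)
  then have "upper_bounds k {g} x = {?M}" by (auto simp: upper_bounds_def)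
  then show ?thesis using \<open>g \<in> G\<close> M(2) by (intro exI[of _ "{g}"]) auto
qed

lemma ex_basis:
  assumes "finite G" "G \<subseteq> {g. length g = n}" "k \<le> n"
  shows "\<exists>B\<subseteq>G. card B \<le> basis_size k \<and> (feasible k B \<longrightarrow> feasible k G) \<and>
    (feasible k G \<longrightarrow> canonical k B = canonical k G)"
  using assms
proof (induction k arbitrary: G)
  case 0
  show ?case
  proof (cases "feasible 0 G")
    case False
    then obtain g where "g \<in> G" "\<not> 0 \<le> slack 0 g (\<lambda>_. 0)" by (auto simp: feasible_def solves_def)
    then show ?thesis using False
      by (intro exI[of _ "{g}"]) (auto simp: feasible_def solves_def slack_def)
  qed (intro exI[of _ "{}"], auto)
next
  case (Suc k)
  let ?E = "eliminate k G"
  obtain B' where B': "B' \<subseteq> ?E" "card B' \<le> basis_size k" "feasible k B' \<longrightarrow> feasible k ?E"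
      "feasible k ?E \<longrightarrow> canonical k B' = canonical k ?E"
    using Suc.IH[of ?E] length_eliminate[OF Suc.prems(2), of k] Suc.prems by auto
  have "\<forall>e\<in>B'. \<exists>q. q \<in> G \<times> G \<and> e = (\<lambda>(g, h). combine k g h) q"
    using B'(1) unfolding eliminate_def by blast
  then obtain parents where parents:
      "\<And>e. e \<in> B' \<Longrightarrow> parents e \<in> G \<times> G \<and> e = (\<lambda>(g, h). combine k g h) (parents e)"
    by metis
  have fin: "finite B'" using B'(1) Suc.prems(1) by (auto intro: finite_subset)
  define B1 where "B1 = (fst \<circ> parents) ` B' \<union> (snd \<circ> parents) ` B'"
  have B1: "B1 \<subseteq> G" using parents by (auto simp: B1_def mem_Times_iff)
  have "card B1 \<le> card B' + card B'"
    unfolding B1_def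
    by (intro order_trans[OF card_Un_le] add_mono card_image_le fin)
  then have card_B1: "card B1 \<le> 2 * basis_size k" using B'(2) by simp
  have B'_B1: "B' \<subseteq> eliminate k B1"
  proof
    fix e assume "e \<in> B'"
    then have "parents e \<in> B1 \<times> B1" by (simp add: B1_def mem_Times_iff)
    then show "e \<in> eliminate k B1"
      unfolding eliminate_def using parents[OF \<open>e \<in> B'\<close>] by (metis image_eqI)
  qed
  show ?case
  proof (cases "feasible (Suc k) G")
    case False
    then have "\<not> feasible k ?E" using Suc.prems by (subst feasible_eliminate) auto
    then have "\<not> feasible k (eliminate k B1)" using B' B'_B1 feasible_mono by blast
    then have "\<not> feasible (Suc k) B1"
      using Suc.prems B1 finite_subset[OF B1] by (subst (asm) feasible_eliminate) auto
    then show ?thesis using B1 card_B1 False by (intro exI[of _ B1]) auto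
  next
    case True
    then have feas: "feasible k ?E" using Suc.prems by (subst feasible_eliminate) auto
    let ?x = "canonical k ?E"
    obtain S T where S: "S \<subseteq> G" "card S \<le> 1"
        "Max (insert 0 (lower_bounds k S ?x)) = Max (insert 0 (lower_bounds k G ?x))"
      and T: "T \<subseteq> G" "card T \<le> 1"
        "Min (insert 0 (upper_bounds k T ?x)) = Min (insert 0 (upper_bounds k G ?x))"
      using witness_lower_bound witness_upper_bound Suc.prems(1) by meson
    define B where "B = B1 \<union> (S \<union> T)"
    have B: "B \<subseteq> G" "B1 \<subseteq> B" "S \<subseteq> B" "T \<subseteq> B" using B1 S T by (auto simp: B_def)
    have finB: "finite B" using finite_subset[OF B(1) Suc.prems(1)] .
    have "card B \<le> card B1 + (card S + card T)"
      unfolding B_def by (intro order_trans[OF card_Un_le] add_mono order_refl card_Un_le)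
    then have "card B \<le> basis_size (Suc k)" using card_B1 S T by simp
    moreover have "canonical (Suc k) B = canonical (Suc k) G"
    proof -
      have eq1: "canonical k B' = ?x" using B' feas by simp
      have "solves k ?x ?E"
        using Suc.prems feas by (intro canonical_solves[where n = n] length_eliminate) auto
      then have "solves k (canonical k B') (eliminate k B)"
        using eliminate_mono[OF B(1)] unfolding eq1 by (auto intro: solves_mono)
      then have "canonical k (eliminate k B) = canonical k B'"
        using B'_B1 eliminate_mono[OF B(2), of k] Suc.prems B(1) finB
        by (intro canonical_eqI[where n = n] length_eliminate) auto
      then have eq: "canonical k (eliminate k B) = ?x" using eq1 by simp
      have sub: "lower_bounds k S ?x \<subseteq> lower_bounds k B ?x"
          "lower_bounds k B ?x \<subseteq> lower_bounds k G ?x"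
          "upper_bounds k T ?x \<subseteq> upper_bounds k B ?x"
          "upper_bounds k B ?x \<subseteq> upper_bounds k G ?x"
        using B by (auto simp: lower_bounds_def upper_bounds_def)
      have fin: "finite (lower_bounds k G ?x)" "finite (lower_bounds k B ?x)"
          "finite (upper_bounds k G ?x)" "finite (upper_bounds k B ?x)"
        using Suc.prems(1) finB by auto
      have "Max (insert 0 (lower_bounds k B ?x)) = Max (insert 0 (lower_bounds k G ?x))"
      proof (rule antisym)
        show "Max (insert 0 (lower_bounds k B ?x)) \<le> Max (insert 0 (lower_bounds k G ?x))"
          using sub(2) fin by (intro Max_mono) auto
        show "Max (insert 0 (lower_bounds k G ?x)) \<le> Max (insert 0 (lower_bounds k B ?x))"
          unfolding S(3)[symmetric] using sub(1) fin by (intro Max_mono) auto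
      qed
      moreover have "Min (insert 0 (upper_bounds k B ?x)) = Min (insert 0 (upper_bounds k G ?x))"
      proof (rule antisym)
        show "Min (insert 0 (upper_bounds k G ?x)) \<le> Min (insert 0 (upper_bounds k B ?x))"
          using sub(4) fin by (intro Min_antimono) auto
        show "Min (insert 0 (upper_bounds k B ?x)) \<le> Min (insert 0 (upper_bounds k G ?x))"
          unfolding T(3)[symmetric] using sub(3) fin by (intro Min_antimono) auto
      qed
      ultimately show ?thesis by (simp add: Let_def eq closest_to_0_def del: Max_insert Min_insert)
    qed
    ultimately show ?thesis using B True by (intro exI[of _ B]) auto
  qed
qed

section \<open>Random samples\<close>

text \<open>Nothing is violated if \<open>F\<close> is infeasible: then every system that contains \<open>F\<close> is already known
  to be infeasible.\<close>

definition violated :: "nat \<Rightarrow> real list set \<Rightarrow> real list set" where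
  "violated k F = {h. feasible k F \<and> slack k h (canonical k F) < 0}"

text \<open>If the other inequalities contained a basis of the whole system, then their canonical solution
  would be the canonical solution of the whole system, which violates nothing. So the violated
  inequality belongs to every basis.\<close>

lemma violated_in_basis:
  assumes "finite F" "F \<subseteq> {g. length g = n}" "length h = n" "k \<le> n" "h \<in> violated k F"
    and B: "B \<subseteq> insert h F" "feasible k B \<longrightarrow> feasible k (insert h F)"
      "feasible k (insert h F) \<longrightarrow> canonical k B = canonical k (insert h F)"
  shows "h \<in> B" "h \<notin> F"
proof -
  have F: "feasible k F" "slack k h (canonical k F) < 0" using assms(5) by (auto simp: violated_def)
  show "h \<notin> F"
    using F(2) canonical_solves[OF assms(1,2,4) F(1)] by (force simp: solves_def)
  show "h \<in> B"
  proof (rule ccontr)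
    assume "h \<notin> B"
    then have "B \<subseteq> F" using B(1) by auto
    then have feas: "feasible k (insert h F)" using F(1) feasible_mono B(2) by blast
    have sol: "solves k (canonical k B) (insert h F)"
      using B(3) feas assms canonical_solves[of "insert h F" n k] by auto
    have "canonical k F = canonical k B"
      using assms \<open>B \<subseteq> F\<close> solves_mono[OF sol] by (intro canonical_eqI[where n = n]) auto
    then show False using F(2) sol by (auto simp: solves_def)
  qed
qed

text \<open>Consequently, positions whose inequality is violated by the canonical solution of the other
  positions carry distinct elements of the basis.\<close>

lemma card_violated_left_out:
  assumes "finite V" "V \<subseteq> {g. length g = n}" "set hs \<subseteq> {g. length g = n}" "k \<le> n"
  shows "card {l. l < length hs \<and> hs ! l \<in> violated k (V \<union> set (take l hs @ drop (Suc l) hs))}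
    \<le> basis_size k" (is "card ?S \<le> _")
proof -
  let ?all = "V \<union> set hs"
  let ?F = "\<lambda>l. V \<union> set (take l hs @ drop (Suc l) hs)"
  obtain B where B: "B \<subseteq> ?all" "card B \<le> basis_size k" "feasible k B \<longrightarrow> feasible k ?all"
      "feasible k ?all \<longrightarrow> canonical k B = canonical k ?all"
    using ex_basis[of ?all n k] assms by auto
  have all: "insert (hs ! l) (?F l) = ?all" if "l < length hs" for l
    using id_take_nth_drop[OF that]
    by (metis Un_insert_right list.simps(15) set_append)
  have F: "finite (?F l)" "?F l \<subseteq> {g. length g = n}" for l
    using assms by (auto dest: in_set_takeD in_set_dropD)
  have basis: "hs ! l \<in> B \<and> hs ! l \<notin> ?F l" if "l \<in> ?S" for l
    using violated_in_basis[OF F, of "hs ! l" k l B] that assms B all[of l] by auto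
  have "inj_on (\<lambda>l. hs ! l) ?S"
  proof (rule inj_onI, rule ccontr)
    fix l l' assume l: "l \<in> ?S" "l' \<in> ?S" "hs ! l = hs ! l'" "l \<noteq> l'"
    have "hs ! l' \<in> set (take l hs @ drop (Suc l) hs)"
    proof (cases "l' < l")
      case True
      then have "take l hs ! l' = hs ! l'" "l' < length (take l hs)" using l by auto
      then show ?thesis by (metis Un_iff nth_mem set_append)
    next
      case False
      then have "drop (Suc l) hs ! (l' - Suc l) = hs ! l'" "l' - Suc l < length (drop (Suc l) hs)"
        using l by auto
      then show ?thesis by (metis Un_iff nth_mem set_append)
    qed
    then show False using basis[OF l(1)] l(3) by auto
  qed
  then have "card ?S = card ((\<lambda>l. hs ! l) ` ?S)" by (simp add: card_image)
  also have "\<dots> \<le> card B"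
    using basis B(1) assms by (intro card_mono) (auto intro: finite_subset)
  finally show ?thesis using B(2) by simp
qed

text \<open>If the canonical solution of \<open>F\<close> satisfies \<open>B\<close>, then it is the canonical solution of \<open>B \<union> F\<close>.
  So is that of \<open>B\<close>, which satisfies the whole system and hence \<open>F\<close>. Therefore both are equal.\<close>

lemma solves_basis_imp_solves:
  assumes "finite G" "G \<subseteq> {g. length g = n}" "k \<le> n" "F \<subseteq> G" "B \<subseteq> G"
    and B: "feasible k B \<longrightarrow> feasible k G" "feasible k G \<longrightarrow> canonical k B = canonical k G"
    and F: "feasible k F" "solves k (canonical k F) B"
  shows "solves k (canonical k F) G"
proof -
  have fin: "finite (B \<union> F)" "B \<union> F \<subseteq> {g. length g = n}" "finite F" "F \<subseteq> {g. length g = n}"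
    using assms(1,2,4,5) by (auto intro: finite_subset)
  have "feasible k G" using F(2) B(1) by (auto simp: feasible_def)
  then have G: "solves k (canonical k B) G" using B(2) canonical_solves assms(1-3) by metis
  have "solves k (canonical k F) (B \<union> F)"
    using F canonical_solves[OF fin(3,4) assms(3) F(1)] by (auto simp: solves_def)
  then have "canonical k (B \<union> F) = canonical k F"
    using fin assms(3) by (intro canonical_eqI[where n = n]) auto
  moreover have "canonical k (B \<union> F) = canonical k B"
    using fin assms(3-5) solves_mono[OF G] by (intro canonical_eqI[where n = n]) auto
  ultimately show ?thesis using G by simp
qed

definition draws :: "nat \<Rightarrow> nat \<Rightarrow> nat list set" where
  "draws m r = {xs. length xs = r \<and> set xs \<subseteq> {..<m}}"

lemma finite_draws [simp]: "finite (draws m r)"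
  using finite_lists_length_eq[of "{..<m}" r] by (simp add: draws_def conj_commute)

lemma card_draws: "card (draws m r) = m ^ r"
  using card_lists_length_eq[of "{..<m}" r] by (simp add: draws_def conj_commute)

text \<open>The symmetry behind the sampling lemma: each position of a sample of size \<open>r + 1\<close> can play the
  role of the element drawn last.\<close>

lemma bij_betw_draws:
  assumes "l \<le> r"
  shows "bij_betw (\<lambda>xs. (take l xs @ drop (Suc l) xs, xs ! l)) (draws m (Suc r))
    (draws m r \<times> {..<m})"
proof (rule bij_betw_byWitness[where f' = "\<lambda>(ys, i). take l ys @ i # drop l ys"])
  show "\<forall>xs\<in>draws m (Suc r).
      (\<lambda>(ys, i). take l ys @ i # drop l ys) (take l xs @ drop (Suc l) xs, xs ! l) = xs"
    using assms by (auto simp: draws_def id_take_nth_drop[symmetric])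
  show "\<forall>q\<in>draws m r \<times> {..<m}. (\<lambda>xs. (take l xs @ drop (Suc l) xs, xs ! l))
      ((\<lambda>(ys, i). take l ys @ i # drop l ys) q) = q"
    using assms by (auto simp: draws_def nth_append)
  have "xs ! l < m" if "xs \<in> draws m (Suc r)" for xs
  proof -
    have "xs ! l \<in> set xs" "set xs \<subseteq> {..<m}" using that assms by (auto simp: draws_def)
    then show ?thesis by blast
  qed
  then show "(\<lambda>xs. (take l xs @ drop (Suc l) xs, xs ! l)) ` draws m (Suc r) \<subseteq> draws m r \<times> {..<m}"
    using assms by (auto simp: draws_def dest!: in_set_takeD in_set_dropD)
  show "(\<lambda>(ys, i). take l ys @ i # drop l ys) ` (draws m r \<times> {..<m}) \<subseteq> draws m (Suc r)"
    using assms by (auto simp: draws_def dest!: in_set_takeD in_set_dropD)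
qed

text \<open>The sampling lemma: on average over all samples of size \<open>r\<close>, the canonical solution of the
  sample violates at most \<open>basis_size k * m / (r + 1)\<close> inequalities. Draw one further element;
  by symmetry, it is as likely to be violated by the canonical solution of the others as each of
  the \<open>r + 1\<close> elements of the enlarged sample, and at most \<open>basis_size k\<close> of these are.\<close>

lemma sum_card_violated:
  assumes "finite V" "V \<subseteq> {g. length g = n}" "set hs \<subseteq> {g. length g = n}" "k \<le> n"
  shows "Suc r * (\<Sum>ys\<in>draws (length hs) r.
      card {i. i < length hs \<and> hs ! i \<in> violated k (V \<union> (!) hs ` set ys)})
    \<le> basis_size k * length hs ^ Suc r"
proof -
  let ?m = "length hs"
  let ?P = "\<lambda>ys i. hs ! i \<in> violated k (V \<union> (!) hs ` set ys)"
  let ?del = "\<lambda>l xs. take l xs @ drop (Suc l) xs"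
  have "(\<Sum>ys\<in>draws ?m r. card {i. i < ?m \<and> ?P ys i})
      = (\<Sum>ys\<in>draws ?m r. \<Sum>i<?m. of_bool (?P ys i))"
    by (intro sum.cong refl) (simp add: lessThan_def Collect_conj_eq)
  also have "\<dots> = (\<Sum>(ys, i)\<in>draws ?m r \<times> {..<?m}. of_bool (?P ys i))"
    by (rule sum.cartesian_product)
  finally have pairs: "(\<Sum>ys\<in>draws ?m r. card {i. i < ?m \<and> ?P ys i})
      = (\<Sum>(ys, i)\<in>draws ?m r \<times> {..<?m}. of_bool (?P ys i))" .
  have eq: "(\<Sum>ys\<in>draws ?m r. card {i. i < ?m \<and> ?P ys i})
      = (\<Sum>xs\<in>draws ?m (Suc r). of_bool (?P (?del l xs) (xs ! l)))" if "l \<le> r" for l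
    using pairs sum.reindex_bij_betw[OF bij_betw_draws[OF that, of ?m],
        of "\<lambda>(ys, i). of_bool (?P ys i) :: nat"] by (simp only: prod.case)
  have "Suc r * (\<Sum>ys\<in>draws ?m r. card {i. i < ?m \<and> ?P ys i})
      = (\<Sum>l<Suc r. \<Sum>ys\<in>draws ?m r. card {i. i < ?m \<and> ?P ys i})"
    by (simp del: sum.lessThan_Suc)
  also have "\<dots> = (\<Sum>l<Suc r. \<Sum>xs\<in>draws ?m (Suc r). of_bool (?P (?del l xs) (xs ! l)))"
    by (intro sum.cong refl eq) simp
  also have "\<dots> = (\<Sum>xs\<in>draws ?m (Suc r). \<Sum>l<Suc r. of_bool (?P (?del l xs) (xs ! l)))"
    by (rule sum.swap)
  also have "\<dots> \<le> (\<Sum>xs\<in>draws ?m (Suc r). basis_size k)"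
  proof (rule sum_mono)
    fix xs assume "xs \<in> draws ?m (Suc r)"
    then have xs: "length xs = Suc r" "set xs \<subseteq> {..<?m}" by (auto simp: draws_def)
    let ?gs = "map ((!) hs) xs"
    have "set ?gs \<subseteq> {g. length g = n}" using xs assms(3) by (auto simp: subset_iff)
    then have "card {l. l < Suc r \<and> ?gs ! l \<in> violated k (V \<union> set (?del l ?gs))} \<le> basis_size k"
      using card_violated_left_out[OF assms(1,2) _ assms(4), of ?gs] xs by simp
    also have "{l. l < Suc r \<and> ?gs ! l \<in> violated k (V \<union> set (?del l ?gs))}
        = {l. l < Suc r \<and> ?P (?del l xs) (xs ! l)}"
      using xs by (auto simp: take_map drop_map image_Un)
    finally show "(\<Sum>l<Suc r. of_bool (?P (?del l xs) (xs ! l))) \<le> basis_size k"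
      by (simp add: lessThan_def Collect_conj_eq del: sum.lessThan_Suc)
  qed
  finally show ?thesis by (simp add: card_draws mult.commute)
qed

lemma basis_size_pos: "0 < basis_size k"
  by (induction k) auto

text \<open>By Markov's inequality, at most half of the samples violate more than twice as many
  inequalities as expected, and the expected number is at most \<open>basis_size k * (r + 1)\<close> if
  \<open>m \<le> (r + 1)\<^sup>2\<close>.\<close>

lemma many_violated_rare:
  assumes "finite V" "V \<subseteq> {g. length g = n}" "set hs \<subseteq> {g. length g = n}" "k \<le> n"
    and m: "length hs \<le> Suc r * Suc r" "hs \<noteq> []"
  shows "2 * card {ys \<in> draws (length hs) r. 2 * basis_size k * Suc r <
      card {i. i < length hs \<and> hs ! i \<in> violated k (V \<union> (!) hs ` set ys)}} \<le> length hs ^ r"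
    (is "2 * card ?bad \<le> _")
proof -
  let ?m = "length hs" and ?b = "basis_size k"
  let ?c = "\<lambda>ys. card {i. i < length hs \<and> hs ! i \<in> violated k (V \<union> (!) hs ` set ys)}"
  have "card ?bad * (2 * ?b * Suc r) = (\<Sum>ys\<in>?bad. 2 * ?b * Suc r)" by simp
  also have "\<dots> \<le> (\<Sum>ys\<in>?bad. ?c ys)" by (rule sum_mono) auto
  also have "\<dots> \<le> (\<Sum>ys\<in>draws ?m r. ?c ys)" by (rule sum_mono2) auto
  finally have "Suc r * (card ?bad * (2 * ?b * Suc r)) \<le> ?b * ?m ^ Suc r"
    using sum_card_violated[OF assms(1-4), of r] by (meson le_trans mult_le_mono2)
  then have "?b * ((2 * card ?bad) * (Suc r * Suc r)) \<le> ?b * (?m ^ r * ?m)"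
    by (simp only: mult_ac power_Suc)
  then have "(2 * card ?bad) * (Suc r * Suc r) \<le> ?m ^ r * ?m"
    using basis_size_pos[of k] mult_le_cancel1 by blast
  then have "(2 * card ?bad) * ?m \<le> ?m ^ r * ?m"
    using m(1) by (meson le_trans mult_le_mono2)
  then show ?thesis using m(2) by simp
qed

text \<open>The expectation over \<open>r\<close> independent and uniform draws from \<open>{..<m}\<close>, in the form in which it
  arises from a loop that draws one element at a time.\<close>

primrec mean :: "nat \<Rightarrow> nat \<Rightarrow> (nat list \<Rightarrow> ennreal) \<Rightarrow> ennreal" where
  "mean m 0 F = F []"
| "mean m (Suc r) F = (\<Sum>i<m. mean m r (\<lambda>ys. F (i # ys))) / of_nat m"

lemma mean_eq_sum:
  assumes "m > 0"
  shows "mean m r F = (\<Sum>ys\<in>draws m r. F ys) / of_nat (m ^ r)"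
proof (induction r arbitrary: F)
  case (Suc r)
  have "bij_betw (\<lambda>(i, ys). i # ys) ({..<m} \<times> draws m r) (draws m (Suc r))"
    by (rule bij_betw_byWitness[where f' = "\<lambda>xs. (hd xs, tl xs)"])
      (auto simp: draws_def length_Suc_conv)
  then have "(\<Sum>ys\<in>draws m (Suc r). F ys) = (\<Sum>i<m. \<Sum>ys\<in>draws m r. F (i # ys))"
    by (simp add: sum.cartesian_product sum.reindex_bij_betw[symmetric] case_prod_unfold)
  moreover have "inverse (of_nat m ^ r * of_nat m :: ennreal) =
      inverse (of_nat m ^ r) * inverse (of_nat m)"
    using of_nat_less_top[of m] of_nat_less_top[of "m ^ r"] by (intro ennreal_inverse_mult) auto
  ultimately show ?case
    unfolding mean.simps Suc.IH
    by (simp add: divide_ennreal_def sum_distrib_right[symmetric] mult.assoc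
        mult.commute[of "of_nat m"])
next
  case 0
  have "draws m 0 = {[]}" by (auto simp: draws_def)
  then show ?case by (simp add: divide_ennreal_def)
qed

text \<open>In the potential of the loop over the rounds below, a bad sample costs \<open>2 * t\<close> more than a good
  one.\<close>

lemma mean_add_rare:
  assumes "m > 0" "2 * card {ys \<in> draws m r. bad ys} \<le> m ^ r"
  shows "mean m r (\<lambda>ys. A + (if bad ys then 2 * of_nat t else 0)) \<le> A + of_nat t"
proof -
  have m: "of_nat (m ^ r) > (0 :: ennreal)" "of_nat (m ^ r) < (\<top> :: ennreal)"
    using assms(1) by (simp_all add: of_nat_less_top del: of_nat_power)
  have "(\<Sum>ys\<in>draws m r. A + (if bad ys then 2 * of_nat t else 0))
      = of_nat (m ^ r) * A + of_nat (card {ys \<in> draws m r. bad ys}) * (2 * of_nat t)"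
    by (simp add: sum.distrib sum.If_cases card_draws Int_def conj_commute)
  also have "\<dots> = of_nat (m ^ r) * A + of_nat (2 * card {ys \<in> draws m r. bad ys} * t)"
    by (simp add: mult_ac)
  also have "\<dots> \<le> of_nat (m ^ r) * A + of_nat (m ^ r * t)"
    using assms(2) by (intro add_mono order_refl of_nat_mono mult_right_mono) auto
  also have "\<dots> = of_nat (m ^ r) * (A + of_nat t)"
    by (simp add: algebra_simps)
  finally have "mean m r (\<lambda>ys. A + (if bad ys then 2 * of_nat t else 0))
      \<le> of_nat (m ^ r) * (A + of_nat t) / of_nat (m ^ r)"
    unfolding mean_eq_sum[OF assms(1)] by (rule divide_right_mono_ennreal)
  also have "\<dots> = A + of_nat t"
    using m ennreal_mult_divide_eq[of "of_nat (m ^ r)" "A + of_nat t"]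
    by (simp add: mult.commute less_imp_neq[symmetric] del: of_nat_power)
  finally show ?thesis .
qed

section \<open>Elimination on the machine\<close>

text \<open>An inequality in \<open>D\<close> variables occupies \<open>D + 1\<close> consecutive real cells.\<close>

definition ineq_at :: "nat \<Rightarrow> (nat \<Rightarrow> real) \<Rightarrow> nat \<Rightarrow> real list" where
  "ineq_at D R a = map (\<lambda>j. R (a + j)) [0..<Suc D]"

definition ineqs_at :: "nat \<Rightarrow> (nat \<Rightarrow> real) \<Rightarrow> nat \<Rightarrow> nat \<Rightarrow> real list list" where
  "ineqs_at D R a m = map (\<lambda>i. ineq_at D R (a + i * Suc D)) [0..<m]"

lemma length_ineq_at [simp]: "length (ineq_at D R a) = Suc D"
  by (simp add: ineq_at_def)

lemma ineq_at_nth [simp]: "j \<le> D \<Longrightarrow> ineq_at D R a ! j = R (a + j)"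
  unfolding ineq_at_def by (subst nth_map) (auto simp del: upt_Suc)

lemma ineq_at_cong: "(\<And>x. a \<le> x \<Longrightarrow> x < a + Suc D \<Longrightarrow> R x = R' x) \<Longrightarrow> ineq_at D R a = ineq_at D R' a"
  unfolding ineq_at_def by (rule map_cong) auto

lemma length_ineqs_at [simp]: "length (ineqs_at D R a m) = m"
  by (simp add: ineqs_at_def)

lemma ineqs_at_nth [simp]: "i < m \<Longrightarrow> ineqs_at D R a m ! i = ineq_at D R (a + i * Suc D)"
  by (simp add: ineqs_at_def)

lemma ineqs_at_0 [simp]: "ineqs_at D R a 0 = []"
  by (simp add: ineqs_at_def)

lemma ineqs_at_Suc: "ineqs_at D R a (Suc m) = ineqs_at D R a m @ [ineq_at D R (a + m * Suc D)]"
  by (simp add: ineqs_at_def)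

lemma ineqs_at_append: "ineqs_at D R a (m + n) = ineqs_at D R a m @ ineqs_at D R (a + m * Suc D) n"
  by (induction n) (simp_all add: ineqs_at_Suc algebra_simps del: mult_Suc_right)

lemma set_ineqs: "set (ineqs_at D R a m) \<subseteq> {g. length g = Suc D}"
  by (auto simp: ineqs_at_def)

lemma ineqs_at_cong:
  assumes "\<And>x. a \<le> x \<Longrightarrow> x < a + m * Suc D \<Longrightarrow> R x = R' x"
  shows "ineqs_at D R a m = ineqs_at D R' a m"
  unfolding ineqs_at_def
proof (rule map_cong[OF refl], rule ineq_at_cong, rule assms)
  fix i x assume "i \<in> set [0..<m]" "a + i * Suc D \<le> x" "x < a + i * Suc D + Suc D"
  moreover from this have "Suc i * Suc D \<le> m * Suc D" by (intro mult_le_mono1) auto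
  ultimately show "a \<le> x" "x < a + m * Suc D" by simp_all
qed

lemma ineq_in_ineqs_bound: "i < m \<Longrightarrow> i * Suc D + Suc D \<le> m * Suc D"
  using mult_le_mono1[of "Suc i" m "Suc D"] by simp

lemma exec_Pair_simps:
  "put_nat (Dir i) v (N, R) = (N(i := v), R)"
  "put_nat (Ind i) v (N, R) = (N(N i := v), R)"
  "put_real (Dir i) r (N, R) = (N, R(i := r))"
  "put_real (Ind i) r (N, R) = (N, R(N i := r))"
  "nat_at (N, R) (Dir i) = N i" "nat_at (N, R) (Ind i) = N (N i)"
  "real_at (N, R) (Dir i) = R i" "real_at (N, R) (Ind i) = R (N i)"
  by (simp_all add: put_nat_def put_real_def nat_at_def real_at_def)

text \<open>Conventions: natural number cell 0 is a flag for results, cells 1 and 2 contain the constants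
  \<open>1\<close> and \<open>D + 1\<close>. Real cells 0 to 6 are temporary, cell 7 is never changed by the solvers,
  and the variable \<open>x j\<close> is kept in cell \<open>8 + j\<close>. Arrays of inequalities start at or after
  cell \<open>8 + D\<close>.\<close>

text \<open>Since there are no procedures, a program that occurs as a part of another one is parameterized by
  an offset \<open>b\<close> for the numbers of its natural number cells. It is started with the address and the length of
  an array of inequalities in the cells \<open>b + 3\<close> and \<open>b + 4\<close>. Its local variables are the cells from
  \<open>b + 6\<close> on, and it may overwrite the real cells from the address in cell \<open>b + 5\<close> on.\<close>

definition solver_pre :: "nat \<Rightarrow> nat \<Rightarrow> (nat \<Rightarrow> nat) \<Rightarrow> bool" where
  "solver_pre D b N \<longleftrightarrow> N 1 = 1 \<and> N 2 = Suc D \<and> 8 + D \<le> N (b + 3) \<and> 1 \<le> N (b + 4) \<and>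
    N (b + 3) + N (b + 4) * Suc D \<le> N (b + 5)"

definition solution :: "(nat \<Rightarrow> real) \<Rightarrow> nat \<Rightarrow> real" where
  "solution R j = R (8 + j)"

text \<open>The cells \<open>a\<close> and \<open>b\<close> contain the addresses, which are advanced.\<close>

definition copy_cells :: "nat \<Rightarrow> nat \<Rightarrow> nat \<Rightarrow> prog" where
  "copy_cells k a b = block (concat (map (\<lambda>_.
     [RCopy (Ind b) (Ind a), NAdd (Dir a) (Dir a) (Dir 1), NAdd (Dir b) (Dir b) (Dir 1)]) [0..<k]))"

lemma straight_copy_cells [simp]: "straight (copy_cells k a b)"
  by (auto simp: copy_cells_def)

lemma exec_copy_cells:
  assumes "N 1 = 1" "a \<noteq> b" "a \<noteq> 1" "b \<noteq> 1" "N a + k \<le> N b"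
  shows "exec (copy_cells k a b) (N, R) = (N(a := N a + k, b := N b + k),
    \<lambda>x. if N b \<le> x \<and> x < N b + k then R (N a + (x - N b)) else R x)"
  using assms(5)
proof (induction k)
  case (Suc k)
  have IH: "exec (copy_cells k a b) (N, R) = (N(a := N a + k, b := N b + k),
    \<lambda>x. if N b \<le> x \<and> x < N b + k then R (N a + (x - N b)) else R x)"
    using Suc.prems by (intro Suc.IH) simp
  have "exec (copy_cells (Suc k) a b) (N, R)
      = exec (block [RCopy (Ind b) (Ind a), NAdd (Dir a) (Dir a) (Dir 1),
          NAdd (Dir b) (Dir b) (Dir 1)]) (exec (copy_cells k a b) (N, R))"
    by (simp add: copy_cells_def)
  also have "\<dots> = (N(a := N a + Suc k, b := N b + Suc k),
    \<lambda>x. if N b \<le> x \<and> x < N b + Suc k then R (N a + (x - N b)) else R x)"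
    unfolding IH using assms(1-4) Suc.prems
    by (auto simp: exec_Pair_simps fun_eq_iff less_Suc_eq)
  finally show ?case .
qed (auto simp: copy_cells_def fun_eq_iff)

text \<open>Cell \<open>e\<close> contains the address of the inequality, whose slack is put into real cell 0; afterwards
  it contains the address of the coefficient of \<open>x k\<close>.\<close>

definition compute_slack :: "nat \<Rightarrow> nat \<Rightarrow> prog" where
  "compute_slack k e = block ([RCopy (Dir 0) (Ind e), NAdd (Dir e) (Dir e) (Dir 1)] @
     concat (map (\<lambda>j. [RMul (Dir 1) (Ind e) (Dir (8 + j)), RSub (Dir 0) (Dir 0) (Dir 1),
       NAdd (Dir e) (Dir e) (Dir 1)]) [0..<k]))"

lemma straight_compute_slack [simp]: "straight (compute_slack k e)"
  by (auto simp: compute_slack_def)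

lemma exec_compute_slack:
  assumes "N 1 = 1" "e \<noteq> 1" "8 \<le> N e" "k \<le> D"
  shows "exec (compute_slack k e) (N, R) = (N(e := N e + Suc k),
    R(0 := slack k (ineq_at D R (N e)) (solution R),
      1 := (if k = 0 then R 1 else R (N e + k) * R (7 + k))))"
  using assms(4)
proof (induction k)
  case 0
  then show ?case
    using assms(1-3) by (auto simp: compute_slack_def exec_Pair_simps slack_def fun_eq_iff)
next
  case (Suc k)
  have IH: "exec (compute_slack k e) (N, R) = (N(e := N e + Suc k),
    R(0 := slack k (ineq_at D R (N e)) (solution R),
      1 := (if k = 0 then R 1 else R (N e + k) * R (7 + k))))"
    using Suc.prems by (intro Suc.IH) simp
  have "exec (compute_slack (Suc k) e) (N, R)
      = exec (block [RMul (Dir 1) (Ind e) (Dir (8 + k)), RSub (Dir 0) (Dir 0) (Dir 1),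
       NAdd (Dir e) (Dir e) (Dir 1)]) (exec (compute_slack k e) (N, R))"
    by (simp add: compute_slack_def)
  also have "\<dots> = (N(e := N e + Suc (Suc k)),
    R(0 := slack k (ineq_at D R (N e)) (solution R) - R (N e + Suc k) * R (8 + k),
      1 := R (N e + Suc k) * R (8 + k)))"
    unfolding IH using assms(1-3) by (auto simp: exec_Pair_simps fun_eq_iff)
  also have "slack k (ineq_at D R (N e)) (solution R) - R (N e + Suc k) * R (8 + k)
      = slack (Suc k) (ineq_at D R (N e)) (solution R)"
    using Suc.prems by (simp add: slack_Suc solution_def)
  finally show ?case by simp
qed

subsection \<open>Collecting the violated inequalities\<close>

text \<open>The inequalities that are violated by the current values of the variables are copied to the
  array starting at the address in cell \<open>b + 6\<close>, which is advanced. Cell \<open>b + 7\<close> counts them,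
  \<open>b + 8\<close> is the loop counter, \<open>b + 9\<close> the address of the current inequality, and \<open>b + 10\<close> a
  pointer into it.\<close>

definition collect_violated_body :: "nat \<Rightarrow> nat \<Rightarrow> prog" where
  "collect_violated_body D b = block [
     NCopy (Dir (b + 10)) (Dir (b + 9)),
     compute_slack D (b + 10),
     RConst (Dir 2) 0,
     Cond (RLess (Dir 0) (Dir 2))
       (block [copy_cells (Suc D) (b + 9) (b + 6), NAdd (Dir (b + 7)) (Dir (b + 7)) (Dir 1)])
       (NAdd (Dir (b + 9)) (Dir (b + 9)) (Dir 2)),
     NAdd (Dir (b + 8)) (Dir (b + 8)) (Dir 1)]"

definition collect_violated :: "nat \<Rightarrow> nat \<Rightarrow> prog" where
  "collect_violated D b = Seq (block [NConst (Dir (b + 8)) 0, NConst (Dir (b + 7)) 0,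
       NCopy (Dir (b + 9)) (Dir (b + 3))])
     (While (NLess (Dir (b + 8)) (Dir (b + 4))) (collect_violated_body D b))"

lemma straight_collect_violated_body [simp]: "straight (collect_violated_body D b)"
  by (simp add: collect_violated_body_def)

definition violated_ineqs :: "nat \<Rightarrow> (nat \<Rightarrow> real) \<Rightarrow> real list list \<Rightarrow> real list list" where
  "violated_ineqs D x hs = filter (\<lambda>h. slack D h x < 0) hs"

lemma runs_collect_violated:
  fixes N :: "nat \<Rightarrow> nat" and R :: "nat \<Rightarrow> real"
  assumes "N 1 = 1" "N 2 = Suc D" "8 + D \<le> N (b + 3)"
    and q: "N (b + 3) + N (b + 4) * Suc D \<le> N (b + 6)"
  defines "W \<equiv> violated_ineqs D (solution R) (ineqs_at D R (N (b + 3)) (N (b + 4)))"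
  shows "runs (collect_violated D b) (N, R) (8 + N (b + 4) * (steps (collect_violated_body D b) + 2))
    (\<lambda>(N', R').
      (\<forall>x. x \<notin> {b + 6, b + 7, b + 8, b + 9, b + 10} \<longrightarrow> N' x = N x) \<and>
      (\<forall>x. 3 \<le> x \<and> x < N (b + 6) \<longrightarrow> R' x = R x) \<and>
      N' (b + 7) = length W \<and> N' (b + 6) = N (b + 6) + length W * Suc D \<and>
      ineqs_at D R' (N (b + 6)) (length W) = W)"
proof -
  define P m q where Pmq: "P = N (b + 3)" "m = N (b + 4)" "q = N (b + 6)"
  define hs where "hs = ineqs_at D R P m"
  define V where "V = (\<lambda>i. violated_ineqs D (solution R) (take i hs))"
  define Inv where "Inv = (\<lambda>i (N', R').
      (\<forall>x. x \<notin> {b + 6, b + 7, b + 8, b + 9, b + 10} \<longrightarrow> N' x = N x) \<and>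
      (\<forall>x. 3 \<le> x \<and> x < q \<longrightarrow> R' x = R x) \<and>
      N' (b + 8) = i \<and> N' (b + 9) = P + i * Suc D \<and>
      N' (b + 7) = length (V i) \<and> N' (b + 6) = q + length (V i) * Suc D \<and>
      ineqs_at D R' q (length (V i)) = V i)"
  have step: "Inv (Suc i) (exec (collect_violated_body D b) (N', R'))"
    if i: "i < m" and inv: "Inv i (N', R')" for i N' R'
  proof -
    have N': "\<And>x. x \<notin> {b + 6, b + 7, b + 8, b + 9, b + 10} \<Longrightarrow> N' x = N x"
      and R': "\<And>x. 3 \<le> x \<Longrightarrow> x < q \<Longrightarrow> R' x = R x"
      and cells: "N' (b + 8) = i" "N' (b + 9) = P + i * Suc D"
        "N' (b + 7) = length (V i)" "N' (b + 6) = q + length (V i) * Suc D"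
      and V: "ineqs_at D R' q (length (V i)) = V i"
      using inv by (auto simp: Inv_def)
    define a where "a = P + i * Suc D"
    have a: "a + Suc D \<le> q" "8 \<le> a" "8 + D \<le> q" and cell_a: "N' (b + 9) = a"
      using ineq_in_ineqs_bound[OF i, of D] q assms(3) cells(2) by (auto simp: Pmq a_def)
    have h: "ineq_at D R' a = hs ! i"
      using i R' a by (auto simp: hs_def Pmq a_def intro!: ineq_at_cong)
    have sol: "slack D g (solution R') = slack D g (solution R)" for g
      using R' a by (intro slack_cong) (simp add: solution_def)
    have take: "take (Suc i) hs = take i hs @ [hs ! i]"
      using i by (simp add: hs_def take_Suc_conv_app_nth)
    define N1 R1 where "N1 = N'(b + 10 := a + Suc D)"
      and "R1 = R'(0 := slack D (hs ! i) (solution R),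
        1 := (if D = 0 then R' 1 else R' (a + D) * R' (7 + D)), 2 := 0)"
    have slack: "exec (compute_slack D (b + 10)) (N'(b + 10 := a), R') =
        (N1, R'(0 := slack D (hs ! i) (solution R),
        1 := (if D = 0 then R' 1 else R' (a + D) * R' (7 + D))))"
      using exec_compute_slack[of "N'(b + 10 := a)" "b + 10" D D R'] N' assms(1) a(2)
      by (simp add: h sol N1_def)
    have exec: "exec (collect_violated_body D b) (N', R') =
      exec (NAdd (Dir (b + 8)) (Dir (b + 8)) (Dir 1)) (if slack D (hs ! i) (solution R) < 0
       then exec (NAdd (Dir (b + 7)) (Dir (b + 7)) (Dir 1))
         (exec (copy_cells (Suc D) (b + 9) (b + 6)) (N1, R1))
       else exec (NAdd (Dir (b + 9)) (Dir (b + 9)) (Dir 2)) (N1, R1))"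
      by (simp add: collect_violated_body_def exec_Pair_simps cell_a slack R1_def)
    have N1: "N1 x = N x" if "x \<notin> {b + 6, b + 7, b + 8, b + 9, b + 10}" for x
      using that N' by (simp add: N1_def)
    have N1': "N1 1 = 1" "N1 2 = Suc D" "N1 (b + 6) = q + length (V i) * Suc D"
      "N1 (b + 7) = length (V i)" "N1 (b + 8) = i" "N1 (b + 9) = a"
      using N1[of 1] N1[of 2] assms(1,2) cells cell_a by (auto simp: N1_def)
    have R1: "R1 x = R' x" if "3 \<le> x" for x
      using that by (simp add: R1_def)
    have "ineqs_at D R1 q (length (V i)) = ineqs_at D R' q (length (V i))"
      using a R1 by (intro ineqs_at_cong) auto
    then have V1: "ineqs_at D R1 q (length (V i)) = V i" using V by simp
    show ?thesis
    proof (cases "slack D (hs ! i) (solution R) < 0")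
      case True
      then have VS: "V (Suc i) = V i @ [hs ! i]"
        by (simp add: V_def violated_ineqs_def take)
      define l where "l = N1 (b + 6)"
      have l: "l = q + length (V i) * Suc D" by (simp add: l_def N1')
      define N2 R2 where "N2 = N1(b + 9 := a + Suc D, b + 6 := l + Suc D)"
        and "R2 = (\<lambda>x. if l \<le> x \<and> x < l + Suc D then R1 (a + (x - l)) else R1 x)"
      have copy: "exec (copy_cells (Suc D) (b + 9) (b + 6)) (N1, R1) = (N2, R2)"
        using exec_copy_cells[of N1 "b + 9" "b + 6" "Suc D" R1, unfolded N1'(6) l_def[symmetric]]
          a N1'(1) l unfolding N2_def R2_def by simp
      have "ineqs_at D R2 q (length (V i)) = ineqs_at D R1 q (length (V i))"
        by (intro ineqs_at_cong) (auto simp: R2_def l)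
      then have "ineqs_at D R2 q (length (V i)) = V i" using V1 by simp
      moreover have "ineq_at D R2 l = hs ! i"
        unfolding h[symmetric] ineq_at_def using a R1 by (intro map_cong) (auto simp: R2_def)
      ultimately have "ineqs_at D R2 q (length (V (Suc i))) = V (Suc i)"
        by (simp add: VS ineqs_at_Suc l del: mult_Suc_right)
      moreover have "exec (collect_violated_body D b) (N', R') =
          (N2(b + 7 := length (V i) + 1, b + 8 := i + 1), R2)"
        using True N1' by (simp add: exec copy exec_Pair_simps N2_def)
      moreover have "R2 x = R x" if "3 \<le> x" "x < q" for x
        using that R1 R' by (simp add: R2_def l)
      ultimately show ?thesis
        using N1 N1' by (auto simp: Inv_def VS l N2_def a_def)
    next
      case False
      then have VS: "V (Suc i) = V i"
        by (simp add: V_def violated_ineqs_def take)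
      have "exec (collect_violated_body D b) (N', R') =
          (N1(b + 9 := a + Suc D, b + 8 := i + 1), R1)"
        using False N1' by (simp add: exec exec_Pair_simps)
      then show ?thesis
        using N1 N1' R1 R' V1 by (auto simp: Inv_def VS a_def)
    qed
  qed
  have loop: "runs (While (NLess (Dir (b + 8)) (Dir (b + 4))) (collect_violated_body D b))
      (exec (block [NConst (Dir (b + 8)) 0, NConst (Dir (b + 7)) 0, NCopy (Dir (b + 9)) (Dir (b + 3))])
        (N, R)) (m * (steps (collect_violated_body D b) + 2) + 1) (Inv m)"
  proof (rule runs_While)
    show "holds (NLess (Dir (b + 8)) (Dir (b + 4))) s \<and>
        runs (collect_violated_body D b) s (steps (collect_violated_body D b)) (Inv (Suc i))"
      if "i < m" "Inv i s" for i s
      using that step[of i "fst s" "snd s"]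
      by (cases s) (auto simp: Inv_def exec_Pair_simps Pmq intro!: runs_straight)
  qed (auto simp: Inv_def exec_Pair_simps Pmq V_def violated_ineqs_def)
  show ?thesis
    unfolding collect_violated_def
    by (rule runs_weaken[OF runs_Seq_straight[OF _ loop]])
      (auto simp: Pmq Inv_def W_def V_def hs_def)
qed

subsection \<open>Elimination of one variable\<close>

text \<open>The multipliers are in the real cells 3 and 4, the addresses of the two inequalities and of the
  result in the cells \<open>e\<close>, \<open>f\<close> and \<open>q\<close>.\<close>

definition combine_cells :: "nat \<Rightarrow> nat \<Rightarrow> nat \<Rightarrow> nat \<Rightarrow> prog" where
  "combine_cells n e f q = block (concat (map (\<lambda>_.
     [RMul (Dir 5) (Dir 3) (Ind e), RMul (Dir 6) (Dir 4) (Ind f), RAdd (Ind q) (Dir 5) (Dir 6),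
      NAdd (Dir e) (Dir e) (Dir 1), NAdd (Dir f) (Dir f) (Dir 1), NAdd (Dir q) (Dir q) (Dir 1)])
     [0..<n]))"

lemma straight_combine_cells [simp]: "straight (combine_cells n e f q)"
  by (auto simp: combine_cells_def)

lemma exec_combine_cells:
  assumes "N 1 = 1" "e \<noteq> f" "e \<noteq> q" "f \<noteq> q" "e \<noteq> 1" "f \<noteq> 1" "q \<noteq> 1"
    "7 \<le> N e" "7 \<le> N f" "N e + n \<le> N q" "N f + n \<le> N q"
  shows "\<exists>r5 r6. exec (combine_cells n e f q) (N, R) =
    (N(e := N e + n, f := N f + n, q := N q + n),
     \<lambda>x. if N q \<le> x \<and> x < N q + n
       then R 3 * R (N e + (x - N q)) + R 4 * R (N f + (x - N q)) else (R(5 := r5, 6 := r6)) x)"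
  using assms(10,11)
proof (induction n)
  case 0
  show ?case by (intro exI[of _ "R 5"] exI[of _ "R 6"]) (auto simp: combine_cells_def fun_eq_iff)
next
  case (Suc n)
  define R1 where "R1 = (\<lambda>r5 r6 x. if N q \<le> x \<and> x < N q + n
       then R 3 * R (N e + (x - N q)) + R 4 * R (N f + (x - N q)) else (R(5 := r5, 6 := r6)) x)"
  obtain r5 r6 where IH: "exec (combine_cells n e f q) (N, R) =
    (N(e := N e + n, f := N f + n, q := N q + n), R1 r5 r6)"
    using Suc unfolding R1_def by fastforce
  have neq: "e \<noteq> f" "f \<noteq> e" "e \<noteq> q" "q \<noteq> e" "f \<noteq> q" "q \<noteq> f" "e \<noteq> Suc 0" "f \<noteq> Suc 0" "q \<noteq> Suc 0"
    "Suc 0 \<noteq> e" "Suc 0 \<noteq> f" "Suc 0 \<noteq> q" "N f + n \<noteq> 5"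
    using assms(2-9) by auto
  have R1: "R1 r5 r6 3 = R 3" "R1 r5 r6 4 = R 4" "R1 r5 r6 (N e + n) = R (N e + n)"
    "R1 r5 r6 (N f + n) = R (N f + n)"
    using assms(8,9) Suc.prems by (auto simp: R1_def)
  let ?r5 = "R 3 * R (N e + n)" and ?r6 = "R 4 * R (N f + n)"
  have "exec (combine_cells (Suc n) e f q) (N, R)
      = exec (block [RMul (Dir 5) (Dir 3) (Ind e), RMul (Dir 6) (Dir 4) (Ind f),
        RAdd (Ind q) (Dir 5) (Dir 6), NAdd (Dir e) (Dir e) (Dir 1), NAdd (Dir f) (Dir f) (Dir 1),
        NAdd (Dir q) (Dir q) (Dir 1)]) (exec (combine_cells n e f q) (N, R))"
    by (simp add: combine_cells_def)
  also have "\<dots> = (N(e := N e + n, f := N f + n, q := N q + n,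
        e := N e + Suc n, f := N f + Suc n, q := N q + Suc n),
      (R1 r5 r6)(5 := ?r5, 6 := ?r6, N q + n := ?r5 + ?r6))"
    unfolding IH using assms(1) by (simp add: exec_Pair_simps R1 neq)
  also have "N(e := N e + n, f := N f + n, q := N q + n,
        e := N e + Suc n, f := N f + Suc n, q := N q + Suc n)
      = N(e := N e + Suc n, f := N f + Suc n, q := N q + Suc n)"
    by (simp add: fun_eq_iff)
  also have "(R1 r5 r6)(5 := ?r5, 6 := ?r6, N q + n := ?r5 + ?r6)
      = (\<lambda>x. if N q \<le> x \<and> x < N q + Suc n
         then R 3 * R (N e + (x - N q)) + R 4 * R (N f + (x - N q))
         else (R(5 := ?r5, 6 := ?r6)) x)"
    using assms(8) Suc.prems by (auto simp: fun_eq_iff R1_def less_Suc_eq)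
  finally show ?case by blast
qed

definition set_multipliers :: "nat \<Rightarrow> nat \<Rightarrow> prog" where
  "set_multipliers k b = block [
     NConst (Dir (b + 12)) (Suc k),
     NAdd (Dir (b + 10)) (Dir (b + 8)) (Dir (b + 12)),
     NAdd (Dir (b + 11)) (Dir (b + 9)) (Dir (b + 12)),
     RCopy (Dir 0) (Ind (b + 10)), RCopy (Dir 1) (Ind (b + 11)),
     RConst (Dir 2) 0, RConst (Dir 3) 0, RConst (Dir 4) 0,
     Cond (RLess (Dir 2) (Dir 0))
       (Cond (RLess (Dir 1) (Dir 2))
         (block [RSub (Dir 3) (Dir 2) (Dir 1), RCopy (Dir 4) (Dir 0)]) Skip)
       (Cond (RLess (Dir 0) (Dir 2)) Skip (RConst (Dir 3) 1))]"

lemma exec_set_multipliers: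
  assumes "k < D" "exec (set_multipliers k b) (N, R) = (N', R')"
  shows "x \<notin> {b + 10, b + 11, b + 12} \<Longrightarrow> N' x = N x" "7 \<le> y \<Longrightarrow> R' y = R y"
    "(R' 3, R' 4) = multipliers k (ineq_at D R (N (b + 8))) (ineq_at D R (N (b + 9)))"
proof -
  define g h where "g = R (N (b + 8) + Suc k)" and "h = R (N (b + 9) + Suc k)"
  have "exec (set_multipliers k b) (N, R) =
     (N(b + 12 := Suc k, b + 10 := N (b + 8) + Suc k, b + 11 := N (b + 9) + Suc k),
      (let R0 = R(0 := g, 1 := h, 2 := 0, 3 := 0, 4 := 0) in
       if 0 < g then if h < 0 then R0(3 := - h, 4 := g) else R0
       else if g < 0 then R0 else R0(3 := 1)))"
    by (simp add: set_multipliers_def exec_Pair_simps Let_def g_def h_def)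
  then have eq: "N' = N(b + 12 := Suc k, b + 10 := N (b + 8) + Suc k, b + 11 := N (b + 9) + Suc k)"
    "R' = (let R0 = R(0 := g, 1 := h, 2 := 0, 3 := 0, 4 := 0) in
       if 0 < g then if h < 0 then R0(3 := - h, 4 := g) else R0
       else if g < 0 then R0 else R0(3 := 1))"
    using assms(2) by simp_all
  show "x \<notin> {b + 10, b + 11, b + 12} \<Longrightarrow> N' x = N x" "7 \<le> y \<Longrightarrow> R' y = R y"
    by (simp_all add: eq Let_def)
  have "ineq_at D R (N (b + 8)) ! Suc k = g" "ineq_at D R (N (b + 9)) ! Suc k = h"
    using assms(1) by (simp_all add: g_def h_def)
  then show "(R' 3, R' 4) = multipliers k (ineq_at D R (N (b + 8))) (ineq_at D R (N (b + 9)))"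
    by (simp add: eq multipliers_def Let_def)
qed

definition eliminate_pair :: "nat \<Rightarrow> nat \<Rightarrow> nat \<Rightarrow> prog" where
  "eliminate_pair D k b = block [
     set_multipliers k b,
     NCopy (Dir (b + 10)) (Dir (b + 8)), NCopy (Dir (b + 11)) (Dir (b + 9)),
     combine_cells (Suc D) (b + 10) (b + 11) (b + 13),
     NAdd (Dir (b + 9)) (Dir (b + 9)) (Dir 2),
     NAdd (Dir (b + 14)) (Dir (b + 14)) (Dir 1),
     NAdd (Dir (b + 7)) (Dir (b + 7)) (Dir 1)]"

lemma straight_eliminate_pair [simp]: "straight (eliminate_pair D k b)"
  by (simp add: eliminate_pair_def set_multipliers_def)

lemma exec_eliminate_pair:
  assumes "N 1 = 1" "N 2 = Suc D" "k < D" "8 \<le> N (b + 8)" "8 \<le> N (b + 9)"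
    "N (b + 8) + Suc D \<le> N (b + 13)" "N (b + 9) + Suc D \<le> N (b + 13)"
    and exec: "exec (eliminate_pair D k b) (N, R) = (N', R')"
  shows "x < b + 7 \<Longrightarrow> N' x = N x" "N' (b + 7) = Suc (N (b + 7))" "N' (b + 8) = N (b + 8)"
    "N' (b + 9) = N (b + 9) + Suc D" "N' (b + 13) = N (b + 13) + Suc D"
    "N' (b + 14) = Suc (N (b + 14))"
    "7 \<le> y \<Longrightarrow> y < N (b + 13) \<Longrightarrow> R' y = R y"
    "ineq_at D R' (N (b + 13)) =
      combine k (ineq_at D R (N (b + 8))) (ineq_at D R (N (b + 9)))"
proof -
  let ?g = "ineq_at D R (N (b + 8))" and ?h = "ineq_at D R (N (b + 9))"
  obtain N0 R0 where NR0: "exec (set_multipliers k b) (N, R) = (N0, R0)" by fastforce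
  note m = exec_set_multipliers[OF assms(3) NR0]
  define q where "q = N (b + 13)"
  define N1 where "N1 = N0(b + 10 := N (b + 8), b + 11 := N (b + 9))"
  have N1: "N1 (b + 10) = N (b + 8)" "N1 (b + 11) = N (b + 9)" "N1 (b + 13) = q"
    and N1': "x \<notin> {b + 10, b + 11, b + 12} \<Longrightarrow> N1 x = N x" for x
    using m(1) by (auto simp: N1_def q_def)
  define N2 where "N2 = N1(b + 10 := N (b + 8) + Suc D, b + 11 := N (b + 9) + Suc D, b + 13 := q + Suc D)"
  obtain r5 r6 where comb: "exec (combine_cells (Suc D) (b + 10) (b + 11) (b + 13)) (N1, R0) =
    (N2, \<lambda>x. if q \<le> x \<and> x < q + Suc D
       then R0 3 * R0 (N (b + 8) + (x - q)) + R0 4 * R0 (N (b + 9) + (x - q))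
       else (R0(5 := r5, 6 := r6)) x)"
    using exec_combine_cells[of N1 "b + 10" "b + 11" "b + 13" "Suc D" R0] assms(1,4-7) N1'[of 1]
    unfolding N1 N2_def by (auto simp: q_def)
  have N2: "N2 2 = Suc D" "N2 1 = 1" "N2 (b + 9) = N (b + 9)" "N2 (b + 14) = N (b + 14)"
     "N2 (b + 7) = N (b + 7)"
    using N1' assms(1,2) by (simp_all add: N2_def)
  have "exec (eliminate_pair D k b) (N, R) = exec (block [
     NAdd (Dir (b + 9)) (Dir (b + 9)) (Dir 2),
     NAdd (Dir (b + 14)) (Dir (b + 14)) (Dir 1),
     NAdd (Dir (b + 7)) (Dir (b + 7)) (Dir 1)])
     (exec (combine_cells (Suc D) (b + 10) (b + 11) (b + 13)) (N1, R0))"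
    by (simp add: eliminate_pair_def exec_Pair_simps NR0 m(1) N1_def)
  then have NR': "N' = N2(b + 9 := N (b + 9) + Suc D, b + 14 := Suc (N (b + 14)),
      b + 7 := Suc (N (b + 7)))"
     "R' = (\<lambda>x. if q \<le> x \<and> x < q + Suc D
       then R0 3 * R0 (N (b + 8) + (x - q)) + R0 4 * R0 (N (b + 9) + (x - q))
       else (R0(5 := r5, 6 := r6)) x)"
    unfolding comb using exec N2 by (simp_all add: exec_Pair_simps)
  show "x < b + 7 \<Longrightarrow> N' x = N x" "N' (b + 7) = Suc (N (b + 7))" "N' (b + 8) = N (b + 8)"
    "N' (b + 9) = N (b + 9) + Suc D" "N' (b + 13) = N (b + 13) + Suc D"
    "N' (b + 14) = Suc (N (b + 14))"
    using N1' by (simp_all add: NR'(1) N2_def q_def)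
  show "R' y = R y" if "7 \<le> y" "y < N (b + 13)" using that m(2) by (simp add: NR'(2) q_def)
  have "R0 3 = fst (multipliers k ?g ?h)" "R0 4 = snd (multipliers k ?g ?h)"
    using m(3) by (metis fst_conv, metis snd_conv)
  then show "ineq_at D R' (N (b + 13)) = combine k ?g ?h"
    unfolding combine_def ineq_at_def[of D R'] length_ineq_at
    using assms(4,5) m(2)
    by (intro map_cong refl) (simp add: NR'(2) less_Suc_eq_le q_def atLeast_upt[symmetric] del: upt_Suc)
qed

text \<open>The loop counters are in the cells \<open>b + 6\<close> and \<open>b + 7\<close>, the addresses of the two current
  inequalities in \<open>b + 8\<close> and \<open>b + 9\<close>, and working copies of them in \<open>b + 10\<close> and \<open>b + 11\<close>. The
  results are appended at the address in \<open>b + 13\<close>, and \<open>b + 14\<close> counts them.\<close>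

definition eliminate_row :: "nat \<Rightarrow> nat \<Rightarrow> nat \<Rightarrow> prog" where
  "eliminate_row D k b =
    Seq (block [NConst (Dir (b + 7)) 0, NCopy (Dir (b + 9)) (Dir (b + 3))])
    (Seq (While (NLess (Dir (b + 7)) (Dir (b + 4))) (eliminate_pair D k b))
    (block [NAdd (Dir (b + 8)) (Dir (b + 8)) (Dir 2), NAdd (Dir (b + 6)) (Dir (b + 6)) (Dir 1)]))"

definition eliminate_cells :: "nat \<Rightarrow> nat \<Rightarrow> nat \<Rightarrow> prog" where
  "eliminate_cells D k b =
    Seq (block [NConst (Dir (b + 6)) 0, NCopy (Dir (b + 8)) (Dir (b + 3)),
      NCopy (Dir (b + 13)) (Dir (b + 5)), NConst (Dir (b + 14)) 0])
    (While (NLess (Dir (b + 6)) (Dir (b + 4)))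
      (eliminate_row D k b))"

lemma runs_eliminate_cells:
  fixes N :: "nat \<Rightarrow> nat" and R :: "nat \<Rightarrow> real"
  assumes "N 1 = 1" "N 2 = Suc D" "k < D" "8 + D \<le> N (b + 3)" "1 \<le> N (b + 4)"
    and Q: "N (b + 3) + N (b + 4) * Suc D \<le> N (b + 5)"
  shows "runs (eliminate_cells D k b) (N, R)
    ((steps (eliminate_pair D k b) + 30) * (N (b + 4) * N (b + 4)))
    (\<lambda>(N', R'). (\<forall>x<b + 6. N' x = N x) \<and> (\<forall>x. 7 \<le> x \<and> x < N (b + 5) \<longrightarrow> R' x = R x) \<and>
      N' (b + 13) = N (b + 5) + N (b + 4) * N (b + 4) * Suc D \<and>
      N' (b + 14) = N (b + 4) * N (b + 4) \<and>
      set (ineqs_at D R' (N (b + 5)) (N (b + 4) * N (b + 4))) =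
        eliminate k (set (ineqs_at D R (N (b + 3)) (N (b + 4)))))"
proof -
  define P m Q where Pmq: "P = N (b + 3)" "m = N (b + 4)" "Q = N (b + 5)"
  define G where "G = ineqs_at D R P m"
  \<comment> \<open>the results after \<open>i\<close> complete rows of pairs and \<open>j\<close> pairs of the next row\<close>
  define E where "E = (\<lambda>i j. concat (map (\<lambda>g. map (combine k g) G) (take i G)) @
      map (combine k (G ! i)) (take j G))"
  define frame where "frame = (\<lambda>N' R'. (\<forall>x<b + 6. N' x = N x) \<and>
      (\<forall>x. 7 \<le> x \<and> x < Q \<longrightarrow> R' x = R x))"
  define Inv1 where "Inv1 = (\<lambda>i (N', R'). frame N' R' \<and>
      N' (b + 6) = i \<and> N' (b + 8) = P + i * Suc D \<and> N' (b + 13) = Q + (i * m) * Suc D \<and>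
      N' (b + 14) = i * m \<and> ineqs_at D R' Q (i * m) = E i 0)"
  define Inv2 where "Inv2 = (\<lambda>i j (N', R'). frame N' R' \<and>
      N' (b + 6) = i \<and> N' (b + 8) = P + i * Suc D \<and> N' (b + 7) = j \<and> N' (b + 9) = P + j * Suc D \<and>
      N' (b + 13) = Q + (i * m + j) * Suc D \<and>
      N' (b + 14) = i * m + j \<and> ineqs_at D R' Q (i * m + j) = E i j)"
  let ?tp = "steps (eliminate_pair D k b)"
  have pair: "Inv2 i (Suc j) (exec (eliminate_pair D k b) (N1, R1))"
    if i: "i < m" and j: "j < m" and inv: "Inv2 i j (N1, R1)" for i j N1 R1
  proof -
    have N1: "\<And>x. x < b + 6 \<Longrightarrow> N1 x = N x" and R1: "\<And>x. 7 \<le> x \<Longrightarrow> x < Q \<Longrightarrow> R1 x = R x"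
      and cells: "N1 (b + 6) = i" "N1 (b + 8) = P + i * Suc D" "N1 (b + 7) = j"
        "N1 (b + 9) = P + j * Suc D" "N1 (b + 13) = Q + (i * m + j) * Suc D" "N1 (b + 14) = i * m + j"
      and E: "ineqs_at D R1 Q (i * m + j) = E i j"
      using inv by (auto simp: Inv2_def frame_def)
    obtain N2 R2 where NR2: "exec (eliminate_pair D k b) (N1, R1) = (N2, R2)" by fastforce
    have bounds: "8 \<le> P + i * Suc D" "8 \<le> P + j * Suc D" "P + i * Suc D + Suc D \<le> Q"
      "P + j * Suc D + Suc D \<le> Q"
      using ineq_in_ineqs_bound[OF i, of D] ineq_in_ineqs_bound[OF j, of D] assms(4) Q
      by (auto simp: Pmq)
    have pre: "N1 1 = 1" "N1 2 = Suc D" "k < D" "8 \<le> N1 (b + 8)" "8 \<le> N1 (b + 9)"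
      "N1 (b + 8) + Suc D \<le> N1 (b + 13)" "N1 (b + 9) + Suc D \<le> N1 (b + 13)"
      using N1[of 1] N1[of 2] assms(1-3) bounds by (auto simp: cells)
    note res = exec_eliminate_pair[OF pre NR2]
    have gh: "ineq_at D R1 (P + i * Suc D) = G ! i" "ineq_at D R1 (P + j * Suc D) = G ! j"
      using i j R1 bounds by (auto simp: G_def intro!: ineq_at_cong)
    have "ineqs_at D R2 Q (i * m + j) = E i j"
      unfolding E[symmetric] using res(7) bounds by (intro ineqs_at_cong) (auto simp: cells)
    moreover have "ineq_at D R2 (Q + (i * m + j) * Suc D) = combine k (G ! i) (G ! j)"
      using res(8) unfolding cells gh .
    moreover have "take (Suc j) G = take j G @ [G ! j]"
      using j by (simp add: take_Suc_conv_app_nth G_def)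
    ultimately have "ineqs_at D R2 Q (i * m + Suc j) = E i (Suc j)"
      unfolding add_Suc_right ineqs_at_Suc by (simp add: E_def del: mult_Suc_right)
    then show ?thesis
      using N1 R1 res cells unfolding NR2 Inv2_def frame_def by auto
  qed
  have inner: "runs (eliminate_row D k b) s (m * (?tp + 2) + 11) (Inv1 (Suc i))"
    if i: "i < m" and inv: "Inv1 i s" for i s
  proof -
    let ?next = "block [NAdd (Dir (b + 8)) (Dir (b + 8)) (Dir 2), NAdd (Dir (b + 6)) (Dir (b + 6)) (Dir 1)]"
    let ?s = "exec (block [NConst (Dir (b + 7)) 0, NCopy (Dir (b + 9)) (Dir (b + 3))]) s"
    have loop: "runs (While (NLess (Dir (b + 7)) (Dir (b + 4))) (eliminate_pair D k b)) ?s
        (m * (?tp + 2) + 1) (Inv2 i m)"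
    proof (rule runs_While)
      show "holds (NLess (Dir (b + 7)) (Dir (b + 4))) s \<and>
          runs (eliminate_pair D k b) s ?tp (Inv2 i (Suc j))"
        if "j < m" "Inv2 i j s" for j s
        using that pair[OF i, of j "fst s" "snd s"]
        by (cases s) (auto simp: Inv2_def frame_def exec_Pair_simps Pmq intro!: runs_straight)
      show "Inv2 i 0 ?s"
        using inv by (cases s) (auto simp: Inv1_def Inv2_def frame_def exec_Pair_simps Pmq)
    qed (auto simp: Inv2_def frame_def exec_Pair_simps Pmq)
    have next_row: "runs ?next s' 4 (Inv1 (Suc i))" if "Inv2 i m s'" for s'
    proof (rule runs_straight)
      have "E i m = E (Suc i) 0" using i by (simp add: E_def G_def take_Suc_conv_app_nth)
      then show "Inv1 (Suc i) (exec ?next s')"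
        using that assms(1,2)
        by (cases s') (auto simp: Inv1_def Inv2_def frame_def exec_Pair_simps Pmq add.commute)
    qed auto
    show ?thesis
      unfolding eliminate_row_def
      by (rule runs_weaken[OF runs_Seq_straight[OF _ runs_Seq[OF loop next_row]]]) auto
  qed
  let ?init = "block [NConst (Dir (b + 6)) 0, NCopy (Dir (b + 8)) (Dir (b + 3)),
    NCopy (Dir (b + 13)) (Dir (b + 5)), NConst (Dir (b + 14)) 0]"
  have loop: "runs (While (NLess (Dir (b + 6)) (Dir (b + 4))) (eliminate_row D k b))
      (exec ?init (N, R))
      (m * (m * (?tp + 2) + 11 + 2) + 1) (Inv1 m)"
  proof (rule runs_While)
    show "Inv1 0 (exec ?init (N, R))"
      by (auto simp: Inv1_def frame_def exec_Pair_simps Pmq E_def)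
  qed (use inner in \<open>auto simp: Inv1_def frame_def exec_Pair_simps Pmq\<close>)
  have post: "Inv1 m (N', R') \<Longrightarrow> (\<forall>x<b + 6. N' x = N x) \<and>
      (\<forall>x. 7 \<le> x \<and> x < Q \<longrightarrow> R' x = R x) \<and> N' (b + 13) = Q + m * m * Suc D \<and>
      N' (b + 14) = m * m \<and> set (ineqs_at D R' Q (m * m)) = eliminate k (set G)" for N' R'
    by (auto simp: Inv1_def frame_def E_def G_def eliminate_def)
  have time: "9 + (m * (m * (?tp + 2) + 11 + 2) + 1) \<le> (?tp + 30) * (m * m)"
  proof -
    have "m \<le> m * m" "1 \<le> m * m" using assms(5) by (auto simp: Pmq)
    then have "10 + 13 * m \<le> 28 * (m * m)" by linarith
    then show ?thesis by (simp add: algebra_simps)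
  qed
  show ?thesis
    unfolding eliminate_cells_def Pmq[symmetric] G_def[symmetric]
    by (rule runs_weaken[OF runs_Seq_straight[OF _ loop]]) (use time post in auto)
qed

subsection \<open>The solver based on elimination\<close>

text \<open>When the values of \<open>x j\<close> for \<open>j < k\<close> are known, the lower and upper bounds for \<open>x k\<close> are
  collected in the real cells 5 and 6, which are initially 0; the sum of these cells is the point
  closest to 0 between the bounds.\<close>

definition last_variable_body :: "nat \<Rightarrow> nat \<Rightarrow> prog" where
  "last_variable_body k b = block [
     NCopy (Dir (b + 10)) (Dir (b + 8)),
     compute_slack k (b + 10),
     RCopy (Dir 1) (Ind (b + 10)), RConst (Dir 2) 0, RDiv (Dir 3) (Dir 0) (Dir 1),
     Cond (RLess (Dir 1) (Dir 2)) (Cond (RLess (Dir 5) (Dir 3)) (RCopy (Dir 5) (Dir 3)) Skip) Skip,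
     Cond (RLess (Dir 2) (Dir 1)) (Cond (RLess (Dir 3) (Dir 6)) (RCopy (Dir 6) (Dir 3)) Skip) Skip,
     NAdd (Dir (b + 8)) (Dir (b + 8)) (Dir 2),
     NAdd (Dir (b + 6)) (Dir (b + 6)) (Dir 1)]"

lemma straight_last_variable_body [simp]: "straight (last_variable_body k b)"
  by (simp add: last_variable_body_def)

lemma exec_last_variable_body:
  assumes "N 1 = 1" "N 2 = Suc D" "k < D" "8 \<le> N (b + 8)"
    and exec: "exec (last_variable_body k b) (N, R) = (N', R')"
  defines "g \<equiv> ineq_at D R (N (b + 8))"
  shows "x \<notin> {b + 6, b + 8, b + 10} \<Longrightarrow> N' x = N x"
    "N' (b + 6) = Suc (N (b + 6))" "N' (b + 8) = N (b + 8) + Suc D" "7 \<le> y \<Longrightarrow> R' y = R y"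
    "R' 5 = (if g ! Suc k < 0 then max (slack k g (solution R) / g ! Suc k) (R 5) else R 5)"
    "R' 6 = (if g ! Suc k > 0 then min (slack k g (solution R) / g ! Suc k) (R 6) else R 6)"
proof -
  define a s1 where "a = N (b + 8)" and "s1 = slack k g (solution R)"
  define c where "c = g ! Suc k"
  have c: "c = R (a + Suc k)" using assms(3) by (simp add: c_def g_def a_def)
  define N1 where "N1 = N(b + 10 := a + Suc k)"
  obtain r1 where slack: "exec (compute_slack k (b + 10)) (N(b + 10 := a), R) =
      (N1, R(0 := s1, 1 := r1))"
    using exec_compute_slack[of "N(b + 10 := a)" "b + 10" k D R] assms(1,3,4)
    by (simp add: s1_def g_def a_def N1_def)
  define u where "u = s1 / c"
  define R1 where "R1 = R(0 := s1, 1 := c, 2 := 0, 3 := u)"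
  have prefix: "exec (block [NCopy (Dir (b + 10)) (Dir (b + 8)), compute_slack k (b + 10),
     RCopy (Dir 1) (Ind (b + 10)), RConst (Dir 2) 0, RDiv (Dir 3) (Dir 0) (Dir 1)]) (N, R) = (N1, R1)"
    using assms(4) by (simp add: exec_Pair_simps slack a_def[symmetric] c R1_def u_def N1_def)
  have R1: "R1 1 = c" "R1 (Suc 0) = c" "R1 2 = 0" "R1 3 = u" "R1 5 = R 5" "R1 6 = R 6"
    "7 \<le> y \<Longrightarrow> R1 y = R y" for y
    by (simp_all add: R1_def)
  have N1: "N1 1 = 1" "N1 (Suc 0) = 1" "N1 2 = Suc D" "N1 (b + 8) = a" "N1 (b + 6) = N (b + 6)"
    using assms(1,2) by (simp_all add: N1_def a_def)
  have "exec (last_variable_body k b) (N, R) =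
    exec (block [
     Cond (RLess (Dir 1) (Dir 2)) (Cond (RLess (Dir 5) (Dir 3)) (RCopy (Dir 5) (Dir 3)) Skip) Skip,
     Cond (RLess (Dir 2) (Dir 1)) (Cond (RLess (Dir 3) (Dir 6)) (RCopy (Dir 6) (Dir 3)) Skip) Skip,
     NAdd (Dir (b + 8)) (Dir (b + 8)) (Dir 2), NAdd (Dir (b + 6)) (Dir (b + 6)) (Dir 1)]) (N1, R1)"
    unfolding prefix[symmetric] last_variable_body_def by simp
  also have "\<dots> = (N1(b + 8 := a + Suc D, b + 6 := Suc (N (b + 6))),
      if c < 0 \<and> R 5 < u then R1(5 := u) else if 0 < c \<and> u < R 6 then R1(6 := u) else R1)"
    by (cases "c < 0"; cases "0 < c"; cases "R 5 < u"; cases "u < R 6")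
      (simp_all add: exec_Pair_simps R1 N1)
  finally have eq: "N' = N1(b + 8 := a + Suc D, b + 6 := Suc (N (b + 6)))"
     "R' = (if c < 0 \<and> R 5 < u then R1(5 := u) else if 0 < c \<and> u < R 6 then R1(6 := u) else R1)"
    using exec by simp_all
  show "x \<notin> {b + 6, b + 8, b + 10} \<Longrightarrow> N' x = N x"
    "N' (b + 6) = Suc (N (b + 6))" "N' (b + 8) = N (b + 8) + Suc D" "7 \<le> y \<Longrightarrow> R' y = R y"
    by (simp_all add: eq a_def N1_def R1)
  show "R' 5 = (if g ! Suc k < 0 then max (slack k g (solution R) / g ! Suc k) (R 5) else R 5)"
    "R' 6 = (if g ! Suc k > 0 then min (slack k g (solution R) / g ! Suc k) (R 6) else R 6)"
    unfolding c_def[symmetric] s1_def[symmetric] u_def[symmetric]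
    by (auto simp: eq R1 max_def min_def)
qed

definition last_variable :: "nat \<Rightarrow> nat \<Rightarrow> prog" where
  "last_variable k b =
    Seq (block [NConst (Dir (b + 6)) 0, NCopy (Dir (b + 8)) (Dir (b + 3)),
      RConst (Dir 5) 0, RConst (Dir 6) 0])
    (Seq (While (NLess (Dir (b + 6)) (Dir (b + 4))) (last_variable_body k b))
      (RAdd (Dir (8 + k)) (Dir 5) (Dir 6)))"

lemma bounds_insert:
  "lower_bounds k (insert g G) x =
    (if g ! Suc k < 0 then insert (slack k g x / g ! Suc k) (lower_bounds k G x)
     else lower_bounds k G x)"
  "upper_bounds k (insert g G) x =
    (if g ! Suc k > 0 then insert (slack k g x / g ! Suc k) (upper_bounds k G x)
     else upper_bounds k G x)"
  by (auto simp: lower_bounds_def upper_bounds_def)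

lemma bounds_cong:
  assumes "\<And>j. j < k \<Longrightarrow> x j = y j"
  shows "lower_bounds k G x = lower_bounds k G y" "upper_bounds k G x = upper_bounds k G y"
  using slack_cong[OF assms] by (simp_all add: lower_bounds_def upper_bounds_def)

lemma runs_last_variable:
  fixes N :: "nat \<Rightarrow> nat" and R :: "nat \<Rightarrow> real"
  assumes "N 1 = 1" "N 2 = Suc D" "k < D" "8 + D \<le> N (b + 3)" "1 \<le> N (b + 4)"
  defines "G \<equiv> set (ineqs_at D R (N (b + 3)) (N (b + 4)))"
  shows "runs (last_variable k b) (N, R) ((steps (last_variable_body k b) + 20) * N (b + 4))
    (\<lambda>(N', R'). (\<forall>x<b + 6. N' x = N x) \<and> (\<forall>x\<ge>7. x \<noteq> 8 + k \<longrightarrow> R' x = R x) \<and>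
      R' (8 + k) = closest_to_0 (lower_bounds k G (solution R)) (upper_bounds k G (solution R)))"
proof -
  define P m where Pm: "P = N (b + 3)" "m = N (b + 4)"
  define gs where "gs = ineqs_at D R P m"
  define lo hi where "lo = (\<lambda>i. Max (insert 0 (lower_bounds k (set (take i gs)) (solution R))))"
    and "hi = (\<lambda>i. Min (insert 0 (upper_bounds k (set (take i gs)) (solution R))))"
  define Inv where "Inv = (\<lambda>i (N', R'). (\<forall>x<b + 6. N' x = N x) \<and> (\<forall>x\<ge>7. R' x = R x) \<and>
      N' (b + 6) = i \<and> N' (b + 8) = P + i * Suc D \<and> R' 5 = lo i \<and> R' 6 = hi i)"
  let ?t = "steps (last_variable_body k b)"
  have step: "Inv (Suc i) (exec (last_variable_body k b) (N1, R1))"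
    if i: "i < m" and inv: "Inv i (N1, R1)" for i N1 R1
  proof -
    have N1: "\<And>x. x < b + 6 \<Longrightarrow> N1 x = N x" and R1: "\<And>x. 7 \<le> x \<Longrightarrow> R1 x = R x"
      and cells: "N1 (b + 6) = i" "N1 (b + 8) = P + i * Suc D" "R1 5 = lo i" "R1 6 = hi i"
      using inv by (auto simp: Inv_def)
    obtain N2 R2 where NR2: "exec (last_variable_body k b) (N1, R1) = (N2, R2)" by fastforce
    have pre: "N1 1 = 1" "N1 2 = Suc D" "k < D" "8 \<le> N1 (b + 8)"
      using N1[of 1] N1[of 2] assms(1-4) cells by (auto simp: Pm)
    note res = exec_last_variable_body[OF pre NR2]
    have g: "ineq_at D R1 (N1 (b + 8)) = gs ! i"
      using i R1 assms(4) unfolding cells by (auto simp: gs_def Pm intro!: ineq_at_cong)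
    have sol: "slack k (gs ! i) (solution R1) = slack k (gs ! i) (solution R)"
      using R1 by (intro slack_cong) (simp add: solution_def)
    have take: "set (take (Suc i) gs) = insert (gs ! i) (set (take i gs))"
      using i by (simp add: take_Suc_conv_app_nth gs_def)
    have "R2 5 = lo (Suc i)"
      unfolding res(5) g sol cells(3) lo_def take bounds_insert
      by (auto simp: insert_commute[of 0] simp del: Max_insert intro!: Max_insert[symmetric])
    moreover have "R2 6 = hi (Suc i)"
      unfolding res(6) g sol cells(4) hi_def take bounds_insert
      by (auto simp: insert_commute[of 0] simp del: Min_insert intro!: Min_insert[symmetric])
    ultimately show ?thesis
      using N1 R1 res(1-4) cells unfolding NR2 Inv_def by auto
  qed
  have loop: "runs (While (NLess (Dir (b + 6)) (Dir (b + 4))) (last_variable_body k b))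
      (exec (block [NConst (Dir (b + 6)) 0, NCopy (Dir (b + 8)) (Dir (b + 3)),
      RConst (Dir 5) 0, RConst (Dir 6) 0]) (N, R)) (m * (?t + 2) + 1) (Inv m)"
  proof (rule runs_While)
    show "holds (NLess (Dir (b + 6)) (Dir (b + 4))) s \<and>
        runs (last_variable_body k b) s ?t (Inv (Suc i))"
      if "i < m" "Inv i s" for i s
      using that step[of i "fst s" "snd s"]
      by (cases s) (auto simp: Inv_def exec_Pair_simps Pm intro!: runs_straight)
  qed (auto simp: Inv_def exec_Pair_simps Pm lo_def hi_def lower_bounds_def upper_bounds_def)
  have last: "runs (RAdd (Dir (8 + k)) (Dir 5) (Dir 6)) s 1 (\<lambda>(N', R').
      (\<forall>x<b + 6. N' x = N x) \<and> (\<forall>x\<ge>7. x \<noteq> 8 + k \<longrightarrow> R' x = R x) \<and>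
      R' (8 + k) = closest_to_0 (lower_bounds k G (solution R)) (upper_bounds k G (solution R)))"
    if "Inv m s" for s
    using that by (cases s, intro runs_straight)
      (auto simp: Inv_def exec_Pair_simps closest_to_0_def lo_def hi_def gs_def G_def Pm)
  show ?thesis
    unfolding last_variable_def
    by (rule runs_weaken[OF runs_Seq_straight[OF _ runs_Seq[OF loop last]]])
      (use assms(5) in \<open>auto simp: Pm algebra_simps\<close>)
qed

text \<open>The recursion over the variables takes place in the construction of the program, not at run time.
  The local variables of the inner program start where those of this level end: the cells \<open>b + 17\<close>
  to \<open>b + 19\<close> are the cells \<open>b + 3\<close> to \<open>b + 5\<close> for \<open>b + 14\<close> in place of \<open>b\<close>.\<close>

primrec solve_by_elimination :: "nat \<Rightarrow> nat \<Rightarrow> nat \<Rightarrow> prog" where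
  "solve_by_elimination D 0 b = Skip"
| "solve_by_elimination D (Suc k) b =
    Seq (eliminate_cells D k b)
    (Seq (block [NCopy (Dir (b + 17)) (Dir (b + 5)), NCopy (Dir (b + 18)) (Dir (b + 14)),
      NCopy (Dir (b + 19)) (Dir (b + 13))])
    (Seq (solve_by_elimination D k (b + 14)) (last_variable k b)))"

text \<open>The number of inequalities is squared \<open>k\<close> times, which determines the running time. The result is
  the canonical solution as defined above even if the system is infeasible; this is checked
  afterwards.\<close>

lemma runs_solve_by_elimination:
  assumes "k \<le> D"
  shows "\<exists>C. \<forall>N R. solver_pre D b N \<longrightarrow>
    runs (solve_by_elimination D k b) (N, R) (C * N (b + 4) ^ 2 ^ k)
      (\<lambda>(N', R'). (\<forall>x<b + 6. N' x = N x) \<and>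
        (\<forall>x. x = 7 \<or> 8 + D \<le> x \<and> x < N (b + 5) \<longrightarrow> R' x = R x) \<and>
        (\<forall>j<k. solution R' j = canonical k (set (ineqs_at D R (N (b + 3)) (N (b + 4)))) j))"
  using assms
proof (induction k arbitrary: b)
  case 0
  show ?case by (auto intro!: runs_Skip)
next
  case (Suc k)
  let ?b = "b + 14"
  obtain C where IH: "\<And>N R. solver_pre D ?b N \<Longrightarrow>
    runs (solve_by_elimination D k ?b) (N, R) (C * N (?b + 4) ^ 2 ^ k)
      (\<lambda>(N', R'). (\<forall>x<?b + 6. N' x = N x) \<and>
        (\<forall>x. x = 7 \<or> 8 + D \<le> x \<and> x < N (?b + 5) \<longrightarrow> R' x = R x) \<and>
        (\<forall>j<k. solution R' j = canonical k (set (ineqs_at D R (N (?b + 3)) (N (?b + 4)))) j))"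
    using Suc.IH[of ?b] Suc.prems by auto
  define c1 c2 where "c1 = steps (eliminate_pair D k b) + 30"
    and "c2 = steps (last_variable_body k b) + 20"
  have "runs (solve_by_elimination D (Suc k) b) (N, R) ((c1 + C + c2 + 9) * N (b + 4) ^ 2 ^ Suc k)
      (\<lambda>(N', R'). (\<forall>x<b + 6. N' x = N x) \<and>
        (\<forall>x. x = 7 \<or> 8 + D \<le> x \<and> x < N (b + 5) \<longrightarrow> R' x = R x) \<and>
        (\<forall>j<Suc k. solution R' j =
           canonical (Suc k) (set (ineqs_at D R (N (b + 3)) (N (b + 4)))) j))"
    if "solver_pre D b N" for N R
  proof -
    have pre: "N 1 = 1" "N 2 = Suc D" "8 + D \<le> N (b + 3)" "1 \<le> N (b + 4)"
        "N (b + 3) + N (b + 4) * Suc D \<le> N (b + 5)"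
      using that by (auto simp: solver_pre_def)
    define P m Q where PmQ: "P = N (b + 3)" "m = N (b + 4)" "Q = N (b + 5)"
    define G where "G = set (ineqs_at D R P m)"
    define x where "x = canonical k (eliminate k G)"
    define S1 where "S1 = (\<lambda>(N', R'). (\<forall>x<b + 6. N' x = N x) \<and> (\<forall>x. 7 \<le> x \<and> x < Q \<longrightarrow> R' x = R x) \<and>
      N' (b + 13) = Q + m * m * Suc D \<and> N' (b + 14) = m * m \<and>
      set (ineqs_at D R' Q (m * m)) = eliminate k G)"
    define S2 where "S2 = (\<lambda>(N', R'). (\<forall>x<b + 6. N' x = N x) \<and>
      (\<forall>x. x = 7 \<or> 8 + D \<le> x \<and> x < Q \<longrightarrow> R' x = R x) \<and> (\<forall>j<k. solution R' j = x j))"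
    define S3 where "S3 = (\<lambda>(N', R'). (\<forall>x<b + 6. N' x = N x) \<and>
        (\<forall>x. x = 7 \<or> 8 + D \<le> x \<and> x < Q \<longrightarrow> R' x = R x) \<and>
        (\<forall>j<Suc k. solution R' j = canonical (Suc k) G j))"
    have one: "runs (eliminate_cells D k b) (N, R) (c1 * (m * m)) S1"
      using runs_eliminate_cells[OF pre(1,2) _ pre(3-5), of k R] Suc.prems
      unfolding PmQ[symmetric] c1_def S1_def G_def by simp
    let ?set = "block [NCopy (Dir (b + 17)) (Dir (b + 5)), NCopy (Dir (b + 18)) (Dir (b + 14)),
      NCopy (Dir (b + 19)) (Dir (b + 13))]"
    have two: "runs (solve_by_elimination D k ?b) (exec ?set s) (C * (m * m) ^ 2 ^ k) S2"
      if s: "S1 s" for s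
    proof (cases s)
      case (Pair N1 R1)
      define N2 where "N2 = N1(b + 17 := N1 (b + 5), b + 18 := N1 (b + 14), b + 19 := N1 (b + 13))"
      have ex: "exec ?set s = (N2, R1)"
        by (simp add: Pair exec_Pair_simps N2_def)
      have N1: "\<And>x. x < b + 6 \<Longrightarrow> N1 x = N x" "N1 (b + 13) = Q + m * m * Suc D" "N1 (b + 14) = m * m"
        and R1: "\<And>x. 7 \<le> x \<Longrightarrow> x < Q \<Longrightarrow> R1 x = R x"
        and E: "set (ineqs_at D R1 Q (m * m)) = eliminate k G"
        using s by (auto simp: S1_def Pair)
      have N2: "N2 x = N x" if "x < b + 6" for x using that N1 by (simp add: N2_def)
      have add: "b + 14 + 3 = b + 17" "b + 14 + 4 = b + 18" "b + 14 + 5 = b + 19" "b + 14 + 6 = b + 20"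
        by simp_all
      have cells: "N2 (b + 17) = Q" "N2 (b + 18) = m * m" "N2 (b + 19) = Q + m * m * Suc D"
        using N1 by (simp_all add: N2_def PmQ)
      have sub: "solver_pre D ?b N2"
        using pre N2[of 1] N2[of 2] unfolding solver_pre_def add cells by (auto simp: PmQ)
      show ?thesis
        unfolding ex
        by (rule runs_weaken[OF IH[OF sub, of R1, unfolded add cells]])
          (use N2 R1 pre in \<open>auto simp: S2_def x_def E[unfolded PmQ] PmQ\<close>)
    qed
    have three: "runs (last_variable k b) s (c2 * m) S3" if s: "S2 s" for s
    proof (cases s)
      case (Pair N1 R1)
      have N1: "\<And>x. x < b + 6 \<Longrightarrow> N1 x = N x"
        and R1: "R1 7 = R 7" "\<And>x. 8 + D \<le> x \<Longrightarrow> x < Q \<Longrightarrow> R1 x = R x"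
        and sol: "\<And>j. j < k \<Longrightarrow> solution R1 j = x j"
        using s by (auto simp: S2_def Pair)
      have cells: "N1 1 = 1" "N1 2 = Suc D" "N1 (b + 3) = P" "N1 (b + 4) = m"
        using N1 pre by (simp_all add: PmQ)
      have G: "ineqs_at D R1 P m = ineqs_at D R P m"
        using R1 pre by (intro ineqs_at_cong) (auto simp: PmQ)
      have can: "canonical (Suc k) G = x(k := closest_to_0 (lower_bounds k G x) (upper_bounds k G x))"
        by (simp add: x_def Let_def)
      have sol_Suc: "\<forall>j<Suc k. solution R' j = canonical (Suc k) G j"
        if "\<forall>x\<ge>7. x \<noteq> 8 + k \<longrightarrow> R' x = R1 x"
          "R' (8 + k) = closest_to_0 (lower_bounds k G (solution R1)) (upper_bounds k G (solution R1))"
        for R'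
        using that sol bounds_cong[where k = k and G = G, OF sol] unfolding can
        by (auto simp: solution_def less_Suc_eq)
      show ?thesis
        unfolding Pair
        by (rule runs_weaken[OF runs_last_variable[of N1 D k b R1]])
          (use N1 R1 Suc.prems pre in
            \<open>auto simp: cells S3_def c2_def PmQ[symmetric] G G_def[symmetric] simp del: canonical.simps intro!: sol_Suc[rule_format]\<close>)
    qed
    have "c1 * (m * m) + 1 + (6 + 1 + (C * (m * m) ^ 2 ^ k + 1 + c2 * m))
        \<le> (c1 + C + c2 + 9) * m ^ 2 ^ Suc k"
    proof -
      have 1: "m * m \<le> m ^ 2 ^ Suc k"
        using pre(4) power_increasing[of 2 "2 ^ Suc k" m]
        by (simp add: PmQ power2_eq_square)
      have 2: "m \<le> m * m" "1 \<le> m * m" using pre(4) by (auto simp: PmQ)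
      have 3: "(m * m) ^ 2 ^ k = m ^ 2 ^ Suc k"
        by (simp add: power_mult power2_eq_square[symmetric])
      have "c1 * (m * m) \<le> c1 * m ^ 2 ^ Suc k" "c2 * m \<le> c2 * m ^ 2 ^ Suc k"
        using 1 2 by (intro mult_le_mono; linarith)+
      moreover have "9 \<le> 9 * m ^ 2 ^ Suc k" using 1 2 by linarith
      moreover have "(c1 + C + c2 + 9) * m ^ 2 ^ Suc k =
          c1 * m ^ 2 ^ Suc k + C * m ^ 2 ^ Suc k + c2 * m ^ 2 ^ Suc k + 9 * m ^ 2 ^ Suc k"
        by (simp only: distrib_right)
      ultimately show ?thesis unfolding 3 by linarith
    qed
    then have "runs (solve_by_elimination D (Suc k) b) (N, R)
        ((c1 + C + c2 + 9) * m ^ 2 ^ Suc k) S3"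
      unfolding solve_by_elimination.simps
      by (intro runs_weaken[OF runs_Seq[OF one runs_Seq_straight[OF _ runs_Seq[OF two three]]]]) auto
    then show ?thesis unfolding S3_def G_def PmQ .
  qed
  then show ?case by blast
qed

section \<open>Halving the exponent by random sampling\<close>

text \<open>Besides its own cells, a solver may change the flag in cell 0 and the real cells below
  \<open>8 + D\<close> other than cell 7.\<close>

definition solver_post :: "nat \<Rightarrow> nat \<Rightarrow> (nat \<Rightarrow> nat) \<Rightarrow> (nat \<Rightarrow> real) \<Rightarrow> state \<Rightarrow> bool" where
  "solver_post D b N R = (\<lambda>(N', R').
    (\<forall>x. 0 < x \<and> x < b + 6 \<longrightarrow> N' x = N x) \<and>
    (\<forall>x. x = 7 \<or> 8 + D \<le> x \<and> x < N (b + 5) \<longrightarrow> R' x = R x) \<and>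
    (let G = set (ineqs_at D R (N (b + 3)) (N (b + 4))) in
     if feasible D G then N' 0 = 1 \<and> (\<forall>j<D. solution R' j = canonical D G j) else N' 0 = 0))"

definition solver :: "nat \<Rightarrow> nat \<Rightarrow> nat \<Rightarrow> prog \<Rightarrow> bool" where
  "solver D b e p \<longleftrightarrow> (\<exists>C. \<forall>N R. solver_pre D b N \<longrightarrow>
    runs p (N, R) (C * N (b + 4) ^ e) (solver_post D b N R))"

text \<open>The system is feasible if and only if the point computed by elimination violates no inequality.\<close>

definition elimination_solver :: "nat \<Rightarrow> nat \<Rightarrow> prog" where
  "elimination_solver D b = Seq (solve_by_elimination D D b)
     (Seq (NCopy (Dir (b + 6)) (Dir (b + 5)))
     (Seq (collect_violated D b)
       (block [NConst (Dir 0) 0, Cond (NLess (Dir (b + 7)) (Dir 1)) (NConst (Dir 0) 1) Skip])))"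

lemma violated_ineqs_cong:
  "(\<And>j. j < D \<Longrightarrow> x j = y j) \<Longrightarrow> violated_ineqs D x hs = violated_ineqs D y hs"
  unfolding violated_ineqs_def using slack_cong[of D x y] by simp

lemma violated_ineqs_eq_Nil_iff: "violated_ineqs D x hs = [] \<longleftrightarrow> solves D x (set hs)"
  by (auto simp: violated_ineqs_def solves_def filter_empty_conv not_less)

lemma solver_elimination_solver: "solver D b (2 ^ D) (elimination_solver D b)"
proof -
  obtain C where C: "\<And>N R. solver_pre D b N \<Longrightarrow>
    runs (solve_by_elimination D D b) (N, R) (C * N (b + 4) ^ 2 ^ D)
      (\<lambda>(N', R'). (\<forall>x<b + 6. N' x = N x) \<and>
        (\<forall>x. x = 7 \<or> 8 + D \<le> x \<and> x < N (b + 5) \<longrightarrow> R' x = R x) \<and>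
        (\<forall>j<D. solution R' j = canonical D (set (ineqs_at D R (N (b + 3)) (N (b + 4)))) j))"
    using runs_solve_by_elimination[of D D b] by auto
  define c where "c = steps (collect_violated_body D b) + 2"
  have "runs (elimination_solver D b) (N, R) ((C + c + 20) * N (b + 4) ^ 2 ^ D) (solver_post D b N R)"
    if pre: "solver_pre D b N" for N R
  proof -
    have pre': "N 1 = 1" "N 2 = Suc D" "8 + D \<le> N (b + 3)" "1 \<le> N (b + 4)"
        "N (b + 3) + N (b + 4) * Suc D \<le> N (b + 5)"
      using pre by (auto simp: solver_pre_def)
    define P m Q where PmQ: "P = N (b + 3)" "m = N (b + 4)" "Q = N (b + 5)"
    define hs where "hs = ineqs_at D R P m"
    define x where "x = canonical D (set hs)"
    define W where "W = violated_ineqs D x hs"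
    define S where "S = (\<lambda>(N', R').
      (\<forall>x. x < b + 6 \<longrightarrow> N' x = N x) \<and> (\<forall>x. x = 7 \<or> 8 + D \<le> x \<and> x < Q \<longrightarrow> R' x = R x) \<and>
      (\<forall>j<D. solution R' j = x j))"
    have one: "runs (solve_by_elimination D D b) (N, R) (C * m ^ 2 ^ D) S"
      using C[OF pre, of R] unfolding PmQ[symmetric] S_def x_def hs_def .
    have two: "runs (collect_violated D b) (exec (NCopy (Dir (b + 6)) (Dir (b + 5))) s) (8 + m * c)
        (\<lambda>s. S s \<and> fst s (b + 7) = length W)" if s: "S s" for s
    proof (cases s)
      case (Pair N1 R1)
      define N2 where "N2 = N1(b + 6 := Q)"
      have N1: "\<And>x. x < b + 6 \<Longrightarrow> N1 x = N x"
        and R1: "R1 7 = R 7" "\<And>x. 8 + D \<le> x \<Longrightarrow> x < Q \<Longrightarrow> R1 x = R x"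
        and sol: "\<And>j. j < D \<Longrightarrow> solution R1 j = x j"
        using s by (auto simp: S_def Pair)
      have ex: "exec (NCopy (Dir (b + 6)) (Dir (b + 5))) s = (N2, R1)"
        using N1 by (simp add: Pair exec_Pair_simps N2_def PmQ)
      have cells: "N2 1 = 1" "N2 2 = Suc D" "N2 (b + 3) = P" "N2 (b + 4) = m" "N2 (b + 6) = Q"
        using N1 pre' by (simp_all add: PmQ N2_def)
      have hs: "ineqs_at D R1 P m = hs"
        using R1 pre' unfolding hs_def by (intro ineqs_at_cong) (auto simp: PmQ)
      have W: "violated_ineqs D (solution R1) (ineqs_at D R1 P m) = W"
        unfolding hs W_def by (rule violated_ineqs_cong) (rule sol)
      have "\<And>x. x < b + 6 \<Longrightarrow> N2 x = N x" using N1 by (simp add: N2_def)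
      then show ?thesis
        unfolding ex
        by (intro runs_weaken[OF runs_collect_violated[of N2 D b R1]])
          (use R1 sol pre'[folded PmQ] in \<open>auto simp: cells W S_def c_def solution_def\<close>)
    qed
    have three: "runs (block [NConst (Dir 0) 0, Cond (NLess (Dir (b + 7)) (Dir 1)) (NConst (Dir 0) 1) Skip])
        s 5 (solver_post D b N R)" if s: "S s \<and> fst s (b + 7) = length W" for s
    proof (cases s)
      case (Pair N1 R1)
      have "solves D x (set hs)" if "feasible D (set hs)"
        unfolding x_def using canonical_solves[OF _ set_ineqs _ that[unfolded hs_def]]
        by (simp add: hs_def)
      then have "feasible D (set hs) \<longleftrightarrow> W = []"
        unfolding W_def violated_ineqs_eq_Nil_iff by (auto simp: feasible_def)
      then show ?thesis
        using s pre'(1) by (intro runs_straight)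
          (auto simp: Pair S_def solver_post_def exec_Pair_simps PmQ[symmetric] hs_def[symmetric]
            x_def[symmetric] Let_def)
    qed
    have "1 * m \<le> m ^ 2 ^ D" "1 \<le> m ^ 2 ^ D"
      using pre'(4) self_le_power[of m "2 ^ D"] by (auto simp: PmQ)
    then have "C * m ^ 2 ^ D + 1 + (1 + 1 + (8 + m * c + 1 + 5)) \<le> (C + c + 20) * m ^ 2 ^ D"
      using mult_le_mono2[of m "m ^ 2 ^ D" c]
      unfolding add_mult_distrib mult.commute[of m c] by linarith
    then show ?thesis
      unfolding elimination_solver_def PmQ[symmetric]
      by (intro runs_weaken[OF runs_Seq[OF one runs_Seq_straight[OF _ runs_Seq[OF two three]]]]) auto
  qed
  then show ?thesis unfolding solver_def by blast
qed

subsection \<open>Drawing a sample\<close>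

text \<open>The machine cannot multiply natural numbers, but here one factor is always a constant.\<close>

definition add_multiple :: "nat \<Rightarrow> nat \<Rightarrow> nat \<Rightarrow> prog" where
  "add_multiple n a t = block (replicate n (NAdd (Dir a) (Dir a) (Dir t)))"

lemma straight_add_multiple [simp]: "straight (add_multiple n a t)"
  by (simp add: add_multiple_def)

lemma exec_add_multiple:
  "a \<noteq> t \<Longrightarrow> exec (add_multiple n a t) (N, R) = (N(a := N a + n * N t), R)"
  by (induction n arbitrary: N) (simp_all add: add_multiple_def exec_Pair_simps add.assoc)

text \<open>The index in cell \<open>b + 18\<close> is converted into an address in cell \<open>b + 9\<close>. The sample is built up at
  the address in \<open>b + 6\<close>, and \<open>b + 8\<close> counts its elements.\<close>

definition add_to_sample :: "nat \<Rightarrow> nat \<Rightarrow> prog" where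
  "add_to_sample D b = block [
     NCopy (Dir (b + 9)) (Dir (b + 3)),
     add_multiple (Suc D) (b + 9) (b + 18),
     copy_cells (Suc D) (b + 9) (b + 6),
     NAdd (Dir (b + 8)) (Dir (b + 8)) (Dir 1)]"

lemma straight_add_to_sample [simp]: "straight (add_to_sample D b)"
  by (simp add: add_to_sample_def)

definition sampling_loop :: "nat \<Rightarrow> nat \<Rightarrow> prog" where
  "sampling_loop D b = While (NLess (Dir (b + 8)) (Dir (b + 11)))
     (Seq (NRand (Dir (b + 18)) (Dir (b + 17))) (add_to_sample D b))"

text \<open>The state after drawing the indices \<open>ys\<close>, if the loop was started in \<open>(N, R)\<close>.\<close>

definition sampled :: "nat \<Rightarrow> nat \<Rightarrow> (nat \<Rightarrow> nat) \<Rightarrow> (nat \<Rightarrow> real) \<Rightarrow> nat list \<Rightarrow> state \<Rightarrow> bool" where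
  "sampled D b N R ys = (\<lambda>(N', R').
    (\<forall>x. x \<notin> {b + 6, b + 8, b + 9, b + 18} \<longrightarrow> N' x = N x) \<and>
    (\<forall>x<N (b + 16). R' x = R x) \<and> N' (b + 8) = length ys \<and>
    N' (b + 6) = N (b + 16) + length ys * Suc D \<and>
    ineqs_at D R' (N (b + 16)) (length ys) =
      map ((!) (ineqs_at D R (N (b + 3)) (N (b + 4)))) ys)"

lemma average_add:
  assumes "m > 0"
  shows "(\<Sum>i<m. A + x i) / of_nat m = A + (\<Sum>i<m. x i) / (of_nat m :: ennreal)"
proof -
  have "of_nat m * A / of_nat m = A"
    using assms ennreal_mult_divide_eq[of "of_nat m" A] by (simp add: mult.commute)
  then show ?thesis by (simp add: sum.distrib add_divide_distrib_ennreal)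
qed

text \<open>What follows the loop may take a time that depends on the sample, so the bound has to be an
  average over the samples.\<close>

lemma ert_sampling_loop:
  fixes N :: "nat \<Rightarrow> nat" and R :: "nat \<Rightarrow> real"
  assumes pre: "N 1 = 1" "N (b + 17) = N (b + 4) - 1" "1 \<le> N (b + 4)"
      "N (b + 3) + N (b + 4) * Suc D \<le> N (b + 16)"
    and F: "\<And>ys s. ys \<in> draws (N (b + 4)) (N (b + 11)) \<Longrightarrow> sampled D b N R ys s \<Longrightarrow> f s \<le> F ys"
    and start: "sampled D b N R [] s"
  shows "ert f (sampling_loop D b) s
    \<le> of_nat (N (b + 11) * (steps (add_to_sample D b) + 4) + 1) + mean (N (b + 4)) (N (b + 11)) F"
proof -
  define P m r vp where Pmr: "P = N (b + 3)" "m = N (b + 4)" "r = N (b + 11)" "vp = N (b + 16)"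
  let ?t = "steps (add_to_sample D b)"
  have step: "sampled D b N R (ys @ [i]) (exec (add_to_sample D b) (put_nat (Dir (b + 18)) i s))"
    if i: "i < m" and s: "sampled D b N R ys s" for i ys s
  proof (cases s)
    case (Pair N1 R1)
    have N1: "\<And>x. x \<notin> {b + 6, b + 8, b + 9, b + 18} \<Longrightarrow> N1 x = N x"
      and R1: "\<And>x. x < vp \<Longrightarrow> R1 x = R x"
      and cells: "N1 (b + 8) = length ys" "N1 (b + 6) = vp + length ys * Suc D"
      and arr: "ineqs_at D R1 vp (length ys) = map ((!) (ineqs_at D R P m)) ys"
      using s by (auto simp: sampled_def Pair Pmr)
    define a q where "a = P + i * Suc D" and "q = vp + length ys * Suc D"
    define N2 where "N2 = N1(b + 18 := i, b + 9 := a)"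
    define N3 R3 where "N3 = N2(b + 9 := a + Suc D, b + 6 := q + Suc D)"
      and "R3 = (\<lambda>x. if q \<le> x \<and> x < q + Suc D then R1 (a + (x - q)) else R1 x)"
    have a: "a + Suc D \<le> vp"
      using ineq_in_ineqs_bound[OF i, of D] pre(4) by (auto simp: Pmr a_def)
    have "N2 1 = 1" "N2 (b + 6) = q" "N2 (b + 9) = a" "N2 (b + 8) = length ys"
      using N1 pre(1) cells by (simp_all add: N2_def q_def del: mult_Suc_right)
    note N2 = this
    have "a + Suc D \<le> q" using a by (simp add: q_def)
    then have copy: "exec (copy_cells (Suc D) (b + 9) (b + 6)) (N2, R1) = (N3, R3)"
      using exec_copy_cells[of N2 "b + 9" "b + 6" "Suc D" R1, unfolded N2(2,3)] N2(1)
      unfolding N3_def R3_def by simp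
    have "exec (block [NCopy (Dir (b + 9)) (Dir (b + 3)), add_multiple (Suc D) (b + 9) (b + 18)])
        (put_nat (Dir (b + 18)) i s) = (N2, R1)"
      using N1 by (simp add: Pair exec_Pair_simps exec_add_multiple N2_def a_def Pmr mult.commute)
    then have ex: "exec (add_to_sample D b) (put_nat (Dir (b + 18)) i s)
        = (N3(b + 8 := Suc (length ys)), R3)"
      using copy N1 pre(1) cells by (simp add: add_to_sample_def exec_Pair_simps N3_def N2_def)
    have "ineqs_at D R3 vp (length ys) = ineqs_at D R1 vp (length ys)"
      by (intro ineqs_at_cong) (auto simp: R3_def q_def)
    moreover have "ineq_at D R3 q = ineqs_at D R P m ! i"
      using i a R1 unfolding ineqs_at_nth[OF i] ineq_at_def
      by (intro map_cong) (auto simp: R3_def a_def)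
    ultimately have "ineqs_at D R3 vp (Suc (length ys)) = map ((!) (ineqs_at D R P m)) (ys @ [i])"
      unfolding ineqs_at_Suc q_def arr by simp
    moreover have "R3 x = R x" if "x < vp" for x using that R1 by (simp add: R3_def q_def)
    ultimately show ?thesis
      using N1 unfolding ex by (auto simp: sampled_def N3_def N2_def q_def Pmr)
  qed
  have "sampled D b N R ys s \<Longrightarrow> ys \<in> draws m (length ys) \<Longrightarrow> length ys + k = r \<Longrightarrow>
    ert f (sampling_loop D b) s \<le> of_nat (k * (?t + 4) + 1) + mean m k (\<lambda>zs. F (ys @ zs))" for k ys s
  proof (induction k arbitrary: ys s)
    case 0
    then have "\<not> holds (NLess (Dir (b + 8)) (Dir (b + 11))) s"
      by (cases s) (auto simp: sampled_def exec_Pair_simps Pmr)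
    then have "ert f (sampling_loop D b) s \<le> 1 + f s"
      unfolding sampling_loop_def using ert_While_unfold[of f "NLess (Dir (b + 8)) (Dir (b + 11))" _ s]
      by (simp only: if_False)
    also have "\<dots> \<le> 1 + F ys" using 0 F[of ys s] by (intro add_mono) (auto simp: Pmr)
    finally show ?case by simp
  next
    case (Suc k)
    let ?loop = "sampling_loop D b"
    let ?g = "\<lambda>s'. 1 + ert f ?loop s'"
    have holds: "holds (NLess (Dir (b + 8)) (Dir (b + 11))) s" and range: "nat_at s (Dir (b + 17)) = m - 1"
      using Suc.prems pre(2) by (cases s; auto simp: sampled_def exec_Pair_simps Pmr)+
    define A :: ennreal where "A = 1 + (of_nat ?t + (1 + of_nat (k * (?t + 4) + 1)))"
    have next_draw: "1 + ert ?g (add_to_sample D b) (put_nat (Dir (b + 18)) i s)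
        \<le> A + mean m k (\<lambda>zs. F (ys @ i # zs))" if i: "i < m" for i
    proof -
      let ?s' = "exec (add_to_sample D b) (put_nat (Dir (b + 18)) i s)"
      have "ert ?g (add_to_sample D b) (put_nat (Dir (b + 18)) i s) \<le> of_nat ?t + ?g ?s'"
        by (rule runsD[OF runs_exec]) auto
      also have "ert f ?loop ?s' \<le> of_nat (k * (?t + 4) + 1) + mean m k (\<lambda>zs. F ((ys @ [i]) @ zs))"
        using Suc.prems i step[OF i] by (intro Suc.IH) (auto simp: draws_def)
      finally show ?thesis
        by (simp add: A_def add_mono ac_simps add_left_mono)
    qed
    have "ert f ?loop s \<le> 1 + ert ?g (Seq (NRand (Dir (b + 18)) (Dir (b + 17))) (add_to_sample D b)) s"
      using ert_While_unfold[of f "NLess (Dir (b + 8)) (Dir (b + 11))" _ s] holds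
      unfolding sampling_loop_def by (simp only: if_True)
    also have "\<dots> \<le> 1 + ert (\<lambda>s'. 1 + ert ?g (add_to_sample D b) s')
        (NRand (Dir (b + 18)) (Dir (b + 17))) s"
      by (intro add_mono order_refl ert_Seq)
    also have "\<dots> \<le> 1 + (1 + (\<Sum>i\<le>m - 1. 1 + ert ?g (add_to_sample D b) (put_nat (Dir (b + 18)) i s))
        / of_nat (Suc (m - 1)))"
      using ert_NRand[of _ "Dir (b + 18)" "Dir (b + 17)" s] unfolding range
      by (intro add_mono order_refl)
    also have "{..m - 1} = {..<m}" using pre(3) by (auto simp: Pmr)
    also have "Suc (m - 1) = m" using pre(3) by (auto simp: Pmr)
    also have "1 + (1 + (\<Sum>i<m. 1 + ert ?g (add_to_sample D b) (put_nat (Dir (b + 18)) i s)) / of_nat m)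
        \<le> 1 + (1 + (\<Sum>i<m. A + mean m k (\<lambda>zs. F (ys @ i # zs))) / of_nat m)"
      by (intro add_mono order_refl divide_right_mono_ennreal sum_mono next_draw) auto
    also have "\<dots> = 1 + (1 + (A + mean m (Suc k) (\<lambda>zs. F (ys @ zs))))"
      using pre(3) by (subst average_add) (auto simp: Pmr)
    also have "\<dots> = of_nat (Suc k * (?t + 4) + 1) + mean m (Suc k) (\<lambda>zs. F (ys @ zs))"
      by (simp add: A_def algebra_simps)
    finally show ?case .
  qed
  from this[of "[]" s r] start show ?thesis by (simp add: Pmr draws_def)
qed

subsection \<open>One level of sampling\<close>

text \<open>While the number in cell \<open>b + 11\<close> runs through the natural numbers, cell \<open>b + 12\<close> contains the
  square of its successor, which is updated by \<open>(r + 1)\<^sup>2 = r\<^sup>2 + r + r + 1\<close>.\<close>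

definition sqrt_loop :: "nat \<Rightarrow> prog" where
  "sqrt_loop b = Seq (block [NConst (Dir (b + 11)) 0, NConst (Dir (b + 12)) 1])
    (While (NLeq (Dir (b + 12)) (Dir (b + 4))) (block [
      NAdd (Dir (b + 11)) (Dir (b + 11)) (Dir 1),
      NAdd (Dir (b + 12)) (Dir (b + 12)) (Dir (b + 11)),
      NAdd (Dir (b + 12)) (Dir (b + 12)) (Dir (b + 11)),
      NAdd (Dir (b + 12)) (Dir (b + 12)) (Dir 1)]))"

lemma runs_sqrt_loop:
  fixes N :: "nat \<Rightarrow> nat" and R :: "nat \<Rightarrow> real"
  assumes "N 1 = 1" and r: "r * r \<le> N (b + 4)" "N (b + 4) < Suc r * Suc r"
  shows "runs (sqrt_loop b) (N, R) (6 + r * 10)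
    (\<lambda>(N', R'). R' = R \<and> N' (b + 11) = r \<and> (\<forall>x. x \<notin> {b + 11, b + 12} \<longrightarrow> N' x = N x))"
proof -
  define Inv where "Inv = (\<lambda>i (N', R'). R' = R \<and> N' (b + 11) = i \<and> N' (b + 12) = Suc i * Suc i \<and>
    (\<forall>x. x \<notin> {b + 11, b + 12} \<longrightarrow> N' x = N x))"
  have sq: "Suc i * Suc i \<le> N (b + 4)" if "i < r" for i
    using that r(1) mult_le_mono[of "Suc i" r "Suc i" r] by linarith
  let ?body = "block [
      NAdd (Dir (b + 11)) (Dir (b + 11)) (Dir 1),
      NAdd (Dir (b + 12)) (Dir (b + 12)) (Dir (b + 11)),
      NAdd (Dir (b + 12)) (Dir (b + 12)) (Dir (b + 11)),
      NAdd (Dir (b + 12)) (Dir (b + 12)) (Dir 1)]"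
  have loop: "runs (While (NLeq (Dir (b + 12)) (Dir (b + 4))) ?body)
      (exec (block [NConst (Dir (b + 11)) 0, NConst (Dir (b + 12)) 1]) (N, R)) (r * (8 + 2) + 1) (Inv r)"
  proof (rule runs_While)
    show "holds (NLeq (Dir (b + 12)) (Dir (b + 4))) s \<and> runs ?body s 8 (Inv (Suc i))" if "i < r" "Inv i s" for i s
      using that(2) sq[OF that(1)] assms(1)
      by (cases s) (auto simp: Inv_def exec_Pair_simps intro!: runs_straight)
  qed (use r(2) in \<open>auto simp: Inv_def exec_Pair_simps\<close>)
  show ?thesis
    unfolding sqrt_loop_def
    by (rule runs_weaken[OF runs_Seq_straight[OF _ loop]]) (auto simp: Inv_def)
qed

text \<open>The inequalities collected in earlier rounds (\<open>b + 15\<close> many, ending at the address in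
  \<open>b + 16\<close>) are followed by a fresh sample (of size \<open>b + 11\<close>), and the given solver is applied to
  both together. If its result violates at most \<open>b + 13\<close> inequalities of the input, these are
  collected as well.\<close>

definition solve_sample :: "nat \<Rightarrow> nat \<Rightarrow> prog \<Rightarrow> prog" where
  "solve_sample D b p = Seq (block [
      NCopy (Dir (b + 23)) (Dir (b + 5)), NAdd (Dir (b + 24)) (Dir (b + 15)) (Dir (b + 11)),
      NCopy (Dir (b + 25)) (Dir (b + 6))])
    (Seq p (Cond (NLess (Dir 0) (Dir 1))
      (NConst (Dir (b + 14)) 1)
      (Seq (NCopy (Dir (b + 6)) (Dir (b + 16)))
      (Seq (collect_violated D b)
        (Cond (NLess (Dir (b + 7)) (Dir 1))
          (NConst (Dir (b + 14)) 1)
          (Cond (NLeq (Dir (b + 7)) (Dir (b + 13)))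
            (block [NAdd (Dir (b + 15)) (Dir (b + 15)) (Dir (b + 7)), NCopy (Dir (b + 16)) (Dir (b + 6))])
            Skip))))))"

text \<open>Cell \<open>b + 14\<close> is set to 1 when the result has been found. The number in \<open>b + 13\<close> is at
  least twice the expected number of violated inequalities, because of \<open>m < (r + 1)\<^sup>2\<close>, and \<open>b + 17\<close> contains the largest index.\<close>

definition sampling_solver :: "nat \<Rightarrow> nat \<Rightarrow> prog \<Rightarrow> prog" where
  "sampling_solver D b p = Seq (sqrt_loop b) (Seq
    (block [NCopy (Dir (b + 8)) (Dir (b + 11)), NAdd (Dir (b + 8)) (Dir (b + 8)) (Dir 1),
      NConst (Dir (b + 13)) 0, add_multiple (2 * basis_size D) (b + 13) (b + 8),
      NConst (Dir (b + 14)) 0, NConst (Dir (b + 15)) 0, NCopy (Dir (b + 16)) (Dir (b + 5)),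
      NSub (Dir (b + 17)) (Dir (b + 4)) (Dir 1)])
    (While (NLess (Dir (b + 14)) (Dir 1))
      (Seq (block [NConst (Dir (b + 8)) 0, NCopy (Dir (b + 6)) (Dir (b + 16))])
      (Seq (sampling_loop D b) (solve_sample D b p)))))"

text \<open>The invariant between rounds, if \<open>V\<close> is the list of collected inequalities and \<open>B\<close> is a basis.
  Each successful round collects an element of \<open>B\<close>.\<close>

definition round_inv :: "nat \<Rightarrow> nat \<Rightarrow> (nat \<Rightarrow> nat) \<Rightarrow> (nat \<Rightarrow> real) \<Rightarrow> nat \<Rightarrow> real list set \<Rightarrow>
    real list list \<Rightarrow> state \<Rightarrow> bool" where
  "round_inv D b N R r B V = (\<lambda>(N', R').
    (\<forall>x. 0 < x \<and> x < b + 6 \<longrightarrow> N' x = N x) \<and>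
    (\<forall>x. x = 7 \<or> 8 + D \<le> x \<and> x < N (b + 5) \<longrightarrow> R' x = R x) \<and>
    N' (b + 11) = r \<and> N' (b + 13) = 2 * basis_size D * Suc r \<and> N' (b + 14) = 0 \<and>
    N' (b + 15) = length V \<and> N' (b + 16) = N (b + 5) + length V * Suc D \<and>
    N' (b + 17) = N (b + 4) - 1 \<and>
    ineqs_at D R' (N (b + 5)) (length V) = V \<and>
    set V \<subseteq> set (ineqs_at D R (N (b + 3)) (N (b + 4))) \<and>
    length V + 2 * basis_size D * Suc r * card (B - set V)
      \<le> 2 * basis_size D * Suc r * basis_size D)"

definition bad_sample :: "nat \<Rightarrow> real list list \<Rightarrow> real list list \<Rightarrow> nat list \<Rightarrow> bool" where
  "bad_sample D hs V ys \<longleftrightarrow> 2 * basis_size D * Suc (length ys) <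
    card {i. i < length hs \<and> hs ! i \<in> violated D (set V \<union> (!) hs ` set ys)}"

text \<open>One round after the sample \<open>ys\<close> has been drawn: either it ends with the result, or some
  element of the basis is collected, or the sample was bad.\<close>

lemma runs_solve_sample:
  fixes N :: "nat \<Rightarrow> nat" and R :: "nat \<Rightarrow> real"
  assumes hs_def: "hs = ineqs_at D R (N (b + 3)) (N (b + 4))"
    and pre: "solver_pre D b N" and r: "1 \<le> r" "r * r \<le> N (b + 4)"
    and B: "B \<subseteq> set hs" "feasible D B \<longrightarrow> feasible D (set hs)"
      "feasible D (set hs) \<longrightarrow> canonical D B = canonical D (set hs)"
    and p: "\<And>N R. solver_pre D (b + 20) N \<Longrightarrow>
      runs p (N, R) (C * N (b + 24) ^ (2 * e)) (solver_post D (b + 20) N R)"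
    and e: "1 \<le> e"
    and inv: "round_inv D b N R r B V (N1, R1)"
    and ys: "ys \<in> draws (N (b + 4)) r" "sampled D b N1 R1 ys (N2, R2)"
  shows "runs (solve_sample D b p) (N2, R2)
    ((C * (4 * basis_size D * basis_size D + 1) ^ (2 * e) + steps (collect_violated_body D b) + 30) *
       N (b + 4) ^ e)
    (\<lambda>(N', R').
      (N' (b + 14) = 1 \<and> solver_post D b N R (N', R')) \<or>
      (\<exists>V'. round_inv D b N R r B V' (N', R') \<and> card (B - set V') < card (B - set V)) \<or>
      (round_inv D b N R r B V (N', R') \<and> bad_sample D hs V ys))"
proof -
  define P m Q where PmQ: "P = N (b + 3)" "m = N (b + 4)" "Q = N (b + 5)"
  define bs where "bs = basis_size D"
  define thr where "thr = 2 * bs * Suc r"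
  have pre': "N 1 = 1" "N 2 = Suc D" "8 + D \<le> P" "1 \<le> m" "P + m * Suc D \<le> Q"
    using pre by (auto simp: solver_pre_def PmQ)
  have hs: "hs = ineqs_at D R P m" by (simp add: hs_def PmQ)
  have inv': "\<And>x. 0 < x \<Longrightarrow> x < b + 6 \<Longrightarrow> N1 x = N x" "R1 7 = R 7"
      "\<And>x. 8 + D \<le> x \<Longrightarrow> x < Q \<Longrightarrow> R1 x = R x"
      "N1 (b + 11) = r" "N1 (b + 13) = thr" "N1 (b + 14) = 0" "N1 (b + 15) = length V"
      "N1 (b + 16) = Q + length V * Suc D" "N1 (b + 17) = m - 1"
      "ineqs_at D R1 Q (length V) = V" "set V \<subseteq> set hs" "length V + thr * card (B - set V) \<le> thr * bs"
    using inv by (auto simp: round_inv_def PmQ hs_def thr_def bs_def)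
  have ys_len: "length ys = r" "set ys \<subseteq> {..<m}" using ys(1) by (auto simp: draws_def PmQ)
  define vp q where "vp = Q + length V * Suc D" and "q = vp + r * Suc D"
  have hs1: "ineqs_at D R1 P m = hs"
    unfolding hs using inv'(3) pre' by (intro ineqs_at_cong) auto
  have N2: "\<And>x. x \<notin> {b + 6, b + 8, b + 9, b + 18} \<Longrightarrow> N2 x = N1 x" "\<And>x. x < vp \<Longrightarrow> R2 x = R1 x"
      "N2 (b + 6) = q" "ineqs_at D R2 vp r = map ((!) hs) ys"
    using ys(2) inv'(1)[of "b + 3"] inv'(1)[of "b + 4"] hs1 ys_len(1)
    by (auto simp: sampled_def inv'(8) vp_def q_def PmQ)
  define F where "F = set V \<union> (!) hs ` set ys"
  have F: "F \<subseteq> set hs" "F \<subseteq> {g. length g = Suc D}" "finite F"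
    using inv'(11) ys_len set_ineqs[of D R P m] nth_mem[of _ hs]
    by (auto simp: F_def hs simp del: nth_mem ineqs_at_nth)
  have arr: "set (ineqs_at D R2 Q (length V + r)) = F"
  proof -
    have "ineqs_at D R2 Q (length V) = ineqs_at D R1 Q (length V)"
      using N2(2) by (intro ineqs_at_cong) (auto simp: vp_def)
    then show ?thesis
      unfolding ineqs_at_append F_def vp_def[symmetric] N2(4) using inv'(10) by simp
  qed
  define x where "x = canonical D F"
  define W where "W = violated_ineqs D x hs"
  let ?init = "block [NCopy (Dir (b + 23)) (Dir (b + 5)), NAdd (Dir (b + 24)) (Dir (b + 15)) (Dir (b + 11)),
      NCopy (Dir (b + 25)) (Dir (b + 6))]"
  define N3 where "N3 = N2(b + 23 := Q, b + 24 := length V + r, b + 25 := q)"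
  have init: "exec ?init (N2, R2) = (N3, R2)"
    using N2(1,3) inv'(1)[of "b + 5"] inv'(4,7)
    by (simp add: exec_Pair_simps N3_def PmQ)
  have N3: "N3 x = N1 x" if "x < b + 20" "x \<notin> {b + 6, b + 8, b + 9, b + 18}" for x
    using that N2(1) by (simp add: N3_def)
  have N3': "N3 1 = 1" "N3 2 = Suc D" "N3 (b + 23) = Q" "N3 (b + 24) = length V + r" "N3 (b + 25) = q"
    using N3[of 1] N3[of 2] inv'(1)[of 1] inv'(1)[of 2] pre' by (auto simp: N3_def)
  have add: "b + 20 + 3 = b + 23" "b + 20 + 4 = b + 24" "b + 20 + 5 = b + 25" "b + 20 + 6 = b + 26"
    by simp_all
  have q: "Q + (length V + r) * Suc D = q" by (simp add: q_def vp_def algebra_simps)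
  have "solver_pre D (b + 20) N3"
    unfolding solver_pre_def add N3' q using pre' r(1) by auto
  note sub = p[OF this, of R2, unfolded N3']
  define S1 where "S1 = (\<lambda>(N4, R4).
    (\<forall>x. 0 < x \<and> x < b + 26 \<longrightarrow> N4 x = N3 x) \<and>
    (\<forall>x. x = 7 \<or> 8 + D \<le> x \<and> x < q \<longrightarrow> R4 x = R2 x) \<and>
    (if feasible D F then N4 0 = 1 \<and> (\<forall>j<D. solution R4 j = x j) else N4 0 = 0))"
  have solve: "runs p (exec ?init (N2, R2)) (C * (length V + r) ^ (2 * e)) S1"
    unfolding init
    by (rule runs_weaken[OF sub])
      (auto simp only: solver_post_def S1_def add N3' arr x_def Let_def split: prod.splits if_splits)
  define Out where "Out = (\<lambda>(N', R').
      (N' (b + 14) = 1 \<and> solver_post D b N R (N', R')) \<or>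
      (\<exists>V'. round_inv D b N R r B V' (N', R') \<and> card (B - set V') < card (B - set V)) \<or>
      (round_inv D b N R r B V (N', R') \<and> bad_sample D hs V ys))"
  have frame: "N4 x = N x" if "S1 (N4, R4)" "0 < x" "x < b + 6" for N4 R4 x
    using that N3[of x] inv'(1)[of x] by (auto simp: S1_def)
  have R2': "R2 x = R x" if "x = 7 \<or> 8 + D \<le> x \<and> x < Q" for x
    using that inv'(2,3) N2(2) pre' by (auto simp: vp_def)
  have frameR: "R4 x = R x" if "S1 (N4, R4)" "x = 7 \<or> 8 + D \<le> x \<and> x < Q" for N4 R4 x
    using that R2' by (auto simp: S1_def q_def vp_def)
  have infeasible: "runs (NConst (Dir (b + 14)) 1) (N4, R4) 1 Out"
    if S1: "S1 (N4, R4)" and "N4 0 < N4 1" for N4 R4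
  proof (rule runs_straight)
    have "\<not> feasible D F" using that frame[OF S1, of 1] pre' by (auto simp: S1_def split: if_splits)
    then have "\<not> feasible D (set hs)" "N4 0 = 0"
      using feasible_mono F(1) S1 by (auto simp: S1_def)
    then show "Out (exec (NConst (Dir (b + 14)) 1) (N4, R4))"
      using frame[OF S1] frameR[OF S1]
      by (auto simp: Out_def exec_Pair_simps solver_post_def hs_def Let_def PmQ)
  qed auto
  let ?finish = "Cond (NLess (Dir (b + 7)) (Dir 1)) (NConst (Dir (b + 14)) 1)
     (Cond (NLeq (Dir (b + 7)) (Dir (b + 13)))
      (block [NAdd (Dir (b + 15)) (Dir (b + 15)) (Dir (b + 7)), NCopy (Dir (b + 16)) (Dir (b + 6))]) Skip)"
  define S2 where "S2 = (\<lambda>N4 R4 (N5, R5).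
      (\<forall>x. x \<notin> {b + 6, b + 7, b + 8, b + 9, b + 10} \<longrightarrow> N5 x = N4 x) \<and>
      (\<forall>x. 3 \<le> x \<and> x < vp \<longrightarrow> R5 x = R4 x) \<and>
      N5 (b + 7) = length W \<and> N5 (b + 6) = vp + length W * Suc D \<and>
      ineqs_at D R5 vp (length W) = W)"
  have collect: "runs (collect_violated D b) (exec (NCopy (Dir (b + 6)) (Dir (b + 16))) (N4, R4))
      (8 + m * (steps (collect_violated_body D b) + 2)) (S2 N4 R4)"
    if S1: "S1 (N4, R4)" and feas: "feasible D F" for N4 R4
  proof -
    define N4' where "N4' = N4(b + 6 := vp)"
    have "N4 (b + 16) = vp" using S1 N3[of "b + 16"] inv'(8) by (auto simp: S1_def vp_def)
    then have ex: "exec (NCopy (Dir (b + 6)) (Dir (b + 16))) (N4, R4) = (N4', R4)"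
      by (simp add: exec_Pair_simps N4'_def)
    have cells: "N4' 1 = 1" "N4' 2 = Suc D" "N4' (b + 3) = P" "N4' (b + 4) = m" "N4' (b + 6) = vp"
      using frame[OF S1] pre' by (simp_all add: N4'_def PmQ)
    have "ineqs_at D R4 P m = hs"
      unfolding hs using frameR[OF S1] pre' by (intro ineqs_at_cong) auto
    then have W: "violated_ineqs D (solution R4) (ineqs_at D R4 P m) = W"
      unfolding W_def using S1 feas by (auto simp: S1_def intro!: violated_ineqs_cong)
    have "N4' x = N4 x" if "x \<noteq> b + 6" for x using that by (simp add: N4'_def)
    moreover have "N4 1 = 1" using frame[OF S1, of 1] pre' by simp
    ultimately show ?thesis
      unfolding ex
      by (intro runs_weaken[OF runs_collect_violated[of N4' D b R4]])
        (use pre' in \<open>auto simp: cells W S2_def vp_def\<close>)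
  qed
  have finish: "runs ?finish s 6 Out"
    if S1: "S1 (N4, R4)" and feas: "feasible D F" and S2: "S2 N4 R4 s" for N4 R4 s
  proof (cases s)
    case (Pair N5 R5)
    note S2' = S2[unfolded Pair S2_def prod.case]
    have N5: "N5 x = N3 x" if "0 < x" "x < b + 26" "x \<notin> {b + 6, b + 7, b + 8, b + 9, b + 10}" for x
      using S2' S1 that by (auto simp: S1_def)
    have N5f: "N5 x = N x" if "0 < x" "x < b + 6" for x
      using S2' frame[OF S1] that by auto
    have N5c: "N5 (b + 11) = r" "N5 (b + 13) = thr" "N5 (b + 14) = 0" "N5 (b + 15) = length V"
      "N5 (b + 16) = vp" "N5 (b + 17) = m - 1" "N5 1 = 1"
      using N5 N3 inv' N5f[of 1] pre' by (auto simp: vp_def)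
    have R5f: "R5 x = R x" if "x = 7 \<or> 8 + D \<le> x \<and> x < Q" for x
      using S2' frameR[OF S1 that] that pre' by (auto simp: vp_def)
    have V5: "ineqs_at D R5 Q (length V) = V"
    proof -
      have "ineqs_at D R5 Q (length V) = ineqs_at D R1 Q (length V)"
      proof (rule ineqs_at_cong)
        fix x assume x: "Q \<le> x" "x < Q + length V * Suc D"
        then have "R5 x = R4 x" "R4 x = R2 x" "R2 x = R1 x"
          using S2' S1 N2(2) pre' by (auto simp: S1_def vp_def q_def)
        then show "R5 x = R1 x" by simp
      qed
      then show ?thesis using inv'(10) by simp
    qed
    have sol5: "solution R5 j = x j" if "j < D" for j
    proof -
      have "8 + j < vp" using that pre' by (simp add: vp_def)
      then have "R5 (8 + j) = R4 (8 + j)" using S2' by auto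
      then show ?thesis using S1 feas that by (auto simp: S1_def solution_def)
    qed
    have flag: "N5 0 = 1" using S2' S1 feas by (auto simp: S1_def)
    have W_violated: "W = filter (\<lambda>h. h \<in> violated D F) hs"
      using feas by (simp add: W_def violated_ineqs_def violated_def x_def)
    show ?thesis
    proof (cases "W = []")
      case True
      then have "solves D x (set hs)" by (simp add: W_def violated_ineqs_eq_Nil_iff)
      moreover from this have "canonical D (set hs) = x"
        unfolding x_def using F(1) set_ineqs[of D R P m]
        by (intro canonical_eqI[where n = "Suc D"]) (auto simp: hs)
      ultimately have "solver_post D b N R (N5(b + 14 := 1), R5)"
        using N5f R5f sol5 flag
        by (auto simp: solver_post_def Let_def hs[symmetric] PmQ[symmetric] feasible_def)
      then show ?thesis
        using True S2' N5c by (intro runs_straight) (auto simp: Pair exec_Pair_simps Out_def)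
    next
      case False
      then have "\<not> solves D x (set hs)" by (simp add: W_def violated_ineqs_eq_Nil_iff)
      \<comment> \<open>hence some element of the basis is violated, and it is collected now\<close>
      then have "\<not> solves D x B"
        using solves_basis_imp_solves[of "set hs" "Suc D" D F B] B F feas set_ineqs[of D R P m]
        by (auto simp: x_def hs)
      then obtain \<beta> where \<beta>: "\<beta> \<in> B" "slack D \<beta> x < 0" by (auto simp: solves_def not_le)
      have "solves D x F" unfolding x_def using F feas by (intro canonical_solves[where n = "Suc D"]) auto
      then have "\<beta> \<notin> set V" using \<beta>(2) unfolding solves_def F_def by (meson UnI1 not_le)
      moreover have "\<beta> \<in> set W" using \<beta> B(1) by (auto simp: W_def violated_ineqs_def)
      ultimately have "B - set (V @ W) \<subset> B - set V" using \<beta>(1) by auto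
      then have less: "card (B - set (V @ W)) < card (B - set V)"
        using B(1) by (intro psubset_card_mono) (auto intro: finite_subset)
      show ?thesis
      proof (cases "length W \<le> thr")
        case True
        define N6 where "N6 = N5(b + 15 := length V + length W, b + 16 := vp + length W * Suc D)"
        have "exec ?finish s = (N6, R5)"
          using True False S2' N5c by (simp add: Pair exec_Pair_simps N6_def)
        moreover have "round_inv D b N R r B (V @ W) (N6, R5)"
        proof -
          have "ineqs_at D R5 Q (length (V @ W)) = V @ W"
            using S2' V5 by (simp add: ineqs_at_append vp_def)
          moreover have "length (V @ W) + thr * card (B - set (V @ W)) \<le> thr * bs"
          proof -
            have "thr * Suc (card (B - set (V @ W))) \<le> thr * card (B - set V)"
              using less by (intro mult_le_mono2) simp
            then show ?thesis using True inv'(12) by simp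
          qed
          moreover have "set (V @ W) \<subseteq> set hs"
            using inv'(11) by (auto simp: W_def violated_ineqs_def)
          ultimately show ?thesis
            using N5f R5f N5c unfolding round_inv_def prod.case PmQ[symmetric] hs[symmetric]
              thr_def[symmetric] bs_def[symmetric]
            by (auto simp: N6_def vp_def add_mult_distrib)
        qed
        ultimately show ?thesis
          using less by (intro runs_straight) (auto simp: Out_def simp del: set_append exec.simps)
      next
        case thr: False
        have "exec ?finish s = (N5, R5)"
          using thr False S2' N5c by (simp add: Pair exec_Pair_simps)
        moreover have "round_inv D b N R r B V (N5, R5)"
          using N5f R5f N5c V5 inv'(11,12) unfolding round_inv_def prod.case PmQ[symmetric]
            hs[symmetric] thr_def[symmetric] bs_def[symmetric]
          by (auto simp: vp_def)
        moreover have "bad_sample D hs V ys"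
          using thr unfolding bad_sample_def W_violated length_filter_conv_card F_def
          by (simp add: thr_def bs_def ys_len)
        ultimately show ?thesis
          by (intro runs_straight) (auto simp: Out_def simp del: exec.simps)
      qed
    qed
  qed
  let ?c = "steps (collect_violated_body D b)"
  have rest: "runs (Cond (NLess (Dir 0) (Dir 1)) (NConst (Dir (b + 14)) 1)
      (Seq (NCopy (Dir (b + 6)) (Dir (b + 16))) (Seq (collect_violated D b) ?finish)))
      s (Suc (1 + 1 + (8 + m * (?c + 2) + 1 + 6))) Out" if S1: "S1 s" for s
  proof (cases s)
    case (Pair N4 R4)
    have S1: "S1 (N4, R4)" using that Pair by simp
    have "N4 1 = 1" using frame[OF S1, of 1] pre' by simp
    show ?thesis
      unfolding Pair
    proof (rule runs_Cond)
      assume "holds (NLess (Dir 0) (Dir 1)) (N4, R4)"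
      then show "runs (NConst (Dir (b + 14)) 1) (N4, R4) (1 + 1 + (8 + m * (?c + 2) + 1 + 6)) Out"
        by (intro runs_weaken[OF infeasible[OF S1]]) (auto simp: exec_Pair_simps)
    next
      assume "\<not> holds (NLess (Dir 0) (Dir 1)) (N4, R4)"
      then have "feasible D F"
        using S1 \<open>N4 1 = 1\<close> by (auto simp: S1_def exec_Pair_simps split: if_splits)
      note rest = runs_Seq[OF collect[OF S1 this] finish[OF S1 this]]
      show "runs (Seq (NCopy (Dir (b + 6)) (Dir (b + 16))) (Seq (collect_violated D b) ?finish))
          (N4, R4) (1 + 1 + (8 + m * (?c + 2) + 1 + 6)) Out"
        by (rule runs_weaken[OF runs_Seq_straight[OF _ rest]]) auto
    qed
  qed
  have time: "6 + 1 + (C * (length V + r) ^ (2 * e) + 1 + Suc (1 + 1 + (8 + m * (?c + 2) + 1 + 6)))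
    \<le> (C * (4 * bs * bs + 1) ^ (2 * e) + ?c + 30) * m ^ e"
  proof -
    have "length V \<le> thr * bs" using inv'(12) by simp
    also have "\<dots> \<le> 4 * bs * bs * r" using r(1) by (simp add: thr_def algebra_simps)
    finally have "length V + r \<le> (4 * bs * bs + 1) * r" by (simp add: algebra_simps)
    then have "(length V + r) ^ (2 * e) \<le> ((4 * bs * bs + 1) * r) ^ (2 * e)"
      by (rule power_mono) simp
    also have "\<dots> = (4 * bs * bs + 1) ^ (2 * e) * (r * r) ^ e"
      by (simp only: power_mult_distrib power_mult power2_eq_square mult_ac)
    also have "\<dots> \<le> (4 * bs * bs + 1) ^ (2 * e) * m ^ e"
      using r(2) by (intro mult_le_mono2 power_mono) (auto simp: PmQ)
    finally have 1: "C * (length V + r) ^ (2 * e) \<le> C * (4 * bs * bs + 1) ^ (2 * e) * m ^ e"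
      by (simp add: mult.assoc)
    have 2: "m \<le> m ^ e" "1 \<le> m ^ e" using pre'(4) e self_le_power[of m e] by auto
    then have "(?c + 2) * m \<le> (?c + 2) * m ^ e" by (intro mult_le_mono2)
    then show ?thesis
      using 1 2 unfolding mult.commute[of m] add_mult_distrib by linarith
  qed
  show ?thesis
    unfolding solve_sample_def
    by (rule runs_weaken[OF runs_Seq_straight[OF _ runs_Seq[OF solve rest]]])
      (use time in \<open>auto simp: Out_def bs_def PmQ\<close>)
qed

lemma ex_nat_sqrt: "\<exists>r. r * r \<le> (m :: nat) \<and> m < Suc r * Suc r"
proof (induction m)
  case (Suc m)
  then obtain r where r: "r * r \<le> m" "m < Suc r * Suc r" by blast
  show ?case
  proof (cases "Suc m < Suc r * Suc r")
    case False
    then have "Suc m = Suc r * Suc r" using r by linarith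
    then show ?thesis by (intro exI[of _ "Suc r"]) simp
  qed (use r in \<open>auto intro!: exI[of _ r]\<close>)
qed (auto intro!: exI[of _ 0])

text \<open>With a sample of size about \<open>sqrt m\<close>, the arrays passed to the given solver have length
  \<open>O(sqrt m)\<close>, so that the exponent is halved. The expected number of rounds is bounded in terms of
  the size of a basis: the potential is proportional to the number of elements of the basis that
  have not been collected.\<close>

lemma solver_sampling_solver:
  assumes "solver D (b + 20) (2 * e) p" "1 \<le> e"
  shows "solver D b e (sampling_solver D b p)"
proof -
  obtain C where C: "\<And>N R. solver_pre D (b + 20) N \<Longrightarrow>
      runs p (N, R) (C * N (b + 24) ^ (2 * e)) (solver_post D (b + 20) N R)"
    using assms(1) unfolding solver_def by (auto simp: add.commute[of b])
  define bs where "bs = basis_size D"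
  define T where "T = steps (add_to_sample D b) + 4"
  define K where "K = C * (4 * basis_size D * basis_size D + 1) ^ (2 * e) +
    steps (collect_violated_body D b) + 30"
  let ?prepare = "block [NCopy (Dir (b + 8)) (Dir (b + 11)), NAdd (Dir (b + 8)) (Dir (b + 8)) (Dir 1),
      NConst (Dir (b + 13)) 0, add_multiple (2 * basis_size D) (b + 13) (b + 8),
      NConst (Dir (b + 14)) 0, NConst (Dir (b + 15)) 0, NCopy (Dir (b + 16)) (Dir (b + 5)),
      NSub (Dir (b + 17)) (Dir (b + 4)) (Dir 1)]"
  let ?init = "block [NConst (Dir (b + 8)) 0, NCopy (Dir (b + 6)) (Dir (b + 16))]"
  let ?rest = "Seq (sampling_loop D b) (solve_sample D b p)"
  let ?test = "NLess (Dir (b + 14)) (Dir 1)"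
  define c0 where "c0 = steps ?prepare"
  have "runs (sampling_solver D b p) (N, R)
      ((29 + c0 + (2 * bs + 2) * (T + K + 9)) * N (b + 4) ^ e) (solver_post D b N R)"
    if pre: "solver_pre D b N" for N R
  proof -
    define P m Q where PmQ: "P = N (b + 3)" "m = N (b + 4)" "Q = N (b + 5)"
    define hs where "hs = ineqs_at D R (N (b + 3)) (N (b + 4))"
    have pre': "N 1 = 1" "N 2 = Suc D" "8 + D \<le> P" "1 \<le> m" "P + m * Suc D \<le> Q"
      using pre by (auto simp: solver_pre_def PmQ)
    have hs: "hs = ineqs_at D R P m" "length hs = m" by (simp_all add: hs_def PmQ)
    obtain r where r: "r * r \<le> m" "m < Suc r * Suc r" using ex_nat_sqrt by blast
    have r1: "1 \<le> r" using r(2) pre'(4) by (cases r) auto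
    obtain B where B: "B \<subseteq> set hs" "card B \<le> bs" "feasible D B \<longrightarrow> feasible D (set hs)"
        "feasible D (set hs) \<longrightarrow> canonical D B = canonical D (set hs)"
      using ex_basis[of "set hs" "Suc D" D] set_ineqs[of D R P m] by (auto simp: hs(1) bs_def)
    define Post where "Post = solver_post D b N R"
    define V_of :: "state \<Rightarrow> real list list" where
      "V_of = (\<lambda>s. ineqs_at D (snd s) Q (fst s (b + 15)))"
    define inv where "inv = round_inv D b N R r B"
    have inv_V_of: "V = V_of s" "holds ?test s" if "inv V s" for V s
      using that pre' by (cases s; auto simp: inv_def round_inv_def V_of_def PmQ exec_Pair_simps)+
    have Post_test: "fst s 1 = 1" if "Post s" for s
      using that pre' by (cases s) (auto simp: Post_def solver_post_def)
    define tr where "tr = K * m ^ e"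
    define tc where "tc = r * T + tr + 9"
    \<comment> \<open>\<open>tc\<close> bounds the time of a round. The potential pays for two rounds for each element of the
      basis that has not been collected, since a round fails with probability at most one half,
      and for the round that finds the result.\<close>
    have loop: "ert f (While ?test (Seq ?init ?rest)) s
        \<le> of_nat ((2 * card (B - set (V_of s)) + 2) * tc) + (1 + B0)"
      if B0: "\<And>s. Post s \<Longrightarrow> f s \<le> B0" and inv_s: "inv (V_of s) s" for f B0 s
    proof -
      define I where "I = (\<lambda>s. if \<not> holds ?test s then if Post s then 1 + B0 else \<top>
        else if inv (V_of s) s then of_nat ((2 * card (B - set (V_of s)) + 2) * tc) + (1 + B0)
        else \<top>)"
      have "ert f (While ?test (Seq ?init ?rest)) s \<le> I s"
      proof (rule ert_While)
        show "1 + f s \<le> I s" if "\<not> holds ?test s" for s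
          using that B0[of s] by (auto simp: I_def add_left_mono)
        show "1 + ert (\<lambda>s'. 1 + I s') (Seq ?init ?rest) s \<le> I s" if holds: "holds ?test s" for s
        proof (cases "inv (V_of s) s")
          case True
          obtain N1 R1 where s: "s = (N1, R1)" by fastforce
          define V where "V = V_of s"
          define j where "j = card (B - set V)"
          have inv: "round_inv D b N R r B V (N1, R1)"
            using True by (simp add: V_def inv_def s)
          have N1: "N1 1 = 1" "N1 (b + 3) = P" "N1 (b + 4) = m" "N1 (b + 11) = r"
            "N1 (b + 16) = Q + length V * Suc D" "N1 (b + 17) = m - 1"
            and R1: "\<And>x. 8 + D \<le> x \<Longrightarrow> x < Q \<Longrightarrow> R1 x = R x" and V: "set V \<subseteq> set hs"
            using inv pre' by (auto simp: round_inv_def PmQ hs_def)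
          define N1' where "N1' = N1(b + 8 := 0, b + 6 := Q + length V * Suc D)"
          have init: "exec ?init s = (N1', R1)"
            using N1 by (simp add: s exec_Pair_simps N1'_def)
          have start: "sampled D b N1 R1 [] (N1', R1)"
            using N1 by (simp add: sampled_def N1'_def)
          let ?g = "\<lambda>s'. 1 + I s'"
          let ?bad = "bad_sample D hs V"
          \<comment> \<open>a bound for the cost from here on after a good sample\<close>
          define A where "A = of_nat (tr + 2 + 2 * j * tc) + (1 + B0)"
          have solve: "1 + ert ?g (solve_sample D b p) s' \<le> A + (if ?bad ys then 2 * of_nat tc else 0)"
            if ys: "ys \<in> draws (N1 (b + 4)) (N1 (b + 11))" "sampled D b N1 R1 ys s'" for ys s'
          proof -
            obtain N2 R2 where s': "s' = (N2, R2)" by fastforce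
            define G where "G = 1 + (of_nat (2 * j * tc) + (1 + B0) + (if ?bad ys then 2 * of_nat tc else 0))"
            have "ert ?g (solve_sample D b p) s' \<le> of_nat tr + G"
              unfolding s' tr_def K_def PmQ
            proof (rule runsD[OF runs_solve_sample[OF hs_def pre r1 _ B(1,3,4) C assms(2) inv _
                  ys(2)[unfolded s']]])
              show "r * r \<le> N (b + 4)" using r(1) by (simp add: PmQ)
              show "ys \<in> draws (N (b + 4)) r" using ys(1) N1 by (simp add: PmQ)
              fix s'' :: state
              obtain N3 R3 where s'': "s'' = (N3, R3)" by fastforce
              assume "case s'' of (N', R') \<Rightarrow>
                 N' (b + 14) = 1 \<and> solver_post D b N R (N', R') \<or>
                 (\<exists>V'. round_inv D b N R r B V' (N', R') \<and> card (B - set V') < card (B - set V)) \<or>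
                 round_inv D b N R r B V (N', R') \<and> bad_sample D hs V ys"
              then consider "N3 (b + 14) = 1" "Post s''"
                | V' where "inv V' s''" "card (B - set V') < j"
                | "inv V s''" "?bad ys"
                unfolding s'' by (auto simp: Post_def inv_def j_def)
              then have "I s'' \<le> of_nat (2 * j * tc) + (1 + B0) + (if ?bad ys then 2 * of_nat tc else 0)"
              proof cases
                case 1
                then have "I s'' = 1 + B0"
                  using Post_test[OF 1(2)] by (simp add: I_def s'' exec_Pair_simps)
                then show ?thesis by (simp add: add_increasing add_increasing2)
              next
                case (2 V')
                have "I s'' = of_nat ((2 * card (B - set V') + 2) * tc) + (1 + B0)"
                  using inv_V_of[OF 2(1)] 2(1) by (simp add: I_def)
                also have "\<dots> \<le> of_nat (2 * j * tc) + (1 + B0)"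
                  using 2(2) by (intro add_mono of_nat_mono mult_le_mono1) auto
                finally show ?thesis by (simp add: add_increasing2)
              next
                case 3
                have "I s'' = of_nat ((2 * j + 2) * tc) + (1 + B0)"
                  using inv_V_of[OF 3(1)] 3(1) by (simp add: I_def j_def)
                then show ?thesis using 3(2) by (simp add: algebra_simps)
              qed
              then show "?g s'' \<le> G" unfolding G_def by (rule add_left_mono)
            qed
            then have "1 + ert ?g (solve_sample D b p) s' \<le> 1 + (of_nat tr + G)"
              by (rule add_left_mono)
            also have "\<dots> = A + (if ?bad ys then 2 * of_nat tc else 0)"
              by (simp add: A_def G_def ac_simps)
            finally show ?thesis .
          qed
          have rare: "2 * card {ys \<in> draws m r. ?bad ys} \<le> m ^ r"
          proof -
            have "{ys \<in> draws m r. ?bad ys} = {ys \<in> draws (length hs) r. 2 * basis_size D * Suc r <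
                card {i. i < length hs \<and> hs ! i \<in> violated D (set V \<union> (!) hs ` set ys)}}"
              by (auto simp: bad_sample_def draws_def hs(2))
            moreover have "hs \<noteq> []" using hs(2) pre'(4) by auto
            moreover have set_hs: "set hs \<subseteq> {g. length g = Suc D}" using set_ineqs by (simp add: hs(1))
            moreover have "length hs \<le> Suc r * Suc r" using r(2) hs(2) by simp
            ultimately show ?thesis
              using many_violated_rare[OF finite_set subset_trans[OF V set_hs] set_hs, of D r]
              by (simp only: hs(2)) simp
          qed
          have "ert ?g (Seq ?init ?rest) s \<le> ert (\<lambda>s'. 1 + ert ?g ?rest s') ?init s"
            by (rule ert_Seq)
          also have "\<dots> \<le> of_nat (steps ?init) + (1 + ert ?g ?rest (exec ?init s))"
            by (rule runsD[OF runs_exec]) auto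
          also have "ert ?g ?rest (exec ?init s)
              \<le> ert (\<lambda>s'. 1 + ert ?g (solve_sample D b p) s') (sampling_loop D b) (N1', R1)"
            unfolding init by (rule ert_Seq)
          also have "\<dots> \<le> of_nat (N1 (b + 11) * (steps (add_to_sample D b) + 4) + 1) +
              mean (N1 (b + 4)) (N1 (b + 11)) (\<lambda>ys. A + (if ?bad ys then 2 * of_nat tc else 0))"
            using N1 pre' by (intro ert_sampling_loop[OF _ _ _ _ solve start]) auto
          also have "\<dots> = of_nat (r * T + 1) + mean m r (\<lambda>ys. A + (if ?bad ys then 2 * of_nat tc else 0))"
            by (simp add: N1 T_def)
          also have "mean m r (\<lambda>ys. A + (if ?bad ys then 2 * of_nat tc else 0)) \<le> A + of_nat tc"
            using rare pre'(4) by (intro mean_add_rare) auto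
          finally have "1 + ert ?g (Seq ?init ?rest) s
              \<le> 1 + (of_nat (steps ?init) + (1 + (of_nat (r * T + 1) + (A + of_nat tc))))"
            by (simp add: add_left_mono)
          also have "\<dots> = of_nat (1 + (4 + (1 + (r * T + 1 + (tr + 2 + 2 * j * tc + tc))))) + (1 + B0)"
            by (simp add: A_def ac_simps)
          also have "1 + (4 + (1 + (r * T + 1 + (tr + 2 + 2 * j * tc + tc)))) = (2 * j + 2) * tc"
            by (simp add: tc_def algebra_simps)
          also have "of_nat ((2 * j + 2) * tc) + (1 + B0) = I s"
            using holds True by (simp add: I_def j_def V_def)
          finally show ?thesis by simp
        qed (use holds in \<open>simp add: I_def\<close>)
      qed
      then show ?thesis using inv_V_of(2)[OF inv_s] inv_s by (simp add: I_def)
    qed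
    have main: "runs (While ?test (Seq ?init ?rest)) s ((2 * bs + 2) * tc + 1) Post"
      if "inv V s" for V s
      unfolding runs_def
    proof (intro allI impI)
      fix f :: "state \<Rightarrow> ennreal" and B0 assume "\<forall>s'. Post s' \<longrightarrow> f s' \<le> B0"
      note B0 = this
      have card: "card (B - set (V_of s)) \<le> bs"
        using B(1,2) card_mono[of B "B - set (V_of s)"] finite_subset[OF B(1)] by auto
      have "ert f (While ?test (Seq ?init ?rest)) s
          \<le> of_nat ((2 * card (B - set (V_of s)) + 2) * tc) + (1 + B0)"
        using B0 that inv_V_of(1)[OF that] by (intro loop) auto
      also have "of_nat ((2 * card (B - set (V_of s)) + 2) * tc) + (1 + B0)
          \<le> of_nat ((2 * bs + 2) * tc) + (1 + B0)"
        using card by (intro add_mono of_nat_mono mult_le_mono1) auto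
      finally show "ert f (While ?test (Seq ?init ?rest)) s \<le> of_nat ((2 * bs + 2) * tc + 1) + B0"
        by (simp add: ac_simps)
    qed
    define S where "S = (\<lambda>(N', R'). R' = R \<and> N' (b + 11) = r \<and>
      (\<forall>x. x \<notin> {b + 11, b + 12} \<longrightarrow> N' x = N x))"
    have sqrt: "runs (sqrt_loop b) (N, R) (6 + r * 10) S"
      using runs_sqrt_loop[of N r b R] pre' r unfolding S_def PmQ by auto
    have invariant: "inv [] (exec ?prepare s)" if S: "S s" for s
    proof (cases s)
      case (Pair N' R')
      have N': "R' = R" "N' (b + 11) = r" "\<And>x. x \<notin> {b + 11, b + 12} \<Longrightarrow> N' x = N x"
        using S by (auto simp: S_def Pair)
      have "exec ?prepare s = (N'(b + 8 := r + 1, b + 13 := 2 * basis_size D * (r + 1), b + 14 := 0,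
          b + 15 := 0, b + 16 := Q, b + 17 := m - 1), R)"
        using N' pre' by (simp add: Pair exec_Pair_simps exec_add_multiple PmQ)
      then show ?thesis
        using N' B by (auto simp: inv_def round_inv_def PmQ bs_def)
    qed
    have time: "19 + 10 * r + c0 + (2 * bs + 2) * tc \<le> (29 + c0 + (2 * bs + 2) * (T + K + 9)) * m ^ e"
    proof -
      define M where "M = m ^ e"
      have M: "1 \<le> M" "r \<le> M"
      proof -
        have "r \<le> r * r" using r1 by simp
        moreover have "m \<le> m ^ e" "1 \<le> m ^ e" using pre'(4) assms(2) self_le_power[of m e] by auto
        ultimately show "1 \<le> M" "r \<le> M" using r(1) unfolding M_def by linarith+
      qed
      have "r * T \<le> M * T" "9 \<le> 9 * M" using M by auto
      moreover have "(T + K + 9) * M = M * T + K * M + 9 * M"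
        by (simp add: algebra_simps)
      ultimately have "tc \<le> (T + K + 9) * M"
        unfolding tc_def tr_def M_def[symmetric] by linarith
      then have "(2 * bs + 2) * tc \<le> (2 * bs + 2) * ((T + K + 9) * M)" by (rule mult_le_mono2)
      moreover have "19 \<le> 19 * M" "c0 \<le> c0 * M" "10 * r \<le> 10 * M" using M by auto
      ultimately show ?thesis
        unfolding M_def[symmetric] add_mult_distrib[of _ _ M] mult.assoc[of _ _ M] by linarith
    qed
    show ?thesis
      unfolding sampling_solver_def PmQ[symmetric] Post_def[symmetric]
    proof (rule runs_weaken[OF runs_Seq[OF sqrt runs_Seq_straight[OF _ main[OF invariant]]]])
      show "straight ?prepare" by simp
      show "6 + r * 10 + 1 + (steps ?prepare + 1 + ((2 * bs + 2) * tc + 1))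
          \<le> (29 + c0 + (2 * bs + 2) * (T + K + 9)) * m ^ e"
        unfolding c0_def[symmetric] using time by linarith
    qed
  qed
  then show ?thesis unfolding solver_def by blast
qed

section \<open>Finitely many rotations suffice\<close>

text \<open>In the following, every orthogonal matrix is called a rotation, so reflections are included.\<close>

definition fits :: "(real ^ 'd::finite) set \<Rightarrow> (real ^ 'd) set \<Rightarrow> real ^ 'd ^ 'd \<Rightarrow> real \<Rightarrow> bool" where
  "fits K P A r \<longleftrightarrow> (\<exists>a. (\<lambda>x. a + r *\<^sub>R (A *v x)) ` K \<subseteq> P)"

lemma norm_matrix_vector_le: "norm (M *v x) \<le> norm M * norm (x :: real ^ 'n::finite)"
  for M :: "real ^ 'n ^ 'm::finite"
proof -
  have "norm (M *v x) \<le> L2_set (\<lambda>i. norm (M $ i) * norm x) UNIV"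
    unfolding norm_vec_def[of "M *v x"]
    by (intro L2_set_mono) (auto simp: matrix_vector_mul_component Cauchy_Schwarz_ineq2)
  also have "\<dots> = norm M * norm x"
    by (simp add: norm_vec_def[of M] L2_set_left_distrib)
  finally show ?thesis .
qed

lemma norm_orthogonal_matrix_vector:
  assumes "orthogonal_matrix (A :: real ^ 'n::finite ^ 'n)"
  shows "norm (A *v x) = norm x"
  using assms by (simp add: orthogonal_transformation_matrix orthogonal_transformation_norm)

lemma compact_orthogonal_matrices: "compact {A :: real ^ 'n::finite ^ 'n. orthogonal_matrix A}"
proof -
  have "norm A \<le> (\<Sum>i\<in>(UNIV :: 'n set). 1)" if "orthogonal_matrix A" for A :: "real ^ 'n ^ 'n"
  proof -
    have "norm (A $ i) = 1" for i
      using that by (simp add: orthogonal_matrix_orthonormal_rows row_def vec_nth_inverse)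
    then show ?thesis
      unfolding norm_vec_def[of A] using L2_set_le_sum[of UNIV "\<lambda>i. norm (A $ i)"] by simp
  qed
  then have "bounded {A :: real ^ 'n ^ 'n. orthogonal_matrix A}"
    unfolding bounded_iff by blast
  moreover have "{A :: real ^ 'n ^ 'n. orthogonal_matrix A} =
      {A. \<forall>i j. (\<Sum>k\<in>UNIV. A $ k $ i * A $ k $ j) = mat 1 $ i $ j}"
    by (simp add: orthogonal_matrix vec_eq_iff matrix_matrix_mult_def transpose_def)
  moreover have "closed {A :: real ^ 'n ^ 'n. \<forall>i j. (\<Sum>k\<in>UNIV. A $ k $ i * A $ k $ j) = mat 1 $ i $ j}"
    by (intro closed_Collect_all closed_Collect_eq continuous_intros)
  ultimately show ?thesis by (simp add: compact_eq_bounded_closed)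
qed

text \<open>The triples of a scaling factor, a translation vector and a rotation that put a copy of \<open>K\<close> into
  \<open>P\<close> form a compact set: two distinct points of \<open>K\<close> stay in the bounded set \<open>P\<close>, which bounds the
  scaling factor. So the maximum in the definition of \<open>alpha\<close> is attained.\<close>

lemma alpha_max:
  fixes K P :: "(real ^ 'd::finite) set"
  assumes K: "x \<in> K" "y \<in> K" "x \<noteq> y" and P: "compact P" "P \<noteq> {}"
  shows "\<exists>A. orthogonal_matrix A \<and> fits K P A (alpha K P)"
    "\<And>A r. orthogonal_matrix A \<Longrightarrow> fits K P A r \<Longrightarrow> r \<le> alpha K P"
proof -
  define T where "T = {(r, a, A). orthogonal_matrix A \<and> (\<forall>z\<in>K. a + r *\<^sub>R (A *v z) \<in> P)}"
  obtain M where M: "\<And>p. p \<in> P \<Longrightarrow> norm p \<le> M"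
    using compact_imp_bounded[OF P(1)] unfolding bounded_iff by blast
  have bound: "\<bar>r\<bar> \<le> 2 * M / norm (x - y) \<and> norm a \<le> M + 2 * M / norm (x - y) * norm x"
    if "(r, a, A) \<in> T" for r a A
  proof -
    have A: "orthogonal_matrix A" and in_P: "a + r *\<^sub>R (A *v x) \<in> P" "a + r *\<^sub>R (A *v y) \<in> P"
      using that K by (auto simp: T_def)
    have "\<bar>r\<bar> * norm (x - y) = norm (r *\<^sub>R (A *v (x - y)))"
      by (simp add: norm_orthogonal_matrix_vector[OF A])
    also have "r *\<^sub>R (A *v (x - y)) = (a + r *\<^sub>R (A *v x)) - (a + r *\<^sub>R (A *v y))"
      by (simp add: matrix_vector_mult_diff_distrib scaleR_right_diff_distrib)
    also have "norm \<dots> \<le> norm (a + r *\<^sub>R (A *v x)) + norm (a + r *\<^sub>R (A *v y))"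
      by (rule norm_triangle_ineq4)
    also have "\<dots> \<le> 2 * M" using M[OF in_P(1)] M[OF in_P(2)] by simp
    finally have r: "\<bar>r\<bar> \<le> 2 * M / norm (x - y)" using K(3) by (simp add: field_simps)
    have "norm a \<le> norm (a + r *\<^sub>R (A *v x)) + norm (r *\<^sub>R (A *v x))"
      using norm_triangle_ineq4[of "a + r *\<^sub>R (A *v x)" "r *\<^sub>R (A *v x)"] by simp
    also have "\<dots> \<le> M + 2 * M / norm (x - y) * norm x"
      using M[OF in_P(1)] mult_right_mono[OF r norm_ge_zero[of x]]
      by (simp add: norm_orthogonal_matrix_vector[OF A])
    finally show ?thesis using r by simp
  qed
  have "bounded T"
  proof (rule bounded_subset)
    show "T \<subseteq> cball 0 (2 * M / norm (x - y)) \<times> cball 0 (M + 2 * M / norm (x - y) * norm x) \<times>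
        {A. orthogonal_matrix A}"
      using bound by (auto simp: T_def)
    show "bounded (cball 0 (2 * M / norm (x - y)) \<times> cball 0 (M + 2 * M / norm (x - y) * norm x) \<times>
        {A :: real ^ 'd ^ 'd. orthogonal_matrix A})"
      by (intro bounded_Times bounded_cball compact_imp_bounded compact_orthogonal_matrices)
  qed
  moreover have "closed T"
  proof -
    have "T = (snd \<circ> snd) -` {A. orthogonal_matrix A} \<inter>
        (\<Inter>z\<in>K. (\<lambda>q. fst (snd q) + fst q *\<^sub>R (\<chi> i. \<Sum>j\<in>UNIV. snd (snd q) $ i $ j * z $ j)) -` P)"
      by (auto simp: T_def matrix_vector_mult_def)
    also have "closed \<dots>"
      using compact_imp_closed[OF P(1)] compact_imp_closed[OF compact_orthogonal_matrices]
      by (intro closed_Int closed_INT ballI closed_vimage continuous_intros continuous_on_vec_lambda) auto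
    finally show ?thesis .
  qed
  ultimately have "compact (fst ` T)"
    by (intro compact_continuous_image continuous_intros) (simp add: compact_eq_bounded_closed)
  moreover obtain p where "p \<in> P" using P(2) by blast
  then have "(0, p, mat 1) \<in> T" by (simp add: T_def orthogonal_matrix_id)
  then have "fst ` T \<noteq> {}" by blast
  ultimately obtain r where r: "r \<in> fst ` T" "\<And>r'. r' \<in> fst ` T \<Longrightarrow> r' \<le> r"
    by (meson compact_attains_sup)
  have iff: "r' \<in> fst ` T \<longleftrightarrow> (\<exists>a A. orthogonal_matrix A \<and> (\<lambda>x. a + r' *\<^sub>R (A *v x)) ` K \<subseteq> P)" for r'
    by (force simp: T_def)
  have "alpha K P = r"
    unfolding alpha_def by (rule Greatest_equality) (use r in \<open>auto simp only: iff\<close>)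
  then show "\<exists>A. orthogonal_matrix A \<and> fits K P A (alpha K P)"
    "\<And>A r. orthogonal_matrix A \<Longrightarrow> fits K P A r \<Longrightarrow> r \<le> alpha K P"
    using r unfolding fits_def iff by blast+
qed

text \<open>If \<open>B\<close> is close to the rotation \<open>A\<close>, then \<open>B K\<close>, shrunk slightly about the center of a ball
  contained in \<open>K\<close>, is contained in \<open>A K\<close>: a point of the shrunk copy is a convex combination of
  a point of \<open>K\<close> and a point of the ball.\<close>

lemma fits_nearby_rotation:
  fixes K P :: "(real ^ 'd::finite) set"
  assumes K: "convex K" "cball z \<rho> \<subseteq> K" "\<And>x. x \<in> K \<Longrightarrow> norm (x - z) \<le> D" and "0 < \<epsilon>"
    and A: "orthogonal_matrix A" and AB: "norm (B - A) * D \<le> \<epsilon> * \<rho>" and fit: "fits K P A r"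
  shows "fits K P B (r / (1 + \<epsilon>))"
proof -
  obtain a where a: "\<And>x. x \<in> K \<Longrightarrow> a + r *\<^sub>R (A *v x) \<in> P"
    using fit by (auto simp: fits_def)
  define s where "s = 1 / (1 + \<epsilon>)"
  have s: "0 < s" "s * (1 + \<epsilon>) = 1" using \<open>0 < \<epsilon>\<close> by (auto simp: s_def)
  define a' where "a' = a + r *\<^sub>R (A *v z) - (r * s) *\<^sub>R (B *v z)"
  have "a' + (r / (1 + \<epsilon>)) *\<^sub>R (B *v x) \<in> P" if x: "x \<in> K" for x
  proof -
    define e where "e = transpose A *v ((B - A) *v (x - z))"
    have Ae: "A *v e = (B - A) *v (x - z)"
    proof -
      have "A *v e = (A ** transpose A) *v ((B - A) *v (x - z))"
        by (simp add: e_def matrix_vector_mul_assoc matrix_mul_assoc)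
      then show ?thesis using A by (simp add: orthogonal_matrix_def)
    qed
    have "norm e = norm ((B - A) *v (x - z))"
      unfolding e_def using A by (intro norm_orthogonal_matrix_vector) simp
    also have "\<dots> \<le> norm (B - A) * norm (x - z)" by (rule norm_matrix_vector_le)
    also have "\<dots> \<le> norm (B - A) * D" using K(3)[OF x] by (intro mult_left_mono) auto
    also have "\<dots> \<le> \<epsilon> * \<rho>" by (rule AB)
    finally have "norm ((1 / \<epsilon>) *\<^sub>R e) \<le> \<rho>" using \<open>0 < \<epsilon>\<close> by (simp add: field_simps)
    then have "z + (1 / \<epsilon>) *\<^sub>R e \<in> K" using K(2) by (auto simp: dist_norm subset_iff)
    then have "s *\<^sub>R x + (s * \<epsilon>) *\<^sub>R (z + (1 / \<epsilon>) *\<^sub>R e) \<in> K"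
      using K(1) x s \<open>0 < \<epsilon>\<close> by (intro convexD) (auto simp: distrib_left)
    then have "a + r *\<^sub>R (A *v (s *\<^sub>R x + (s * \<epsilon>) *\<^sub>R (z + (1 / \<epsilon>) *\<^sub>R e))) \<in> P" by (rule a)
    also have "s *\<^sub>R x + (s * \<epsilon>) *\<^sub>R (z + (1 / \<epsilon>) *\<^sub>R e) = z + s *\<^sub>R ((x - z) + e)"
    proof -
      have "(s * \<epsilon>) *\<^sub>R z = z - s *\<^sub>R z"
        using s(2) by (metis add_diff_cancel_left' distrib_left mult.right_neutral scaleR_left_diff_distrib scaleR_one)
      then show ?thesis using \<open>0 < \<epsilon>\<close> by (simp add: scaleR_right_distrib scaleR_right_diff_distrib)
    qed
    also have "A *v (z + s *\<^sub>R ((x - z) + e)) = A *v z + s *\<^sub>R (A *v (x - z) + A *v e)"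
      by (simp add: matrix_vector_right_distrib matrix_vector_mult_scaleR)
    also have "A *v (x - z) + A *v e = B *v (x - z)"
      unfolding Ae by (simp add: matrix_vector_mult_diff_rdistrib)
    also have "a + r *\<^sub>R (A *v z + s *\<^sub>R (B *v (x - z))) = a' + (r / (1 + \<epsilon>)) *\<^sub>R (B *v x)"
      by (simp add: a'_def s_def matrix_vector_mult_diff_distrib scaleR_right_diff_distrib scaleR_right_distrib)
    finally show ?thesis .
  qed
  then show ?thesis unfolding fits_def by blast
qed

text \<open>The set is a \<open>\<delta>\<close>-net of the compact group of all rotations; it does not depend on \<open>P\<close>.\<close>

lemma finite_rotations:
  fixes K :: "(real ^ 'd::finite) set"
  assumes K: "convex K" "bounded K" "interior K \<noteq> {}" and "\<epsilon> > 0"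
  shows "\<exists>As. (\<forall>A\<in>set As. orthogonal_matrix A) \<and>
    (\<forall>P A r. orthogonal_matrix A \<longrightarrow> fits K P A r \<longrightarrow> (\<exists>B\<in>set As. fits K P B (r / (1 + \<epsilon>))))"
proof -
  obtain z \<rho> where z: "\<rho> > 0" "cball z \<rho> \<subseteq> K"
    using K(3) by (auto simp: mem_interior_cball)
  obtain D0 where D0: "\<And>x. x \<in> K \<Longrightarrow> norm x \<le> D0"
    using K(2) unfolding bounded_iff by blast
  define D where "D = \<bar>D0\<bar> + norm z + 1"
  have D: "norm (x - z) \<le> D" if "x \<in> K" for x
    using D0[OF that] norm_triangle_ineq4[of x z] by (simp add: D_def)
  have "D > 0" by (simp add: D_def add_nonneg_pos)
  define \<delta> where "\<delta> = \<epsilon> * \<rho> / D"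
  have "\<delta> > 0" using z(1) \<open>\<epsilon> > 0\<close> \<open>D > 0\<close> by (simp add: \<delta>_def)
  let ?O = "{A :: real ^ 'd ^ 'd. orthogonal_matrix A}"
  obtain S where S: "finite S" "S \<subseteq> ?O" "?O \<subseteq> (\<Union>A\<in>S. ball A \<delta>)"
    using seq_compact_imp_totally_bounded[of ?O] compact_orthogonal_matrices \<open>\<delta> > 0\<close>
    unfolding compact_eq_seq_compact_metric by blast
  obtain As where As: "set As = S" using finite_list[OF S(1)] by blast
  have "\<exists>B\<in>S. fits K P B (r / (1 + \<epsilon>))" if "orthogonal_matrix A" "fits K P A r" for P A r
  proof -
    have "A \<in> (\<Union>A\<in>S. ball A \<delta>)" using S(3) that(1) by blast
    then obtain B where B: "B \<in> S" "dist B A < \<delta>" by auto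
    have "norm (B - A) * D \<le> \<delta> * D"
      using B(2) \<open>D > 0\<close> by (intro mult_right_mono) (auto simp: dist_norm)
    also have "\<delta> * D = \<epsilon> * \<rho>" using \<open>D > 0\<close> by (simp add: \<delta>_def)
    finally show ?thesis
      using fits_nearby_rotation[OF K(1) z(2) D \<open>0 < \<epsilon>\<close> that(1) _ that(2)] B(1) by blast
  qed
  then show ?thesis using As S(2) by (intro exI[of _ As]) blast
qed

section \<open>The linear program for a fixed rotation\<close>

text \<open>The half-space \<open>h\<close> and the vertex \<open>v\<close> give the inequality \<open>c \<bullet> (a + u) \<le> b * s\<close>, where
  \<open>h = (c, b)\<close> and \<open>u = A *v v\<close>. The variable \<open>x 0\<close> is \<open>s\<close>, and \<open>x 1, x 2, \<dots>\<close> are the coordinates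
  of \<open>a\<close>. A solution with \<open>s > 0\<close> is a copy of \<open>A K\<close> scaled by \<open>1 / s\<close> in \<open>P\<close>; passing to the
  reciprocal turns maximization into minimization of \<open>\<bar>s\<bar>\<close>, which is bounded even if only some of the
  inequalities are considered.\<close>

definition copy_ineq :: "real ^ 'd::finite \<Rightarrow> (real ^ 'd) \<times> real \<Rightarrow> real list" where
  "copy_ineq u h = - (fst h \<bullet> u) # - snd h #
     map (\<lambda>j. fst h $ from_nat_into UNIV j) [0..<CARD('d)]"

definition copy_ineqs :: "((real ^ 'd::finite) \<times> real) list \<Rightarrow> (real ^ 'd) list \<Rightarrow> real list list" where
  "copy_ineqs hs us = concat (map (\<lambda>u. map (copy_ineq u) hs) us)"

definition translation :: "(nat \<Rightarrow> real) \<Rightarrow> real ^ 'd::finite" where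
  "translation x = (\<chi> i. x (Suc (to_nat_on UNIV i)))"

lemma bij_betw_coordinates: "bij_betw (from_nat_into (UNIV :: 'd::finite set)) {..<CARD('d)} UNIV"
  by (rule bij_betw_from_nat_into_finite) auto

lemma sum_coordinates: "(\<Sum>j<CARD('d). f (from_nat_into (UNIV :: 'd::finite set) j)) = sum f UNIV"
  by (rule sum.reindex_bij_betw[OF bij_betw_coordinates])

lemma length_copy_ineq [simp]: "length (copy_ineq u h) = Suc (Suc CARD('d))"
  for u :: "real ^ 'd::finite"
  by (simp add: copy_ineq_def)

lemma slack_copy_ineq:
  fixes u :: "real ^ 'd::finite"
  shows "slack (Suc CARD('d)) (copy_ineq u h) x = snd h * x 0 - fst h \<bullet> (translation x + u)"
proof -
  let ?g = "copy_ineq u h" and ?idx = "from_nat_into (UNIV :: 'd set)"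
  have "(\<Sum>j<Suc CARD('d). ?g ! Suc j * x j)
      = - snd h * x 0 + (\<Sum>j<CARD('d). fst h $ ?idx j * x (Suc j))"
    by (subst sum.lessThan_Suc_shift) (simp add: copy_ineq_def)
  also have "(\<Sum>j<CARD('d). fst h $ ?idx j * x (Suc j))
      = (\<Sum>j<CARD('d). fst h $ ?idx j * translation x $ ?idx j)"
    using bij_betw_imp_surj_on[OF to_nat_on_finite[of "UNIV :: 'd set"]]
    by (intro sum.cong refl) (simp add: translation_def)
  also have "\<dots> = fst h \<bullet> translation x"
    using sum_coordinates[of "\<lambda>i. fst h $ i * translation x $ i"] by (simp add: inner_vec_def)
  finally show ?thesis
    by (simp add: slack_def copy_ineq_def inner_right_distrib)
qed

lemma solves_copy_ineqs_iff:
  fixes hs :: "((real ^ 'd::finite) \<times> real) list"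
  shows "solves (Suc CARD('d)) x (set (copy_ineqs hs us)) \<longleftrightarrow>
    (\<forall>u\<in>set us. \<forall>h\<in>set hs. fst h \<bullet> (translation x + u) \<le> snd h * x 0)"
  by (auto simp: solves_def copy_ineqs_def slack_copy_ineq)

lemma fits_0: "P \<noteq> {} \<Longrightarrow> fits K P A 0"
  by (auto simp: fits_def)

text \<open>The inequalities do not say that \<open>s\<close> is positive. But if \<open>s \<le> 0\<close>, then all points of some
  translate of \<open>A K\<close> would be recession directions of \<open>P\<close>; since \<open>P\<close> is bounded, they would all be
  0, although \<open>K\<close> has more than one point.\<close>

lemma solution_fits:
  fixes hs :: "((real ^ 'd::finite) \<times> real) list"
  assumes K: "K = convex hull set vs" "k1 \<in> K" "k2 \<in> K" "k1 \<noteq> k2"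
    and P: "P = halfspaces_Int hs" "bounded P" "P \<noteq> {}" and A: "orthogonal_matrix A"
    and x: "solves (Suc CARD('d)) x (set (copy_ineqs hs (map ((*v) A) vs)))"
  shows "0 < x 0" "fits K P A (1 / x 0)"
proof -
  have ineq: "c \<bullet> (translation x + A *v k) \<le> b * x 0" if "(c, b) \<in> set hs" "k \<in> K" for c b k
  proof -
    let ?C = "(\<lambda>k. A *v k) -` {y. c \<bullet> y \<le> b * x 0 - c \<bullet> translation x}"
    have "convex ?C"
      by (intro convex_linear_vimage matrix_vector_mul_linear convex_halfspace_le)
    moreover have "set vs \<subseteq> ?C"
      using x that(1) by (force simp: solves_copy_ineqs_iff inner_right_distrib)
    ultimately have "K \<subseteq> ?C" unfolding K(1) by (rule hull_minimal[rotated])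
    then show ?thesis using that(2) by (auto simp: inner_right_distrib)
  qed
  have in_P: "p \<in> P \<longleftrightarrow> (\<forall>(c, b)\<in>set hs. c \<bullet> p \<le> b)" for p
    by (auto simp: P(1) halfspaces_Int_def)
  obtain z where z: "z \<in> P" using P(3) by blast
  obtain M where M: "\<And>p. p \<in> P \<Longrightarrow> norm p \<le> M" using P(2) unfolding bounded_iff by blast
  show pos: "0 < x 0"
  proof (rule ccontr)
    assume "\<not> 0 < x 0"
    then have s: "x 0 \<le> 0" by simp
    have "translation x + A *v k - x 0 *\<^sub>R z = 0" (is "?w = 0") if k: "k \<in> K" for k
    proof (rule ccontr)
      assume "?w \<noteq> 0"
      define t where "t = (M + norm z + 1) / norm ?w"
      have "M \<ge> 0" using M[OF z] norm_ge_zero[of z] by linarith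
      then have "t \<ge> 0" by (simp add: t_def)
      have "z + t *\<^sub>R ?w \<in> P"
        unfolding in_P
      proof (safe)
        fix c b assume cb: "(c, b) \<in> set hs"
        have "c \<bullet> z \<le> b" using z cb by (auto simp: in_P)
        then have "x 0 * b \<le> x 0 * (c \<bullet> z)" using s by (rule mult_left_mono_neg)
        then have "c \<bullet> ?w \<le> 0"
          using ineq[OF cb k] by (simp add: inner_diff_right mult.commute)
        then have "t * (c \<bullet> ?w) \<le> 0" using \<open>t \<ge> 0\<close> by (rule mult_nonneg_nonpos[rotated])
        then show "c \<bullet> (z + t *\<^sub>R ?w) \<le> b"
          using \<open>c \<bullet> z \<le> b\<close> by (simp add: inner_right_distrib)
      qed
      then have "norm (z + t *\<^sub>R ?w) \<le> M" by (rule M)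
      moreover have "norm (t *\<^sub>R ?w) \<le> norm (z + t *\<^sub>R ?w) + norm z"
        using norm_triangle_ineq4[of "z + t *\<^sub>R ?w" z] by simp
      moreover have "norm (t *\<^sub>R ?w) = M + norm z + 1"
        using \<open>?w \<noteq> 0\<close> \<open>M \<ge> 0\<close> by (simp add: t_def)
      ultimately show False by simp
    qed
    from this[OF K(2)] this[OF K(3)] have "A *v k1 = A *v k2"
      by (metis add_diff_cancel_left' eq_iff_diff_eq_0)
    then have "norm (k1 - k2) = 0"
      using norm_orthogonal_matrix_vector[OF A, of "k1 - k2"]
      by (simp add: matrix_vector_mult_diff_distrib)
    then show False using K(4) by simp
  qed
  have "(1 / x 0) *\<^sub>R translation x + (1 / x 0) *\<^sub>R (A *v k) \<in> P" if k: "k \<in> K" for k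
    unfolding in_P
  proof (safe)
    fix c b assume "(c, b) \<in> set hs"
    from ineq[OF this k] pos show "c \<bullet> ((1 / x 0) *\<^sub>R translation x + (1 / x 0) *\<^sub>R (A *v k)) \<le> b"
      by (simp add: inner_right_distrib field_simps)
  qed
  then show "fits K P A (1 / x 0)" unfolding fits_def by blast
qed

lemma fits_solution:
  fixes hs :: "((real ^ 'd::finite) \<times> real) list"
  assumes "set vs \<subseteq> K" "P = halfspaces_Int hs" "0 < r" "fits K P A r"
  shows "\<exists>x. solves (Suc CARD('d)) x (set (copy_ineqs hs (map ((*v) A) vs))) \<and> x 0 = 1 / r"
proof -
  obtain a where a: "\<And>k. k \<in> K \<Longrightarrow> a + r *\<^sub>R (A *v k) \<in> P"
    using assms(4) by (auto simp: fits_def)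
  define x where "x = (\<lambda>j. case j of 0 \<Rightarrow> 1 / r | Suc j \<Rightarrow> (a $ from_nat_into UNIV j) / r)"
  have x: "translation x = (1 / r) *\<^sub>R a"
    by (simp add: translation_def x_def vec_eq_iff)
  have "fst h \<bullet> (translation x + A *v v) \<le> snd h * x 0" if "v \<in> set vs" "h \<in> set hs" for v h
  proof -
    have "fst h \<bullet> (a + r *\<^sub>R (A *v v)) \<le> snd h"
      using a[of v] assms(1,2) that by (cases h) (auto simp: halfspaces_Int_def)
    then have "(fst h \<bullet> (a + r *\<^sub>R (A *v v))) / r \<le> snd h / r"
      using \<open>0 < r\<close> by (intro divide_right_mono) auto
    then show ?thesis
      using \<open>0 < r\<close> unfolding x by (simp add: inner_right_distrib x_def add_divide_distrib)
  qed
  moreover have "x 0 = 1 / r" by (simp add: x_def)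
  ultimately show ?thesis
    by (intro exI[of _ x]) (auto simp: solves_copy_ineqs_iff)
qed

text \<open>The list \<open>us\<close> consists of the images of the vertices of \<open>K\<close> under a rotation. The linear program
  is infeasible if and only if no copy with a positive scaling factor fits.\<close>

definition rotation_value :: "((real ^ 'd::finite) \<times> real) list \<Rightarrow> (real ^ 'd) list \<Rightarrow> real" where
  "rotation_value hs us = (let G = set (copy_ineqs hs us) in
     if feasible (Suc CARD('d)) G then 1 / canonical (Suc CARD('d)) G 0 else 0)"

lemma rotation_value:
  fixes hs :: "((real ^ 'd::finite) \<times> real) list"
  assumes K: "K = convex hull set vs" "k1 \<in> K" "k2 \<in> K" "k1 \<noteq> k2"
    and P: "P = halfspaces_Int hs" "bounded P" "P \<noteq> {}" and A: "orthogonal_matrix A"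
  shows "fits K P A (rotation_value hs (map ((*v) A) vs))"
    "fits K P A r \<Longrightarrow> r \<le> rotation_value hs (map ((*v) A) vs)"
proof -
  let ?D = "Suc CARD('d)"
  define G where "G = set (copy_ineqs hs (map ((*v) A) vs))"
  have G: "finite G" "G \<subseteq> {g. length g = Suc ?D}"
    by (auto simp: G_def copy_ineqs_def)
  note sol = solution_fits[OF K P A, folded G_def]
  have val: "rotation_value hs (map ((*v) A) vs) = (if feasible ?D G then 1 / canonical ?D G 0 else 0)"
    by (simp add: rotation_value_def G_def Let_def)
  have can: "solves ?D (canonical ?D G) G" if "feasible ?D G"
    using that G by (intro canonical_solves[where n = "Suc ?D"]) auto
  show "fits K P A (rotation_value hs (map ((*v) A) vs))"
    using sol(2)[OF can] fits_0[OF P(3)] by (simp add: val)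
  show "r \<le> rotation_value hs (map ((*v) A) vs)" if fit: "fits K P A r"
  proof (cases "0 < r")
    case False
    then show ?thesis using sol(1)[OF can] by (auto simp: val intro: order_trans[of r 0])
  next
    case True
    obtain x where x: "solves ?D x G" "x 0 = 1 / r"
      using fits_solution[OF _ P(1) True fit, of vs] hull_subset[of "set vs" convex] K(1)
      by (auto simp: G_def)
    then have feas: "feasible ?D G" by (auto simp: feasible_def)
    have "\<bar>canonical ?D G 0\<bar> \<le> \<bar>x 0\<bar>"
      using canonical_minimal[OF G _ x(1)] by simp
    then have "canonical ?D G 0 \<le> 1 / r" using x(2) True by simp
    then have "r \<le> 1 / canonical ?D G 0"
      using True sol(1)[OF can[OF feas]] by (simp add: field_simps)
    then show ?thesis using feas by (simp add: val)
  qed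
qed

definition best_value :: "((real ^ 'd::finite) \<times> real) list \<Rightarrow> (real ^ 'd) list list \<Rightarrow> real" where
  "best_value hs uss = fold (\<lambda>us \<beta>. max \<beta> (rotation_value hs us)) uss 0"

lemma fold_max_bounds:
  fixes f :: "'a \<Rightarrow> real"
  shows "b \<le> fold (\<lambda>x \<beta>. max \<beta> (f x)) xs b"
    "x \<in> set xs \<Longrightarrow> f x \<le> fold (\<lambda>x \<beta>. max \<beta> (f x)) xs b"
    "b \<le> c \<Longrightarrow> (\<And>x. x \<in> set xs \<Longrightarrow> f x \<le> c) \<Longrightarrow> fold (\<lambda>x \<beta>. max \<beta> (f x)) xs b \<le> c"
proof (induction xs arbitrary: b)
  case (Cons y xs)
  { case 1 show ?case using Cons.IH(1)[of "max b (f y)"] by simp }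
  { case 2 then show ?case using Cons.IH(1)[of "max b (f y)"] Cons.IH(2)[of "max b (f y)"] by auto }
  { case 3 then show ?case using Cons.IH(3)[of "max b (f y)"] by simp }
qed auto

text \<open>The computed value is between \<open>alpha K P / (1 + \<epsilon>)\<close> and \<open>alpha K P\<close>.\<close>

lemma best_value_approximates:
  fixes hs :: "((real ^ 'd::finite) \<times> real) list"
  assumes K: "K = convex hull set vs" "k1 \<in> K" "k2 \<in> K" "k1 \<noteq> k2"
    and P: "P = halfspaces_Int hs" "compact P" "P \<noteq> {}" and "\<epsilon> > 0"
    and As: "\<And>A. A \<in> set As \<Longrightarrow> orthogonal_matrix A"
      "\<And>A r. orthogonal_matrix A \<Longrightarrow> fits K P A r \<Longrightarrow> \<exists>B\<in>set As. fits K P B (r / (1 + \<epsilon>))"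
  shows "\<bar>best_value hs (map (\<lambda>A. map ((*v) A) vs) As) - alpha K P\<bar> \<le> \<epsilon> * alpha K P"
proof -
  note val = rotation_value[OF K P(1) compact_imp_bounded[OF P(2)] P(3)]
  note max = alpha_max[OF K(2-4) P(2,3)]
  let ?\<beta> = "best_value hs (map (\<lambda>A. map ((*v) A) vs) As)" and ?\<alpha> = "alpha K P"
  have "?\<alpha> \<ge> 0" using max(2)[OF orthogonal_matrix_id fits_0[OF P(3)]] .
  have "?\<beta> \<le> ?\<alpha>"
    unfolding best_value_def using \<open>?\<alpha> \<ge> 0\<close> max(2) val(1) As(1)
    by (intro fold_max_bounds(3)) auto
  moreover have "?\<alpha> / (1 + \<epsilon>) \<le> ?\<beta>"
  proof -
    obtain B where B: "B \<in> set As" "fits K P B (?\<alpha> / (1 + \<epsilon>))" using max(1) As(2) by blast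
    then have "?\<alpha> / (1 + \<epsilon>) \<le> rotation_value hs (map ((*v) B) vs)" using val(2) As(1) by blast
    also have "\<dots> \<le> ?\<beta>"
      unfolding best_value_def using B(1) by (intro fold_max_bounds(2)) auto
    finally show ?thesis .
  qed
  then have "?\<alpha> \<le> ?\<beta> + \<epsilon> * ?\<beta>" using \<open>\<epsilon> > 0\<close> by (simp add: field_simps)
  ultimately show ?thesis
    using mult_left_mono[of ?\<beta> ?\<alpha> \<epsilon>] mult_nonneg_nonneg[of \<epsilon> ?\<alpha>] \<open>\<epsilon> > 0\<close> \<open>?\<alpha> \<ge> 0\<close>
    by linarith
qed

section \<open>The algorithm\<close>

text \<open>After \<open>k\<close> levels of sampling, the exponent is \<open>2 ^ (D - k)\<close>.\<close>

lemma ex_linear_solver: "\<exists>p. solver D b 1 p"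
proof -
  have "\<exists>p. solver D b (2 ^ (D - k)) p" if "k \<le> D" for k b
    using that
  proof (induction k arbitrary: b)
    case 0
    then show ?case using solver_elimination_solver[of D b] by auto
  next
    case (Suc k)
    then obtain p where "solver D (b + 20) (2 ^ (D - k)) p" by fastforce
    moreover have "(2 :: nat) ^ (D - k) = 2 * 2 ^ (D - Suc k)"
      using Suc.prems by (metis Suc_diff_le diff_Suc_Suc power_Suc)
    ultimately show ?case using solver_sampling_solver[of D b "2 ^ (D - Suc k)" p] by auto
  qed
  from this[of D b] show ?thesis by simp
qed

text \<open>The coefficients are stored with stride \<open>CARD('d) + 1\<close>, as in the input.\<close>

definition half_spaces_at :: "((real ^ 'd::finite) \<times> real) list \<Rightarrow> (nat \<Rightarrow> real) \<Rightarrow> nat \<Rightarrow> bool" where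
  "half_spaces_at hs R a \<longleftrightarrow> (\<forall>i<length hs.
    (\<forall>j<CARD('d). R (a + i * Suc CARD('d) + j) = fst (hs ! i) $ from_nat_into UNIV j) \<and>
    R (a + i * Suc CARD('d) + CARD('d)) = snd (hs ! i))"

text \<open>Cell 7 contains the address of the current half-space, cell 9 a pointer into it, and cell 6 the
  address of the inequality to be written. The coordinates of \<open>u\<close> are constants of the program,
  since \<open>K\<close> and the rotations are fixed.\<close>

definition emit_ineq :: "real ^ 'd::finite \<Rightarrow> prog" where
  "emit_ineq u = block (
    [NCopy (Dir 9) (Dir 7), RConst (Dir 0) 0] @
    concat (map (\<lambda>j. [RConst (Dir 1) (u $ from_nat_into UNIV j), RMul (Dir 1) (Ind 9) (Dir 1),
      RSub (Dir 0) (Dir 0) (Dir 1), NAdd (Dir 9) (Dir 9) (Dir 1)]) [0..<CARD('d)]) @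
    [RCopy (Ind 6) (Dir 0), NAdd (Dir 6) (Dir 6) (Dir 1),
     RConst (Dir 1) 0, RSub (Ind 6) (Dir 1) (Ind 9), NAdd (Dir 6) (Dir 6) (Dir 1),
     copy_cells CARD('d) 7 6, NAdd (Dir 7) (Dir 7) (Dir 1), NAdd (Dir 8) (Dir 8) (Dir 1)])"

lemma straight_emit_ineq [simp]: "straight (emit_ineq u)"
  by (auto simp: emit_ineq_def)

lemma exec_inner_product:
  assumes "N 1 = 1" "8 \<le> N 9"
  shows "\<exists>r1. exec (block (concat (map (\<lambda>j. [RConst (Dir 1) (u j), RMul (Dir 1) (Ind 9) (Dir 1),
      RSub (Dir 0) (Dir 0) (Dir 1), NAdd (Dir 9) (Dir 9) (Dir 1)]) [0..<k]))) (N, R) =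
    (N(9 := N 9 + k), R(0 := R 0 - (\<Sum>j<k. R (N 9 + j) * u j), 1 := r1))"
proof (induction k)
  case 0
  show ?case by (auto intro!: exI[of _ "R 1"])
next
  case (Suc k)
  let ?p = "\<lambda>j. [RConst (Dir 1) (u j), RMul (Dir 1) (Ind 9) (Dir 1),
      RSub (Dir 0) (Dir 0) (Dir 1), NAdd (Dir 9) (Dir 9) (Dir 1)]"
  obtain r1 where IH: "exec (block (concat (map ?p [0..<k]))) (N, R) =
    (N(9 := N 9 + k), R(0 := R 0 - (\<Sum>j<k. R (N 9 + j) * u j), 1 := r1))"
    using Suc by blast
  have "exec (block (concat (map ?p [0..<Suc k]))) (N, R)
      = exec (block (?p k)) (exec (block (concat (map ?p [0..<k]))) (N, R))"
    by simp
  also have "\<dots> = (N(9 := N 9 + Suc k),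
      R(0 := R 0 - (\<Sum>j<Suc k. R (N 9 + j) * u j), 1 := R (N 9 + k) * u k))"
    unfolding IH using assms by (auto simp: exec_Pair_simps fun_eq_iff)
  finally show ?case by blast
qed

lemma exec_emit_ineq:
  fixes u :: "real ^ 'd::finite"
  assumes "N 1 = 1" "8 \<le> N 7" "N 7 + Suc CARD('d) \<le> N 6"
    and h: "\<And>j. j < CARD('d) \<Longrightarrow> R (N 7 + j) = fst h $ from_nat_into UNIV j"
      "R (N 7 + CARD('d)) = snd h"
    and exec: "exec (emit_ineq u) (N, R) = (N', R')"
  shows "x \<notin> {6, 7, 8, 9} \<Longrightarrow> N' x = N x" "N' 6 = N 6 + Suc (Suc CARD('d))"
    "N' 7 = N 7 + Suc CARD('d)" "N' 8 = Suc (N 8)"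
    "2 \<le> y \<Longrightarrow> y < N 6 \<Longrightarrow> R' y = R y"
    "ineq_at (Suc CARD('d)) R' (N 6) = copy_ineq u h"
proof -
  define d a q where "d = CARD('d)" and "a = N 7" and "q = N 6"
  let ?ip = "block (concat (map (\<lambda>j. [RConst (Dir 1) (u $ from_nat_into UNIV j),
      RMul (Dir 1) (Ind 9) (Dir 1), RSub (Dir 0) (Dir 0) (Dir 1), NAdd (Dir 9) (Dir 9) (Dir 1)])
      [0..<CARD('d)]))"
  define ip where "ip = (\<Sum>j<d. R (a + j) * u $ from_nat_into UNIV j)"
  have ip: "ip = fst h \<bullet> u"
    using sum_coordinates[of "\<lambda>i. fst h $ i * u $ i"] h(1)
    by (simp add: ip_def d_def a_def inner_vec_def)
  define N1 where "N1 = N(9 := a + d)"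
  obtain r1 where "exec ?ip (N(9 := a), R(0 := 0)) =
      (N(9 := a, 9 := a + d), R(0 := 0, 0 := 0 - (\<Sum>j<d. (R(0 := 0)) (a + j) * u $ from_nat_into UNIV j), 1 := r1))"
    using exec_inner_product[of "N(9 := a)" "\<lambda>j. u $ from_nat_into UNIV j" "CARD('d)" "R(0 := 0)"]
      assms(1,2) by (auto simp: a_def d_def)
  then have step1: "exec ?ip (N(9 := a), R(0 := 0)) = (N1, R(0 := - ip, 1 := r1))"
    using assms(2) by (simp add: ip_def N1_def a_def)
  define N2 where "N2 = N1(6 := q + 2)"
  define R2 where "R2 = R(0 := - ip, 1 := 0, q := - ip, q + 1 := - snd h)"
  have ad: "a + d < q" "8 \<le> a" using assms(2,3) by (auto simp: a_def d_def q_def)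
  have step2: "exec (block [RCopy (Ind 6) (Dir 0), NAdd (Dir 6) (Dir 6) (Dir 1),
     RConst (Dir 1) 0, RSub (Ind 6) (Dir 1) (Ind 9), NAdd (Dir 6) (Dir 6) (Dir 1)])
     (N1, R(0 := - ip, 1 := r1)) = (N2, R2)"
    using assms(1) ad h(2)
    by (auto simp: exec_Pair_simps N1_def N2_def R2_def q_def[symmetric] a_def[symmetric]
        d_def[symmetric] fun_eq_iff)
  define N3 where "N3 = N2(7 := a + d, 6 := q + 2 + d)"
  define R3 where "R3 = (\<lambda>x. if q + 2 \<le> x \<and> x < q + 2 + d then R2 (a + (x - (q + 2))) else R2 x)"
  have N2: "N2 1 = 1" "N2 6 = q + 2" "N2 7 = a"
    using assms(1) by (simp_all add: N2_def N1_def a_def)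
  have step3: "exec (copy_cells CARD('d) 7 6) (N2, R2) = (N3, R3)"
    using exec_copy_cells[of N2 7 6 d R2, unfolded N2] ad unfolding N3_def R3_def d_def by simp
  have "exec (emit_ineq u) (N, R) = exec (block [NAdd (Dir 7) (Dir 7) (Dir 1), NAdd (Dir 8) (Dir 8) (Dir 1)])
     (exec (copy_cells CARD('d) 7 6) (exec (block [RCopy (Ind 6) (Dir 0), NAdd (Dir 6) (Dir 6) (Dir 1),
     RConst (Dir 1) 0, RSub (Ind 6) (Dir 1) (Ind 9), NAdd (Dir 6) (Dir 6) (Dir 1)])
     (exec ?ip (N(9 := a), R(0 := 0)))))"
    by (simp add: emit_ineq_def exec_Pair_simps a_def)
  also have "\<dots> = (N3(7 := Suc (a + d), 8 := Suc (N 8)), R3)"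
    unfolding step1 step2 step3 using assms(1) by (simp add: exec_Pair_simps N3_def N2_def N1_def)
  finally have NR': "N' = N3(7 := Suc (a + d), 8 := Suc (N 8))" "R' = R3" using exec by auto
  show "x \<notin> {6, 7, 8, 9} \<Longrightarrow> N' x = N x" "N' 6 = N 6 + Suc (Suc CARD('d))"
    "N' 7 = N 7 + Suc CARD('d)" "N' 8 = Suc (N 8)"
    "2 \<le> y \<Longrightarrow> y < N 6 \<Longrightarrow> R' y = R y"
    by (simp_all add: NR' N3_def N2_def N1_def R3_def R2_def a_def d_def q_def)
  show "ineq_at (Suc CARD('d)) R' (N 6) = copy_ineq u h"
  proof (rule nth_equalityI)
    fix j assume "j < length (ineq_at (Suc CARD('d)) R' (N 6))"
    then have "j \<le> Suc d" by (simp add: d_def)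
    then consider "j = 0" | "j = 1" | i where "j = Suc (Suc i)" "i < d"
      by (cases j; cases "j - 1") auto
    then show "ineq_at (Suc CARD('d)) R' (N 6) ! j = copy_ineq u h ! j"
    proof cases
      case (3 i)
      then have "R3 (q + j) = R (a + i)" using ad by (simp add: R3_def R2_def)
      then show ?thesis using 3 h(1)[of i]
        by (simp add: NR' copy_ineq_def q_def a_def d_def)
    qed (use ad in \<open>simp_all add: NR' copy_ineq_def q_def[symmetric] R3_def R2_def ip\<close>)
  qed simp
qed

definition emit_ineqs :: "real ^ 'd::finite \<Rightarrow> prog" where
  "emit_ineqs u = Seq (block [NConst (Dir 8) 0, NCopy (Dir 7) (Dir 4)])
    (While (NLess (Dir 8) (Dir 3)) (emit_ineq u))"

text \<open>Cell 3 contains the number of half-spaces and cell 4 their address. The inequalities for the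
  current rotation start at the address in cell 5, right after the half-spaces.\<close>

definition layout :: "((real ^ 'd::finite) \<times> real) list \<Rightarrow> (nat \<Rightarrow> nat) \<Rightarrow> (nat \<Rightarrow> real) \<Rightarrow> bool" where
  "layout hs N R \<longleftrightarrow> N 1 = 1 \<and> N 2 = Suc (Suc CARD('d)) \<and> N 3 = length hs \<and>
    N 4 = 8 + Suc CARD('d) \<and> N 5 = N 4 + length hs * Suc CARD('d) \<and> half_spaces_at hs R (N 4)"

lemma half_spaces_at_cong:
  fixes hs :: "((real ^ 'd::finite) \<times> real) list"
  assumes "half_spaces_at hs R a" "\<And>x. a \<le> x \<Longrightarrow> x < a + length hs * Suc CARD('d) \<Longrightarrow> R' x = R x"
  shows "half_spaces_at hs R' a"
proof -
  have "R' (a + i * Suc CARD('d) + j) = R (a + i * Suc CARD('d) + j)"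
    if "i < length hs" "j \<le> CARD('d)" for i j
    using ineq_in_ineqs_bound[OF that(1), of "CARD('d)"] that(2) by (intro assms(2)) auto
  then show ?thesis using assms(1) by (simp add: half_spaces_at_def)
qed

lemma layout_cong:
  assumes lay: "layout hs N R" and N': "\<And>x. 0 < x \<Longrightarrow> x < 6 \<Longrightarrow> N' x = N x"
    and R': "\<And>x. N 4 \<le> x \<Longrightarrow> x < N 5 \<Longrightarrow> R' x = R x"
  shows "layout hs N' R'"
proof -
  have "half_spaces_at hs R' (N 4)"
    by (rule half_spaces_at_cong[of hs R]) (use lay R' in \<open>auto simp: layout_def\<close>)
  moreover have "N' 1 = N 1" "N' 2 = N 2" "N' 3 = N 3" "N' 4 = N 4" "N' 5 = N 5"
    using N' by simp_all
  ultimately show ?thesis using lay unfolding layout_def by metis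
qed

lemma runs_emit_ineqs:
  fixes hs :: "((real ^ 'd::finite) \<times> real) list" and N :: "nat \<Rightarrow> nat" and R :: "nat \<Rightarrow> real"
  assumes lay: "layout hs N R" and q: "N 6 = N 5 + k * Suc (Suc CARD('d))"
  shows "runs (emit_ineqs u) (N, R) (6 + length hs * (steps (emit_ineq u) + 2))
    (\<lambda>(N', R'). (\<forall>x<6. N' x = N x) \<and> R' 7 = R 7 \<and> (\<forall>x. N 4 \<le> x \<and> x < N 5 \<longrightarrow> R' x = R x) \<and>
      N' 6 = N 5 + (k + length hs) * Suc (Suc CARD('d)) \<and>
      ineqs_at (Suc CARD('d)) R' (N 5) (k + length hs) =
        ineqs_at (Suc CARD('d)) R (N 5) k @ map (copy_ineq u) hs)"
proof -
  define D where "D = Suc CARD('d)"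
  define G where "G = ineqs_at D R (N 5) k"
  have N: "N 1 = 1" "N 3 = length hs" "N 4 = 8 + D" "N 5 = 8 + D + length hs * D"
    and hs: "half_spaces_at hs R (8 + D)"
    using lay by (auto simp: layout_def D_def)
  define Inv where "Inv = (\<lambda>i (N', R'). (\<forall>x<6. N' x = N x) \<and> R' 7 = R 7 \<and>
      (\<forall>x. N 4 \<le> x \<and> x < N 5 \<longrightarrow> R' x = R x) \<and>
      N' 6 = N 5 + (k + i) * Suc D \<and> N' 7 = N 4 + i * D \<and> N' 8 = i \<and>
      ineqs_at D R' (N 5) (k + i) = G @ map (copy_ineq u) (take i hs))"
  have step: "Inv (Suc i) (exec (emit_ineq u) (N1, R1))"
    if i: "i < length hs" and inv: "Inv i (N1, R1)" for i N1 R1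
  proof -
    have N1: "\<And>x. x < 6 \<Longrightarrow> N1 x = N x" "N1 6 = N 5 + (k + i) * Suc D" "N1 7 = N 4 + i * D" "N1 8 = i"
      and R1: "R1 7 = R 7" "\<And>x. N 4 \<le> x \<Longrightarrow> x < N 5 \<Longrightarrow> R1 x = R x"
      and arr: "ineqs_at D R1 (N 5) (k + i) = G @ map (copy_ineq u) (take i hs)"
      using inv by (auto simp: Inv_def)
    obtain N2 R2 where NR2: "exec (emit_ineq u) (N1, R1) = (N2, R2)" by fastforce
    have bound: "i * D + D \<le> length hs * D"
      using ineq_in_ineqs_bound[OF i, of "CARD('d)"] by (simp add: D_def)
    have "half_spaces_at hs R1 (8 + D)"
      using R1(2) by (intro half_spaces_at_cong[OF hs]) (auto simp: N D_def)
    then have h: "\<And>j. j < CARD('d) \<Longrightarrow> R1 (N1 7 + j) = fst (hs ! i) $ from_nat_into UNIV j"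
        "R1 (N1 7 + CARD('d)) = snd (hs ! i)"
      using i unfolding half_spaces_at_def N1(3) N(3) D_def[symmetric] by auto
    have pre: "N1 1 = 1" "8 \<le> N1 7" "N1 7 + Suc CARD('d) \<le> N1 6"
      using N1(1)[of 1] N N1(2,3) bound by (auto simp: D_def)
    note res = exec_emit_ineq[OF pre h NR2]
    have "ineqs_at D R2 (N 5) (k + i) = ineqs_at D R1 (N 5) (k + i)"
      using res(5) N1(2) by (intro ineqs_at_cong) (auto simp: N D_def)
    moreover have "ineq_at D R2 (N 5 + (k + i) * Suc D) = copy_ineq u (hs ! i)"
      using res(6) N1(2) by (simp add: D_def)
    ultimately have "ineqs_at D R2 (N 5) (k + Suc i) = G @ map (copy_ineq u) (take (Suc i) hs)"
      unfolding add_Suc_right ineqs_at_Suc using arr i by (simp add: take_Suc_conv_app_nth)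
    moreover have "R2 x = R x" if "x = 7 \<or> N 4 \<le> x \<and> x < N 5" for x
      using that res(5)[of x] R1 N1(2) N by auto
    ultimately show ?thesis
      using res(1-4) N1 by (auto simp: NR2 Inv_def D_def)
  qed
  have loop: "runs (While (NLess (Dir 8) (Dir 3)) (emit_ineq u))
      (exec (block [NConst (Dir 8) 0, NCopy (Dir 7) (Dir 4)]) (N, R))
      (length hs * (steps (emit_ineq u) + 2) + 1) (Inv (length hs))"
  proof (rule runs_While)
    show "holds (NLess (Dir 8) (Dir 3)) s \<and>
        runs (emit_ineq u) s (steps (emit_ineq u)) (Inv (Suc i))"
      if "i < length hs" "Inv i s" for i s
      using that step[of i "fst s" "snd s"] N
      by (cases s) (auto simp: Inv_def exec_Pair_simps intro!: runs_straight)
  qed (use q N in \<open>auto simp: Inv_def exec_Pair_simps G_def D_def\<close>)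
  show ?thesis
    unfolding emit_ineqs_def D_def[symmetric]
    by (rule runs_weaken[OF runs_Seq_straight[OF _ loop]]) (auto simp: Inv_def G_def)
qed

primrec emit_all :: "(real ^ 'd::finite) list \<Rightarrow> prog" where
  "emit_all [] = Skip"
| "emit_all (u # us) = Seq (emit_ineqs u) (emit_all us)"

lemma runs_emit_all:
  fixes hs :: "((real ^ 'd::finite) \<times> real) list"
  assumes "layout hs N R" "N 6 = N 5 + k * Suc (Suc CARD('d))"
  shows "runs (emit_all us) (N, R)
    (\<Sum>u\<leftarrow>us. 7 + length hs * (steps (emit_ineq u) + 2))
    (\<lambda>(N', R'). (\<forall>x<6. N' x = N x) \<and> R' 7 = R 7 \<and> (\<forall>x. N 4 \<le> x \<and> x < N 5 \<longrightarrow> R' x = R x) \<and>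
      N' 6 = N 5 + (k + length us * length hs) * Suc (Suc CARD('d)) \<and>
      ineqs_at (Suc CARD('d)) R' (N 5) (k + length us * length hs) =
        ineqs_at (Suc CARD('d)) R (N 5) k @ copy_ineqs hs us)"
  using assms
proof (induction us arbitrary: N R k)
  case Nil
  then show ?case by (auto intro!: runs_Skip simp: copy_ineqs_def)
next
  case (Cons u us)
  let ?D = "Suc CARD('d)"
  define S where "S = (\<lambda>(N', R'). (\<forall>x<6. N' x = N x) \<and> R' 7 = R 7 \<and>
      (\<forall>x. N 4 \<le> x \<and> x < N 5 \<longrightarrow> R' x = R x) \<and> N' 6 = N 5 + (k + length hs) * Suc ?D \<and>
      ineqs_at ?D R' (N 5) (k + length hs) = ineqs_at ?D R (N 5) k @ map (copy_ineq u) hs)"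
  have one: "runs (emit_ineqs u) (N, R) (6 + length hs * (steps (emit_ineq u) + 2)) S"
    unfolding S_def by (rule runs_emit_ineqs[OF Cons.prems])
  have two: "runs (emit_all us) s (\<Sum>u\<leftarrow>us. 7 + length hs * (steps (emit_ineq u) + 2))
    (\<lambda>(N', R'). (\<forall>x<6. N' x = N x) \<and> R' 7 = R 7 \<and> (\<forall>x. N 4 \<le> x \<and> x < N 5 \<longrightarrow> R' x = R x) \<and>
      N' 6 = N 5 + (k + length (u # us) * length hs) * Suc ?D \<and>
      ineqs_at ?D R' (N 5) (k + length (u # us) * length hs) =
        ineqs_at ?D R (N 5) k @ copy_ineqs hs (u # us))" if S: "S s" for s
  proof (cases s)
    case (Pair N1 R1)
    have N1: "N1 5 = N 5" "N1 4 = N 4" "N1 6 = N1 5 + (k + length hs) * Suc ?D"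
      using S by (auto simp: S_def Pair)
    have "layout hs N1 R1"
      by (rule layout_cong[OF Cons.prems(1)]) (use S in \<open>auto simp: S_def Pair\<close>)
    note IH = Cons.IH[OF this N1(3), unfolded N1(1,2)]
    have "k + length hs + length us * length hs = k + length (u # us) * length hs" by simp
    with IH S show ?thesis
      unfolding Pair by (elim runs_weaken) (auto simp: S_def copy_ineqs_def add.assoc)
  qed
  show ?case by (rule runs_weaken[OF _ _ ]) (use runs_Seq[OF one two] in \<open>auto\<close>)
qed

text \<open>The solver is used with \<open>b = 10\<close>, so that the cells 1 to 12 are preserved; its parameters are in the
  cells 13 to 15. Cell 0 is its flag, and real cell 8 contains the value of \<open>x 0\<close>. The best value so
  far is kept in real cell 7.\<close>

definition rotation_step :: "prog \<Rightarrow> (real ^ 'd::finite) list \<Rightarrow> prog" where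
  "rotation_step p us = Seq (NCopy (Dir 6) (Dir 5)) (Seq (emit_all us)
    (Seq (block [NConst (Dir 14) 0, add_multiple (length us) 14 3, NCopy (Dir 13) (Dir 5),
      NCopy (Dir 15) (Dir 6)])
    (Seq p (Cond (NLess (Dir 0) (Dir 1)) Skip
      (block [RConst (Dir 0) 1, RDiv (Dir 0) (Dir 0) (Dir 8),
        Cond (RLess (Dir 7) (Dir 0)) (RCopy (Dir 7) (Dir 0)) Skip])))))"

lemma runs_rotation_step:
  fixes us :: "(real ^ 'd::finite) list"
  assumes "solver (Suc CARD('d)) 10 1 p" "us \<noteq> []"
  shows "\<exists>c. \<forall>hs N R. layout hs N R \<longrightarrow> hs \<noteq> [] \<longrightarrow> 0 \<le> R 7 \<longrightarrow>
    runs (rotation_step p us) (N, R) (c * length hs)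
    (\<lambda>(N', R'). layout hs N' R' \<and> R' 7 = max (R 7) (rotation_value hs us))"
proof -
  let ?D = "Suc CARD('d)"
  obtain C where p: "\<And>N R. solver_pre ?D 10 N \<Longrightarrow> runs p (N, R) (C * N 14) (solver_post ?D 10 N R)"
    using assms(1) by (auto simp: solver_def)
  let ?set = "block [NConst (Dir 14) 0, add_multiple (length us) 14 3, NCopy (Dir 13) (Dir 5),
      NCopy (Dir 15) (Dir 6)]"
  define c where "c = (\<Sum>u\<leftarrow>us. 9 + steps (emit_ineq u)) + C * length us + steps ?set + 20"
  have "runs (rotation_step p us) (N, R) (c * length hs)
    (\<lambda>(N', R'). layout hs N' R' \<and> R' 7 = max (R 7) (rotation_value hs us))"
    if lay: "layout hs N R" and "hs \<noteq> []" and R7: "0 \<le> R 7" for hs N R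
  proof -
    define n m where "n = length hs" and "m = length us * n"
    have pos: "1 \<le> n" "1 \<le> m"
      using \<open>hs \<noteq> []\<close> assms(2) by (auto simp: n_def m_def Suc_le_eq)
    define G where "G = set (copy_ineqs hs us)"
    have N: "N 1 = 1" "N 2 = Suc ?D" "N 3 = n" "8 + ?D \<le> N 4" "N 4 \<le> N 5"
      using lay by (auto simp: layout_def n_def)
    define N0 where "N0 = N(6 := N 5)"
    have ex0: "exec (NCopy (Dir 6) (Dir 5)) (N, R) = (N0, R)"
      by (simp add: exec_Pair_simps N0_def)
    have N0: "N0 x = N x" if "x < 6" for x using that by (simp add: N0_def)
    have lay0: "layout hs N0 R" by (rule layout_cong[OF lay]) (auto simp: N0)
    have "N0 6 = N0 5 + 0 * Suc ?D" by (simp add: N0_def)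
    note emit = runs_emit_all[OF lay0 this, of us]
    define S where "S = (\<lambda>(N1, R1). (\<forall>x<6. N1 x = N x) \<and> R1 7 = R 7 \<and>
      (\<forall>x. N 4 \<le> x \<and> x < N 5 \<longrightarrow> R1 x = R x) \<and> N1 6 = N 5 + m * Suc ?D \<and>
      set (ineqs_at ?D R1 (N 5) m) = G)"
    have one: "runs (emit_all us) (exec (NCopy (Dir 6) (Dir 5)) (N, R))
        (\<Sum>u\<leftarrow>us. 7 + n * (steps (emit_ineq u) + 2)) S"
      unfolding ex0
      by (rule runs_weaken[OF emit]) (auto simp: S_def N0 n_def m_def G_def)
    define S' where "S' = (\<lambda>(N2, R2). (\<forall>x. 0 < x \<and> x < 6 \<longrightarrow> N2 x = N x) \<and> R2 7 = R 7 \<and>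
      (\<forall>x. N 4 \<le> x \<and> x < N 5 \<longrightarrow> R2 x = R x) \<and>
      (if feasible ?D G then N2 0 = 1 \<and> R2 8 = canonical ?D G 0 else N2 0 = 0))"
    have two: "runs p (exec ?set s) (C * m) S'" if S: "S s" for s
    proof (cases s)
      case (Pair N1 R1)
      define N2 where "N2 = N1(14 := m, 13 := N 5, 15 := N 5 + m * Suc ?D)"
      have ex: "exec ?set s = (N2, R1)"
        using S N by (simp add: Pair S_def exec_Pair_simps exec_add_multiple N2_def m_def)
      have N2: "N2 x = N x" if "x < 6" for x using that S by (simp add: N2_def S_def Pair)
      have cells: "N2 (10 + 3) = N 5" "N2 (10 + 4) = m" "N2 (10 + 5) = N 5 + m * Suc ?D"
        by (simp_all add: N2_def)
      have "solver_pre ?D 10 N2"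
        unfolding solver_pre_def cells using N2[of 1] N2[of 2] N pos by auto
      from p[OF this, of R1] have run: "runs p (N2, R1) (C * m) (solver_post ?D 10 N2 R1)"
        by (simp add: N2_def)
      have R1: "R1 7 = R 7" "\<And>x. N 4 \<le> x \<Longrightarrow> x < N 5 \<Longrightarrow> R1 x = R x"
          "set (ineqs_at ?D R1 (N 5) m) = G"
        using S by (auto simp: S_def Pair)
      have "S' (N3, R3)" if post: "solver_post ?D 10 N2 R1 (N3, R3)" for N3 R3
      proof -
        have "(\<forall>x. 0 < x \<and> x < 10 + 6 \<longrightarrow> N3 x = N2 x) \<and>
          (\<forall>x. x = 7 \<or> 8 + ?D \<le> x \<and> x < N 5 + m * Suc ?D \<longrightarrow> R3 x = R1 x) \<and>
          (if feasible ?D G then N3 0 = 1 \<and> (\<forall>j<?D. solution R3 j = canonical ?D G j) else N3 0 = 0)"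
          using post unfolding solver_post_def prod.case cells R1(3) Let_def .
        moreover from this have "R3 8 = canonical ?D G 0" if "feasible ?D G"
          using that unfolding solution_def by (metis add.right_neutral zero_less_Suc)
        ultimately show ?thesis
          using N2 R1(1,2) N by (simp add: S'_def del: canonical.simps)
      qed
      then show ?thesis
        unfolding ex by (intro runs_weaken[OF run]) auto
    qed
    have three: "runs (Cond (NLess (Dir 0) (Dir 1)) Skip
      (block [RConst (Dir 0) 1, RDiv (Dir 0) (Dir 0) (Dir 8),
        Cond (RLess (Dir 7) (Dir 0)) (RCopy (Dir 7) (Dir 0)) Skip])) s 9
      (\<lambda>(N', R'). layout hs N' R' \<and> R' 7 = max (R 7) (rotation_value hs us))" if S': "S' s" for s
    proof (cases s)
      case (Pair N2 R2)
      have N2: "N2 1 = 1" using S' N by (simp add: S'_def Pair)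
      have lay2: "layout hs N2 R2" by (rule layout_cong[OF lay]) (use S' in \<open>auto simp: S'_def Pair\<close>)
      have lay3: "layout hs N2 R3" if "\<And>x. 8 \<le> x \<Longrightarrow> R3 x = R2 x" for R3
      proof (rule layout_cong[OF lay2])
        fix x assume "N2 4 \<le> x"
        then show "R3 x = R2 x" using lay2 by (intro that) (simp add: layout_def)
      qed simp
      have val: "rotation_value hs us = (if feasible ?D G then 1 / canonical ?D G 0 else 0)"
        unfolding rotation_value_def G_def Let_def ..
      show ?thesis
      proof (cases "feasible ?D G")
        case True
        then have R2: "N2 0 = 1" "R2 7 = R 7" "R2 8 = canonical ?D G 0"
          using S' by (auto simp: S'_def Pair simp del: canonical.simps)
        define v where "v = rotation_value hs us"
        have v: "1 / R2 8 = v" using True by (simp add: v_def val R2(3) del: canonical.simps)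
        define R3 where "R3 = (if R2 7 < v then R2(0 := v, 7 := v) else R2(0 := v))"
        have "exec (Cond (NLess (Dir 0) (Dir 1)) Skip (block [RConst (Dir 0) 1,
            RDiv (Dir 0) (Dir 0) (Dir 8), Cond (RLess (Dir 7) (Dir 0)) (RCopy (Dir 7) (Dir 0)) Skip])) s
          = (N2, R3)"
          using R2(1) N2 by (simp add: Pair exec_Pair_simps R3_def v)
        moreover have "layout hs N2 R3" by (rule lay3) (simp add: R3_def)
        moreover have "R3 7 = max (R 7) v" using R2(2) by (simp add: R3_def)
        ultimately show ?thesis by (intro runs_straight) (simp_all add: v_def)
      next
        case False
        then have "N2 0 = 0" "R2 7 = R 7" "rotation_value hs us = 0"
          using S' val by (auto simp: S'_def Pair)
        then show ?thesis
          using lay2 N2 R7 by (intro runs_straight) (simp_all add: Pair exec_Pair_simps)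
      qed
    qed
    have "(\<Sum>u\<leftarrow>us. 7 + n * (steps (emit_ineq u) + 2)) \<le> (\<Sum>u\<leftarrow>us. 9 + steps (emit_ineq u)) * n"
      using pos(1) by (induction us) (simp_all add: algebra_simps add_mono)
    then have "1 + 1 + ((\<Sum>u\<leftarrow>us. 7 + n * (steps (emit_ineq u) + 2)) + 1 +
        (steps ?set + 1 + (C * m + 1 + 9))) \<le> c * n"
    proof -
      have "steps ?set \<le> steps ?set * n" "20 \<le> 20 * n"
        using mult_le_mono2[OF pos(1)] by (metis mult_1_right)+
      moreover have "C * m = C * length us * n" by (simp add: m_def)
      ultimately show ?thesis
        using \<open>_ \<le> (\<Sum>u\<leftarrow>us. 9 + steps (emit_ineq u)) * n\<close>
        unfolding c_def add_mult_distrib by linarith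
    qed
    then show ?thesis
      unfolding rotation_step_def n_def[symmetric]
      by (intro runs_weaken[OF runs_Seq_straight[OF _ runs_Seq[OF one
            runs_Seq_straight[OF _ runs_Seq[OF two three]]]]]) simp_all
  qed
  then show ?thesis by blast
qed

primrec all_rotations :: "prog \<Rightarrow> (real ^ 'd::finite) list list \<Rightarrow> prog" where
  "all_rotations p [] = Skip"
| "all_rotations p (us # uss) = Seq (rotation_step p us) (all_rotations p uss)"

lemma runs_all_rotations:
  fixes uss :: "(real ^ 'd::finite) list list"
  assumes "solver (Suc CARD('d)) 10 1 p" "\<forall>us\<in>set uss. us \<noteq> []"
  shows "\<exists>c. \<forall>hs N R. layout hs N R \<longrightarrow> hs \<noteq> [] \<longrightarrow> 0 \<le> R 7 \<longrightarrow>
    runs (all_rotations p uss) (N, R) (c * length hs)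
      (\<lambda>(N', R'). R' 7 = fold (\<lambda>us \<beta>. max \<beta> (rotation_value hs us)) uss (R 7))"
  using assms(2)
proof (induction uss)
  case Nil
  show ?case by (auto intro!: runs_Skip)
next
  case (Cons us uss)
  obtain c1 where c1: "\<And>hs N R. layout hs N R \<Longrightarrow> hs \<noteq> [] \<Longrightarrow> 0 \<le> R 7 \<Longrightarrow>
    runs (rotation_step p us) (N, R) (c1 * length hs)
    (\<lambda>(N', R'). layout hs N' R' \<and> R' 7 = max (R 7) (rotation_value hs us))"
    using runs_rotation_step[OF assms(1), of us] Cons.prems by auto
  obtain c2 where c2: "\<And>hs N R. layout hs N R \<Longrightarrow> hs \<noteq> [] \<Longrightarrow> 0 \<le> R 7 \<Longrightarrow>
    runs (all_rotations p uss) (N, R) (c2 * length hs)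
      (\<lambda>(N', R'). R' 7 = fold (\<lambda>us \<beta>. max \<beta> (rotation_value hs us)) uss (R 7))"
    using Cons by auto
  have "runs (all_rotations p (us # uss)) (N, R) ((c1 + c2 + 1) * length hs)
      (\<lambda>(N', R'). R' 7 = fold (\<lambda>us \<beta>. max \<beta> (rotation_value hs us)) (us # uss) (R 7))"
    if "layout hs N R" "hs \<noteq> []" "0 \<le> R 7" for hs N R
  proof -
    let ?Q = "\<lambda>(N', R'). R' 7 = fold (\<lambda>us \<beta>. max \<beta> (rotation_value hs us)) (us # uss) (R 7)"
    have rest: "runs (all_rotations p uss) s (c2 * length hs) ?Q"
      if "case s of (N', R') \<Rightarrow> layout hs N' R' \<and> R' 7 = max (R 7) (rotation_value hs us)" for s
      using that c2[of hs "fst s" "snd s"] \<open>hs \<noteq> []\<close> \<open>0 \<le> R 7\<close> by (cases s) auto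
    have "1 \<le> length hs" using that(2) by (simp add: Suc_le_eq)
    then show ?thesis
      unfolding all_rotations.simps
      by (intro runs_weaken[OF runs_Seq[OF c1[OF that] rest]]) (auto simp: algebra_simps)
  qed
  then show ?case by blast
qed

text \<open>The input is moved, from its end to its beginning since the old and the new place overlap, in
  order to make the real cells with small numbers available for variables.\<close>

definition load_input :: "nat \<Rightarrow> prog" where
  "load_input D = Seq (block [NConst (Dir 1) 1, NConst (Dir 2) (Suc D), NCopy (Dir 3) (Dir 0),
      NConst (Dir 4) (8 + D), NConst (Dir 8) 0, add_multiple D 8 3, NAdd (Dir 5) (Dir 4) (Dir 8),
      NConst (Dir 10) 0])
    (While (NLess (Dir 10) (Dir 8)) (block [NSub (Dir 8) (Dir 8) (Dir 1),
      NAdd (Dir 9) (Dir 8) (Dir 4), RCopy (Ind 9) (Ind 8)]))"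

lemma runs_load_input:
  fixes hs :: "((real ^ 'd::finite) \<times> real) list"
  shows "runs (load_input (Suc CARD('d))) (input hs)
    (steps (add_multiple (Suc CARD('d)) 8 3) + 20 + length hs * (8 * Suc CARD('d)))
    (\<lambda>(N, R). layout hs N R)"
proof -
  define D n M where "D = Suc CARD('d)" and "n = length hs" and "M = n * D"
  obtain N0 R0 where input: "input hs = (N0, R0)" by fastforce
  have N0: "N0 0 = n" and R0: "R0 = (\<lambda>k. let i = k div D; j = k mod D in
      if i < n then if j < CARD('d) then fst (hs ! i) $ from_nat_into UNIV j else snd (hs ! i) else 0)"
    using input by (auto simp: input_def n_def D_def)
  have entry: "R0 (i * D + j) = (if j < CARD('d) then fst (hs ! i) $ from_nat_into UNIV j else snd (hs ! i))"
    if "i < n" "j \<le> CARD('d)" for i j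
  proof -
    have "j < D" using that(2) by (simp add: D_def)
    then have "(i * D + j) div D = i" "(i * D + j) mod D = j" by simp_all
    then show ?thesis using that by (simp add: R0)
  qed
  define Inv :: "nat \<Rightarrow> state \<Rightarrow> bool" where "Inv = (\<lambda>k (N, R). N 1 = 1 \<and> N 2 = Suc D \<and> N 3 = n \<and> N 4 = 8 + D \<and>
    N 5 = 8 + D + M \<and> N 8 = M - k \<and> N 10 = (0 :: nat) \<and>
    (\<forall>x < 8 + D + (M - k). R x = R0 x) \<and> (\<forall>i. M - k \<le> i \<and> i < M \<longrightarrow> R (8 + D + i) = R0 i))"
  let ?body = "block [NSub (Dir 8) (Dir 8) (Dir 1), NAdd (Dir 9) (Dir 8) (Dir 4), RCopy (Ind 9) (Ind 8)]"
  let ?init = "block [NConst (Dir 1) 1, NConst (Dir 2) (Suc D), NCopy (Dir 3) (Dir 0),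
      NConst (Dir 4) (8 + D), NConst (Dir 8) 0, add_multiple D 8 3, NAdd (Dir 5) (Dir 4) (Dir 8),
      NConst (Dir 10) 0]"
  have step: "Inv (Suc k) (exec ?body (N, R))" if k: "k < M" and inv: "Inv k (N, R)" for k N R
  proof -
    define i where "i = M - Suc k"
    have i: "M - k = Suc i" "i < M" using k by (auto simp: i_def)
    have N: "N 1 = 1" "N 2 = Suc D" "N 3 = n" "N 4 = 8 + D" "N 5 = 8 + D + M" "N 8 = Suc i" "N 10 = 0"
      and R: "\<And>x. x < 8 + D + Suc i \<Longrightarrow> R x = R0 x" "\<And>x. Suc i \<le> x \<Longrightarrow> x < M \<Longrightarrow> R (8 + D + x) = R0 x"
      using inv by (auto simp: Inv_def i)
    define R' where "R' = R(8 + D + i := R i)"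
    have "exec ?body (N, R) = (N(8 := i, 9 := i + (8 + D)), R(i + (8 + D) := R i))"
      using N by (simp add: exec_Pair_simps)
    also have "i + (8 + D) = 8 + D + i" by simp
    finally have ex: "exec ?body (N, R) = (N(8 := i, 9 := 8 + D + i), R')" unfolding R'_def .
    have "R' x = R0 x" if "x < 8 + D + i" for x using that R(1)[of x] by (simp add: R'_def)
    moreover have "R' (8 + D + x) = R0 x" if "i \<le> x" "x < M" for x
      using that R(1)[of i] R(2)[of x] by (cases "x = i") (auto simp: R'_def)
    ultimately show ?thesis
      unfolding ex Inv_def prod.case i_def[symmetric] using N by simp
  qed
  have loop: "runs (While (NLess (Dir 10) (Dir 8)) ?body) (exec ?init (N0, R0)) (M * (6 + 2) + 1) (Inv M)"
  proof (rule runs_While)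
    show "holds (NLess (Dir 10) (Dir 8)) s \<and> runs ?body s 6 (Inv (Suc k))" if "k < M" "Inv k s" for k s
    proof
      show "holds (NLess (Dir 10) (Dir 8)) s"
        using that by (cases s) (auto simp: Inv_def exec_Pair_simps)
      show "runs ?body s 6 (Inv (Suc k))"
        using step[OF that(1), of "fst s" "snd s"] that(2) by (intro runs_straight) auto
    qed
    show "Inv 0 (exec ?init (N0, R0))"
      by (simp add: Inv_def exec_Pair_simps exec_add_multiple N0 M_def mult.commute)
  qed (auto simp: Inv_def exec_Pair_simps)
  have post: "layout hs N R" if "Inv M (N, R)" for N R
  proof -
    have "R (8 + D + i * D + j) = R0 (i * D + j)" if "i < n" "j \<le> CARD('d)" for i j
      using \<open>Inv M (N, R)\<close> ineq_in_ineqs_bound[OF that(1), of "CARD('d)"] that(2)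
      by (auto simp: Inv_def M_def D_def add.assoc)
    then have "half_spaces_at hs R (8 + D)"
      unfolding half_spaces_at_def D_def[symmetric] n_def[symmetric] by (simp add: entry)
    then show ?thesis
      using that by (simp add: layout_def Inv_def D_def n_def M_def)
  qed
  show ?thesis
    unfolding load_input_def input D_def[symmetric] n_def[symmetric]
    by (rule runs_weaken[OF runs_Seq_straight[OF _ loop]]) (auto simp: post M_def)
qed

theorem corollary4p0p4:
  fixes K :: "(real ^ 'd::finite) set" and \<epsilon> :: real
  assumes "polytope K" and "interior K \<noteq> {}" and "\<epsilon> > 0"
  shows "\<exists>(p :: prog) (C :: real). \<forall>(hs :: ((real ^ 'd) \<times> real) list) P.
    (\<forall>(a, b)\<in>set hs. a \<noteq> 0) \<and> P = halfspaces_Int hs \<and> polytope P \<and> P \<noteq> {} \<longrightarrow>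
      expected_time p (input hs) \<le> ennreal (C * real (length hs)) \<and>
      (\<forall>\<beta>\<in>outputs p (input hs). \<bar>\<beta> - alpha K P\<bar> \<le> \<epsilon> * alpha K P)"
proof -
  let ?D = "Suc CARD('d)"
  obtain V where "finite V" "K = convex hull V" using assms(1) by (auto simp: polytope_def)
  then obtain vs where K: "K = convex hull set vs" using finite_list by metis
  obtain k1 where k1: "k1 \<in> K" using assms(2) interior_subset by blast
  have "\<not> K \<subseteq> {k1}" using assms(2) interior_mono[of K "{k1}"] by auto
  then obtain k2 where k2: "k2 \<in> K" "k1 \<noteq> k2" by blast
  obtain As where As: "\<And>A. A \<in> set As \<Longrightarrow> orthogonal_matrix A"
      "\<And>P A r. orthogonal_matrix A \<Longrightarrow> fits K P A r \<Longrightarrow> \<exists>B\<in>set As. fits K P B (r / (1 + \<epsilon>))"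
    using finite_rotations[OF polytope_imp_convex[OF assms(1)] polytope_imp_bounded[OF assms(1)]
        assms(2,3)] by blast
  define uss where "uss = map (\<lambda>A. map ((*v) A) vs) As"
  have "\<forall>us\<in>set uss. us \<noteq> []" using k1 K by (auto simp: uss_def)
  moreover obtain q where "solver ?D 10 1 q" using ex_linear_solver by blast
  ultimately obtain c where c: "\<And>hs N R. layout hs N R \<Longrightarrow> hs \<noteq> [] \<Longrightarrow> 0 \<le> R 7 \<Longrightarrow>
    runs (all_rotations q uss) (N, R) (c * length hs)
      (\<lambda>(N', R'). R' 7 = fold (\<lambda>us \<beta>. max \<beta> (rotation_value hs us)) uss (R 7))"
    using runs_all_rotations[of q uss] by auto
  define p where "p = Seq (load_input ?D) (Seq (RConst (Dir 7) 0) (Seq (all_rotations q uss)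
    (RCopy (Dir 0) (Dir 7))))"
  define c0 where "c0 = steps (add_multiple ?D 8 3) + 30 + 8 * ?D"
  have run: "runs p (input hs) ((c0 + c) * length hs) (\<lambda>s. snd s 0 = best_value hs uss)"
    if "hs \<noteq> []" for hs
  proof -
    have n: "1 \<le> length hs" using that by (simp add: Suc_le_eq)
    have rotations: "runs (all_rotations q uss) (exec (RConst (Dir 7) 0) s) (c * length hs)
        (\<lambda>(N, R). R 7 = best_value hs uss)" if s: "case s of (N, R) \<Rightarrow> layout hs N R" for s
    proof (cases s)
      case (Pair N R)
      have "layout hs N (R(7 := 0))"
        by (rule layout_cong[of hs N R]) (use s in \<open>auto simp: Pair layout_def\<close>)
      from c[OF this \<open>hs \<noteq> []\<close>] show ?thesis
        by (simp add: Pair exec_Pair_simps best_value_def)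
    qed
    have copy: "runs (RCopy (Dir 0) (Dir 7)) s 1 (\<lambda>s. snd s 0 = best_value hs uss)"
      if "case s of (N, R) \<Rightarrow> R 7 = best_value hs uss" for s
      using that by (intro runs_straight) (auto simp: exec_Pair_simps split: prod.splits)
    have "steps (add_multiple ?D 8 3) \<le> steps (add_multiple ?D 8 3) * length hs" "30 \<le> 30 * length hs"
      using n by simp_all
    then have "steps (add_multiple ?D 8 3) + 20 + length hs * (8 * ?D) + 1 +
        (1 + 1 + (c * length hs + 1 + 1)) \<le> (c0 + c) * length hs"
      unfolding c0_def add_mult_distrib mult.commute[of "length hs"] by linarith
    then show ?thesis
      unfolding p_def
      by (intro runs_weaken[OF runs_Seq[OF runs_load_input runs_Seq_straight[OF _
            runs_Seq[OF rotations copy]]]]) simp_all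
  qed
  have "expected_time p (input hs) \<le> ennreal (real (c0 + c) * real (length hs)) \<and>
      (\<forall>\<beta>\<in>outputs p (input hs). \<bar>\<beta> - alpha K P\<bar> \<le> \<epsilon> * alpha K P)"
    if P: "P = halfspaces_Int hs" "polytope P" "P \<noteq> {}" for hs P
  proof
    have "hs \<noteq> []"
      using P(1) polytope_imp_bounded[OF P(2)] by (auto simp: halfspaces_Int_def not_bounded_UNIV)
    note run = run[OF this]
    show "expected_time p (input hs) \<le> ennreal (real (c0 + c) * real (length hs))"
      using runs_expected_time[OF run] by (simp add: ennreal_of_nat_eq_real_of_nat)
    have "\<bar>best_value hs uss - alpha K P\<bar> \<le> \<epsilon> * alpha K P"
      unfolding uss_def
      by (rule best_value_approximates[OF K k1 k2 P(1) polytope_imp_compact[OF P(2)] P(3) assms(3) As])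
    then show "\<forall>\<beta>\<in>outputs p (input hs). \<bar>\<beta> - alpha K P\<bar> \<le> \<epsilon> * alpha K P"
      using runs_outputs[OF run] by metis
  qed
  then show ?thesis by (intro exI[of _ p] exI[of _ "real (c0 + c)"]) blast
qed

end
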